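(* Let $K$ be a field of characteristic zero. Let $\alpha\in K((T^{-1}))$ be algebraic over $K(T)$ of degree $d\ge 2$. Then there is a positive constant $C$, depending only on $\alpha$, such that for every real $\varepsilon$ with $0<\varepsilon\le\frac13$, the number of solutions of $$\left|\alpha-\frac pq\right|<\frac{1}{|q|^{2+\varepsilon}}$$ with $p,q\in K[T]$, $q\ne 0$, $\gcd(p,q)=1$, counted modulo simultaneous multiplication of $(p,q)$ by elements of $K^\times$, is less than $\exp(Cd^2\varepsilon^{-2})$.
   Context: $K((T^{-1}))$ is the field of formal Laurent series in $T^{-1}$ over $K$, i.e. the completion of $K(T)$ for the ultrametric absolute value $|a/b|=\mu^{\deg a-\deg b}$ (for nonzero $a,b\in K[T]$), $|0|=0$, where $\mu>1$ is a fixed real number; the absolute value is extended to $K((T^{-1}))$. Solutions $(p,q)$ and $(cp,cq)$ with $c\in K^\times$ are identified. *)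

theory Defs
  imports Complex_Main
    "HOL-Computational_Algebra.Formal_Laurent_Series"
    "HOL-Computational_Algebra.Fraction_Field"
begin

text \<open>
  The type \<open>'a fls\<close> plays the role of K((1/T)): its variable \<^const>\<open>fls_X\<close> is 1/T,
  so that T itself is \<^const>\<open>fls_X_inv\<close>.
\<close>

definition poly_fls :: "'a::field poly \<Rightarrow> 'a fls" where
  "poly_fls p = poly (map_poly fls_const p) fls_X_inv"

lemma poly_fls_0 [simp]: "poly_fls 0 = 0"
  by (simp add: poly_fls_def)

lemma poly_fls_pCons: "poly_fls (pCons a p) = fls_const a + fls_X_inv * poly_fls p"
  by (simp add: poly_fls_def map_poly_pCons)

lemma poly_fls_1 [simp]: "poly_fls 1 = 1"
  by (simp add: one_pCons poly_fls_pCons)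

lemma poly_fls_add: "poly_fls (p + q) = poly_fls p + poly_fls q"
proof (induction p q rule: poly_induct2)
  case (pCons a p b q)
  have "fls_const (a + b) = fls_const a + fls_const b"
    by (rule fls_plus_const [symmetric])
  then show ?case
    by (simp only: add_pCons poly_fls_pCons pCons.IH) (simp add: algebra_simps)
qed simp

lemma poly_fls_smult: "poly_fls (smult c p) = fls_const c * poly_fls p"
  by (induction p) (simp_all add: poly_fls_pCons algebra_simps flip: fls_const_mult_const)

lemma poly_fls_mult: "poly_fls (p * q) = poly_fls p * poly_fls q"
  by (induction p)
    (simp_all add: poly_fls_add poly_fls_smult poly_fls_pCons algebra_simps)

lemma poly_fls_nth: "fls_nth (poly_fls p) n = (if n \<le> 0 then coeff p (nat (- n)) else 0)"
proof (induction p arbitrary: n)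
  case (pCons a p)
  have "nat (- n) = Suc (nat (- (n + 1)))" if "n < 0"
    using that by linarith
  then show ?case
    by (auto simp: poly_fls_pCons fls_X_inv_times_conv_shift pCons.IH)
qed simp

lemma poly_fls_subdegree: "fls_subdegree (poly_fls p) = - int (degree p)"
proof (cases "p = 0")
  case False
  then show ?thesis
    by (intro fls_subdegree_eqI) (auto simp: poly_fls_nth coeff_eq_0)
qed simp

lemma poly_fls_eq_0_iff [simp]: "poly_fls p = 0 \<longleftrightarrow> p = 0"
proof
  assume "poly_fls p = 0"
  then have "fls_nth (poly_fls p) (- int (degree p)) = 0"
    by simp
  then show "p = 0"
    by (simp add: poly_fls_nth)
qed simp

text \<open>The embedding of K(T), represented as \<open>'a poly fract\<close>, into K((1/T)).\<close>

lift_definition ratfun_fls :: "'a::field poly fract \<Rightarrow> 'a fls"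
  is "\<lambda>(a, b). poly_fls a / poly_fls b"
  by (auto simp: frac_eq_eq simp flip: poly_fls_mult)

lemma ratfun_fls_Fract: "b \<noteq> 0 \<Longrightarrow> ratfun_fls (Fract a b) = poly_fls a / poly_fls b"
  by transfer simp

definition min_poly_over_ratfun :: "'a::field fls \<Rightarrow> 'a poly fract poly \<Rightarrow> bool" where
  "min_poly_over_ratfun \<alpha> P \<longleftrightarrow>
     lead_coeff P = 1 \<and> irreducible P \<and> poly (map_poly ratfun_fls P) \<alpha> = 0"

definition algebraic_of_degree :: "'a::field fls \<Rightarrow> nat \<Rightarrow> bool" where
  "algebraic_of_degree \<alpha> d \<longleftrightarrow> (\<exists>P. min_poly_over_ratfun \<alpha> P \<and> degree P = d)"

definition laurent_abs :: "real \<Rightarrow> 'a::field fls \<Rightarrow> real" where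
  "laurent_abs \<mu> f = (if f = 0 then 0 else \<mu> powi (- fls_subdegree f))"

lemma laurent_abs_ratfun:
  assumes "a \<noteq> 0" "b \<noteq> 0"
  shows "laurent_abs \<mu> (poly_fls a / poly_fls b) = \<mu> powi (int (degree a) - int (degree b))"
proof -
  have "poly_fls a = (poly_fls a / poly_fls b) * poly_fls b"
    using assms by simp
  then have "fls_subdegree (poly_fls a) =
      fls_subdegree (poly_fls a / poly_fls b) + fls_subdegree (poly_fls b)"
    using assms by (metis fls_subdegree_mult mult_eq_0_iff poly_fls_eq_0_iff)
  then have "- fls_subdegree (poly_fls a / poly_fls b) = int (degree a) - int (degree b)"
    by (simp add: poly_fls_subdegree)
  then show ?thesis
    using assms by (simp only: laurent_abs_def) simp
qed

definition approx_solutions :: "real \<Rightarrow> 'a::field fls \<Rightarrow> real \<Rightarrow> ('a poly \<times> 'a poly) set" where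
  "approx_solutions \<mu> \<alpha> \<epsilon> = {(p, q). q \<noteq> 0 \<and> coprime p q \<and>
     laurent_abs \<mu> (\<alpha> - poly_fls p / poly_fls q) < 1 / laurent_abs \<mu> (poly_fls q) powr (2 + \<epsilon>)}"

definition scalar_rel :: "(('a::field poly \<times> 'a poly) \<times> ('a poly \<times> 'a poly)) set" where
  "scalar_rel = {((p, q), (p', q')). \<exists>c. c \<noteq> 0 \<and> p' = smult c p \<and> q' = smult c q}"

lemma equiv_scalar_rel: "equiv UNIV (scalar_rel :: (('a::field poly \<times> 'a poly) \<times> _) set)"
  (is "equiv UNIV ?R")
proof (rule equivI)
  show "?R \<subseteq> UNIV \<times> UNIV"
    by simp
  show "refl ?R"
    by (auto simp: refl_on_def scalar_rel_def intro!: exI[of _ 1])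
  show "sym ?R"
  proof (rule symI)
    fix x y :: "'a poly \<times> 'a poly"
    assume "(x, y) \<in> scalar_rel"
    then obtain c p q where "c \<noteq> 0" "x = (p, q)" "y = (smult c p, smult c q)"
      by (auto simp: scalar_rel_def)
    then show "(y, x) \<in> scalar_rel"
      by (auto simp: scalar_rel_def intro!: exI[of _ "inverse c"])
  qed
  show "trans ?R"
  proof (rule transI)
    fix x y z :: "'a poly \<times> 'a poly"
    assume "(x, y) \<in> scalar_rel" "(y, z) \<in> scalar_rel"
    then obtain c d p q where "c \<noteq> 0" "d \<noteq> 0" "x = (p, q)"
      "z = (smult (d * c) p, smult (d * c) q)"
      by (auto simp: scalar_rel_def)
    then show "(x, z) \<in> scalar_rel"
      by (auto simp: scalar_rel_def intro!: exI[of _ "d * c"])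
  qed
qed

end

theory Submission
  imports Defs
    "HOL-Algebra.Algebraic_Closure_Type"
    "Jordan_Normal_Form.Char_Poly"
begin

text \<open>
  Let \<open>v\<close> be the order of vanishing at infinity, so that \<open>|x| = \<mu>\<close> to the power \<open>- v x\<close>. For every \<open>\<mu>\<close>,
  a solution \<open>p/q\<close> different from \<open>\<alpha>\<close> satisfies \<open>v (\<alpha> - p/q) > (2 + \<epsilon>) deg q\<close>. A difference of two
  distinct fractions with denominators of degree \<open>n\<close> has order at most \<open>2 n\<close>, so two solutions with
  denominators of equal degree agree up to a scalar (\<open>equal_degree_solutions\<close>). The number of classes
  is therefore at most one more than the largest degree of a denominator, and it is enough to prove
  \<open>deg q \<le> M / \<epsilon>^3\<close> with \<open>M\<close> depending on \<open>\<alpha>\<close> only (\<open>solution_degree_bound\<close>); this is far below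
  \<open>exp (C d^2 / \<epsilon>^2)\<close>.
  
  The bound on degrees is an effective Roth theorem. In characteristic zero it has a Wronskian proof,
  found by Steinmetz for small functions in Nevanlinna theory. Pass to an algebraically closed
  constant field \<open>K\<close> and multiply \<open>\<alpha>\<close> by a denominator: it becomes a root of a monic separable
  polynomial \<open>P\<close> over \<open>K[T]\<close>. By Puiseux's theorem all roots \<open>\<rho> 0, \<dots>, \<rho> (d - 1)\<close> of \<open>P\<close> lie in one
  field of Laurent series in a root \<open>s\<close> of \<open>1/T\<close>. This field carries the order \<open>v\<close> and the derivation
  \<open>d/dT\<close>, whose constants are \<open>K\<close>.
  
  Let \<open>V r\<close> be the \<open>K\<close>-span of the monomials of weight at most \<open>r\<close> in \<open>T\<close> (of weight 1) and the roots
  (of a fixed weight \<open>c\<close>). Its dimension grows at most linearly in \<open>r\<close>, so some \<open>r = O(1/\<epsilon>^2)\<close> has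
  \<open>dim V (r + c) \<le> (1 + \<epsilon>/2) dim V r\<close> (\<open>linear_growth_ratio\<close>). Choose bases \<open>\<beta>\<close> of \<open>V (r + c)\<close> and \<open>b\<close>
  of \<open>V r\<close>, with \<open>k\<close> and \<open>n\<close> elements, and consider the Wronskian \<open>W\<close> of the functions \<open>q \<beta> j\<close>
  and \<open>p b i\<close>. As \<open>\<alpha> b i\<close> lies in \<open>V (r + c)\<close>, a column operation replaces \<open>p b i\<close> by \<open>(p - q \<alpha>) b i\<close>,
  which has order at least \<open>(1 + \<epsilon>) deg q - O(r)\<close>. Hence \<open>W\<close> has order at least
  \<open>(n (1 + \<epsilon>) - k) deg q - O(n r + n^2)\<close> (\<open>ord_wronskian_approx\<close>), where \<open>n (1 + \<epsilon>) - k \<ge> n \<epsilon> / 2\<close>.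
  
  In the other direction, \<open>W\<close> is a polynomial in the roots over \<open>K[T]\<close>, if the derivation \<open>d/dT\<close> is
  multiplied by a suitable polynomial in \<open>T\<close> beforehand. Substitute roots for roots
  according to any self-map of the index set: the result either vanishes or obeys the same lower bound
  for the order. The sum over all substitutions of the \<open>m\<close>-th powers is symmetric, hence lies in
  \<open>K[T]\<close> (\<open>tuple_sum_rational\<close>), and a nonzero polynomial in \<open>T\<close> has order at most 0. As long as \<open>W\<close>
  is not zero, some \<open>m\<close> makes the sum nonzero (\<open>exists_power_sum_nonzero\<close>), and \<open>deg q\<close> is bounded
  (\<open>nonvanishing_bound\<close>).
  
  If \<open>W = 0\<close>, the functions are linearly dependent over \<open>K\<close>, which gives \<open>q v' = p v\<close> with \<open>v\<close> in
  \<open>V r\<close>, \<open>v'\<close> in \<open>V (r + c)\<close> and \<open>v\<close> nonzero. As \<open>p\<close> and \<open>q\<close> are coprime, \<open>q\<close> divides \<open>v\<close> in the ring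
  generated by \<open>T\<close> and the roots, so \<open>deg q \<le> r + O(1)\<close> (\<open>degree_divisor_bound\<close>, \<open>vanishing_bound\<close>).
\<close>

hide_const (open) Polynomials.degree Polynomials.lead_coeff UnivPoly.coeff UnivPoly.monom
  up_ring.coeff up_ring.monom Module.smult Coset.order Divisibility.prime Divisibility.irreducible

section \<open>Hensel lifting of factorizations over power series\<close>

lemma coprime_poly_bezout:
  fixes p q :: "'a::field poly"
  assumes "coprime p q"
  obtains x y where "x * p + y * q = 1"
proof -
  have "\<exists>x y. x * p + y * q = 1"
    using assms
  proof (induction "euclidean_size q" arbitrary: p q rule: less_induct)
    case less
    show ?case
    proof (cases "q = 0")
      case True
      then have "p dvd 1"
        using less.prems by simp
      then obtain x where "1 = p * x"
        by (elim dvdE)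
      then show ?thesis
        using True by (intro exI[of _ x] exI[of _ 0]) (simp add: mult.commute)
    next
      case False
      have "coprime q (p mod q)"
      proof (rule coprimeI)
        fix c assume c: "c dvd q" "c dvd p mod q"
        then have "c dvd p"
          by (simp add: dvd_mod_iff)
        then show "is_unit c"
          using c(1) less.prems by (meson coprime_common_divisor)
      qed
      then obtain x y where "x * q + y * (p mod q) = 1"
        using less.hyps[of "p mod q" q] mod_size_less[OF False] by blast
      moreover have "p mod q = p - (p div q) * q"
        by (simp add: minus_div_mult_eq_mod)
      ultimately have "y * p + (x - y * (p div q)) * q = 1"
        by (simp add: algebra_simps)
      then show ?thesis by blast
    qed
  qed
  then show ?thesis using that by blast
qed

text \<open>
  The coefficients of the lifted factors are found one after the other: the \<open>n\<close>-th equation reads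
  \<open>g0 * h n + g n * h0 = R\<close>, where \<open>R\<close> involves earlier coefficients only. It is solved by the identity of Bezout,
  and reducing \<open>g n\<close> modulo \<open>g0\<close> keeps the degrees below those of \<open>g0\<close> and \<open>h0\<close>.
\<close>

lemma hensel_coefficients:
  fixes F :: "nat \<Rightarrow> 'a::field poly"
  assumes F0: "F 0 = g0 * h0" and cop: "coprime g0 h0"
    and dg: "degree g0 > 0" and dh: "degree h0 > 0"
    and dF: "\<And>n. n > 0 \<Longrightarrow> degree (F n) < degree g0 + degree h0"
  shows "\<exists>g h. g 0 = g0 \<and> h 0 = h0 \<and> (\<forall>n>0. degree (g n) < degree g0 \<and> degree (h n) < degree h0) \<and>
           (\<forall>n. F n = (\<Sum>i\<le>n. g i * h (n - i)))"
proof -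
  obtain x y where xy: "x * g0 + y * h0 = 1"
    using cop by (rule coprime_poly_bezout)
  define P where "P = (\<lambda>f n r. if n = 0 then r = (g0, h0) else
      degree (fst r) < degree g0 \<and> degree (snd r) < degree h0 \<and>
      g0 * snd r + fst r * h0 = F n - (\<Sum>i\<in>{1..<n}. fst (f i) * snd (f (n - i))))"
  have solve: "\<exists>r. P f n r" if IH: "\<And>m. m < n \<Longrightarrow> P f m (f m)" for f and n :: nat
  proof (cases "n = 0")
    case False
    define R where "R = F n - (\<Sum>i\<in>{1..<n}. fst (f i) * snd (f (n - i)))"
    have "degree (fst (f i) * snd (f (n - i))) < degree g0 + degree h0" if "i \<in> {1..<n}" for i
      using IH[of i] IH[of "n - i"] that degree_mult_le[of "fst (f i)" "snd (f (n - i))"]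
      by (auto simp: P_def split: if_splits)
    then have degR: "degree R < degree g0 + degree h0"
      unfolding R_def using dF[of n] False dg by (intro degree_diff_less degree_sum_less) auto
    define g where "g = (R * y) mod g0"
    have dgg: "degree g < degree g0"
      using degree_mod_less'[of g0 "R * y"] dg by (cases "g0 = 0"; cases "R * y mod g0 = 0") (auto simp: g_def)
    have "R - g * h0 = R * (x * g0 + y * h0) - g * h0"
      using xy by simp
    also have "\<dots> = g0 * (R * x + (R * y) div g0 * h0)"
      unfolding g_def minus_div_mult_eq_mod[symmetric] by (simp add: algebra_simps)
    finally obtain h where h: "R - g * h0 = g0 * h" by blast
    have "degree h < degree h0"
    proof (cases "h = 0")
      case False
      have "degree g0 + degree h = degree (g0 * h)"
        using False dg by (subst degree_mult_eq) auto
      also have "\<dots> = degree (R - g * h0)"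
        by (simp add: h)
      also have "\<dots> < degree g0 + degree h0"
        using degR degree_mult_le[of g h0] dgg by (intro degree_diff_less) auto
      finally show ?thesis by simp
    qed (use dh in auto)
    then show ?thesis
      using False dgg h unfolding P_def R_def[symmetric]
      by (intro exI[of _ "(g, h)"]) (auto simp: algebra_simps)
  qed (auto simp: P_def)
  have "\<exists>f. \<forall>n. P f n (f n)"
  proof (rule dependent_wf_choice[OF wf_less])
    fix f g :: "nat \<Rightarrow> 'a poly \<times> 'a poly" and n r
    assume "\<And>z. (z, n) \<in> {(x, y). x < y} \<Longrightarrow> f z = g z"
    then have "(\<Sum>i\<in>{1..<n}. fst (f i) * snd (f (n - i))) = (\<Sum>i\<in>{1..<n}. fst (g i) * snd (g (n - i)))"
      by (intro sum.cong) auto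
    then show "P f n r = P g n r"
      by (simp add: P_def)
  qed (use solve in auto)
  then obtain f where f: "\<And>n. P f n (f n)" by blast
  define g h where "g = (\<lambda>n. fst (f n))" and "h = (\<lambda>n. snd (f n))"
  have 0: "g 0 = g0" "h 0 = h0"
    using f[of 0] by (auto simp: P_def g_def h_def)
  have "F n = (\<Sum>i\<le>n. g i * h (n - i))" for n
  proof (cases "n = 0")
    case False
    have "(\<Sum>i\<le>n. g i * h (n - i)) = g 0 * h n + (\<Sum>i\<in>{1..<n}. g i * h (n - i)) + g n * h 0"
    proof -
      have "{..n} = insert 0 (insert n {1..<n})"
        using False by auto
      then show ?thesis
        using False by simp
    qed
    also have "\<dots> = F n"
      using f[of n] False 0 by (simp add: P_def g_def h_def algebra_simps)
    finally show ?thesis ..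
  qed (use 0 F0 in auto)
  moreover have "\<forall>n>0. degree (g n) < degree g0 \<and> degree (h n) < degree h0"
    using f by (auto simp: P_def g_def h_def)
  ultimately show ?thesis
    using 0 by blast
qed

text \<open>
  A sequence of polynomials of bounded degree is a power series with polynomial coefficients;
  transposing its array of coefficients gives a polynomial with power series coefficients.
\<close>

definition series_poly :: "nat \<Rightarrow> (nat \<Rightarrow> 'a::field poly) \<Rightarrow> 'a fls poly" where
  "series_poly D g = (\<Sum>i\<le>D. monom (fps_to_fls (Abs_fps (\<lambda>n. coeff (g n) i))) i)"

lemma coeff_series_poly:
  assumes "\<And>n. degree (g n) \<le> D"
  shows "coeff (series_poly D g) i = fps_to_fls (Abs_fps (\<lambda>n. coeff (g n) i))"
proof -
  have "coeff (series_poly D g) i = (if i \<le> D then fps_to_fls (Abs_fps (\<lambda>n. coeff (g n) i)) else 0)"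
    by (simp add: series_poly_def coeff_sum)
  moreover have "Abs_fps (\<lambda>n. coeff (g n) i) = 0" if "i > D"
    by (intro fps_ext) (simp add: coeff_eq_0[OF le_less_trans[OF assms that]])
  ultimately show ?thesis by auto
qed

lemma fps_to_fls_sum: "fps_to_fls (\<Sum>i\<in>A. f i) = (\<Sum>i\<in>A. fps_to_fls (f i))"
  by (induction A rule: infinite_finite_induct) simp_all

lemma series_poly_mult:
  assumes "\<And>n. degree (g n) \<le> D" "\<And>n. degree (h n) \<le> D'"
  shows "series_poly D g * series_poly D' h = series_poly (D + D') (\<lambda>n. \<Sum>i\<le>n. g i * h (n - i))"
proof (rule poly_eqI)
  fix i
  let ?s = "\<lambda>g i. Abs_fps (\<lambda>n. coeff (g n) i)"
  have deg: "degree (\<Sum>i\<le>n. g i * h (n - i)) \<le> D + D'" for n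
  proof (rule degree_sum_le)
    fix i
    show "degree (g i * h (n - i)) \<le> D + D'"
      using degree_mult_le[of "g i" "h (n - i)"] assms(1)[of i] assms(2)[of "n - i"] by linarith
  qed simp
  have "(\<Sum>a\<le>i. ?s g a * ?s h (i - a)) = ?s (\<lambda>n. \<Sum>i\<le>n. g i * h (n - i)) i"
  proof (rule fps_ext)
    fix n
    show "fps_nth (\<Sum>a\<le>i. ?s g a * ?s h (i - a)) n = fps_nth (?s (\<lambda>n. \<Sum>i\<le>n. g i * h (n - i)) i) n"
      by (simp add: fps_sum_nth fps_mult_nth coeff_sum coeff_mult atMost_atLeast0) (rule sum.swap)
  qed
  then have "(\<Sum>a\<le>i. fps_to_fls (?s g a) * fps_to_fls (?s h (i - a))) =
      fps_to_fls (?s (\<lambda>n. \<Sum>i\<le>n. g i * h (n - i)) i)"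
    by (simp flip: fps_to_fls_sum fls_times_fps_to_fls)
  then show "coeff (series_poly D g * series_poly D' h) i =
      coeff (series_poly (D + D') (\<lambda>n. \<Sum>i\<le>n. g i * h (n - i))) i"
    by (simp add: coeff_mult coeff_series_poly[OF assms(1)] coeff_series_poly[OF assms(2)] coeff_series_poly[OF deg])
qed

text \<open>
  As \<open>Q\<close> is monic, the terms of positive order in its coefficients form polynomials of smaller degree,
  as is required for lifting the factors coefficient by coefficient.
\<close>

lemma hensel_lift:
  fixes Q :: "'a::field fls poly"
  assumes integral: "\<And>i n. n < 0 \<Longrightarrow> fls_nth (coeff Q i) n = 0"
    and monic: "lead_coeff Q = 1"
    and red: "map_poly (\<lambda>x. fls_nth x 0) Q = g0 * h0"
    and cop: "coprime g0 h0"
    and dg: "degree g0 > 0" and dh: "degree h0 > 0"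
  shows "\<exists>G H. Q = G * H \<and> degree G > 0 \<and> degree H > 0"
proof -
  define F where "F = (\<lambda>n::nat. map_poly (\<lambda>x. fls_nth x (int n)) Q)"
  have cF: "coeff (F n) i = fls_nth (coeff Q i) (int n)" for n i
    by (simp add: F_def coeff_map_poly)
  have "degree (F 0) = degree Q"
    using monic by (intro antisym le_degree degree_le) (auto simp: cF coeff_eq_0)
  then have deg: "degree Q = degree g0 + degree h0"
    using red dg dh degree_mult_eq[of g0 h0] by (cases "g0 = 0"; cases "h0 = 0") (auto simp: F_def)
  have dF: "degree (F n) < degree g0 + degree h0" if "n > 0" for n
  proof -
    have "degree (F n) \<le> degree Q - 1"
    proof (rule degree_le, intro allI impI)
      fix i assume "i > degree Q - 1"
      then consider "i = degree Q" | "i > degree Q" by linarith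
      then show "coeff (F n) i = 0"
        using that monic by cases (auto simp: cF coeff_eq_0)
    qed
    then show ?thesis
      using deg dg by linarith
  qed
  have "F 0 = g0 * h0"
    using red by (simp add: F_def)
  then obtain g h where gh: "g 0 = g0" "h 0 = h0"
    "\<forall>n>0. degree (g n) < degree g0 \<and> degree (h n) < degree h0"
    "\<And>n. F n = (\<Sum>i\<le>n. g i * h (n - i))"
    using hensel_coefficients[where F = F, OF _ cop dg dh dF] by metis
  have dgn: "degree (g n) \<le> degree g0" and dhn: "degree (h n) \<le> degree h0" for n
    by (cases "n = 0"; use gh(1-3) in \<open>simp add: less_imp_le\<close>)+
  have dFn: "degree (F n) \<le> degree Q" for n
    by (rule degree_le) (simp add: cF coeff_eq_0)
  have "Q = series_poly (degree Q) F"
    using integral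
    by (intro poly_eqI fls_eqI) (simp add: coeff_series_poly dFn cF not_less)
  also have "F = (\<lambda>n. \<Sum>i\<le>n. g i * h (n - i))"
    using gh(4) by auto
  also have "series_poly (degree Q) \<dots> = series_poly (degree g0) g * series_poly (degree h0) h"
    by (simp add: series_poly_mult dgn dhn deg)
  finally have Q: "Q = series_poly (degree g0) g * series_poly (degree h0) h" .
  have nz: "coeff (series_poly (degree g0) g) (degree g0) \<noteq> 0"
    "coeff (series_poly (degree h0) h) (degree h0) \<noteq> 0"
    unfolding coeff_series_poly[OF dgn] coeff_series_poly[OF dhn] fps_to_fls_eq_0_iff fps_eq_iff
    using gh(1,2) dg dh by (auto intro!: exI[of _ 0])
  then have "degree (series_poly (degree g0) g) > 0" "degree (series_poly (degree h0) h) > 0"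
    using dg dh le_degree by fastforce+
  then show ?thesis
    using Q by blast
qed

section \<open>Puiseux expansions\<close>

lemma pcompose_monom: "pcompose (monom a i) r = smult a (r ^ i)"
  for a :: "'a::comm_semiring_1"
  by (induction i) (simp_all add: monom_0 monom_Suc pcompose_pCons)

text \<open>
  Tschirnhaus substitution: translating by the mean of the roots makes the sum of the roots vanish.
\<close>

lemma coeff_tschirnhaus:
  fixes P :: "'a::{field,ring_char_0} poly"
  assumes n: "degree P = n" "n > 0" and monic: "lead_coeff P = 1"
  shows "coeff (pcompose P [:- (coeff P (n - 1) / of_nat n), 1:]) (n - 1) = 0"
proof -
  define r where "r = [:- (coeff P (n - 1) / of_nat n), 1:]"
  have "pcompose P r = pcompose (\<Sum>i\<le>n. monom (coeff P i) i) r"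
    using poly_as_sum_of_monoms[of P] n by simp
  also have "\<dots> = (\<Sum>i\<le>n. smult (coeff P i) (r ^ i))"
    by (simp add: pcompose_sum pcompose_monom)
  finally have "coeff (pcompose P r) (n - 1) = (\<Sum>i\<le>n. coeff P i * coeff (r ^ i) (n - 1))"
    by (simp add: coeff_sum)
  also have "\<dots> = (\<Sum>i\<in>{n - 1, n}. coeff P i * coeff (r ^ i) (n - 1))"
  proof (rule sum.mono_neutral_right)
    show "\<forall>i\<in>{..n} - {n - 1, n}. coeff P i * coeff (r ^ i) (n - 1) = 0"
    proof
      fix i assume "i \<in> {..n} - {n - 1, n}"
      then have "degree (r ^ i) < n - 1"
        by (auto simp: r_def degree_linear_power)
      then show "coeff P i * coeff (r ^ i) (n - 1) = 0"
        by (simp add: coeff_eq_0)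
    qed
  qed auto
  also have "\<dots> = coeff P (n - 1) + of_nat n * (- (coeff P (n - 1) / of_nat n))"
  proof -
    have "coeff (r ^ (n - 1)) (n - 1) = 1"
      by (simp add: r_def coeff_linear_power)
    moreover have "coeff (r ^ n) (n - 1) = of_nat n * (- (coeff P (n - 1) / of_nat n))"
      using n(2) unfolding r_def by (cases n; subst coeff_linear_poly_power) auto
    moreover have "n - 1 \<noteq> n" "coeff P n = 1"
      using n monic by auto
    ultimately show ?thesis by simp
  qed
  also have "\<dots> = 0"
    using n(2) by simp
  finally show ?thesis by (simp add: r_def)
qed

lemma field_hom_fls_compose_power:
  assumes "e > 0"
  shows "field_hom (\<lambda>x::'a::field fls. fls_compose_power x e)"
  by standard (use assms in auto)

lemma subdegree_compose_power:
  assumes "e > 0"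
  shows "fls_subdegree (fls_compose_power f e) = int e * fls_subdegree f"
proof (cases "f = 0")
  case False
  show ?thesis
  proof (rule fls_subdegree_eqI)
    show "fls_nth (fls_compose_power f e) (int e * fls_subdegree f) \<noteq> 0"
      using assms False by (simp add: fls_nth_compose_power)
    fix k assume k: "k < int e * fls_subdegree f"
    show "fls_nth (fls_compose_power f e) k = 0"
    proof (cases "int e dvd k")
      case True
      then obtain j where "k = int e * j" by (elim dvdE)
      then show ?thesis
        using k assms by (simp add: fls_nth_compose_power)
    qed (use assms in \<open>simp add: fls_nth_compose_power\<close>)
  qed
qed (use assms in auto)

text \<open>
  If all roots were equal to \<open>x\<close>, the coefficient at \<open>n - 1\<close> would be \<open>- n x\<close>, so \<open>x\<close> would vanish and
  \<open>q\<close> would be a power of the variable.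
\<close>

lemma poly_two_roots:
  fixes q :: "'k::{alg_closed_field,field_char_0} poly"
  assumes n: "degree q = n" "n > 0" and monic: "lead_coeff q = 1" and c: "coeff q (n - 1) = 0"
    and nz: "q \<noteq> monom 1 n"
  shows "\<exists>x y. x \<noteq> y \<and> poly q x = 0 \<and> poly q y = 0"
proof (rule ccontr)
  assume *: "\<not> ?thesis"
  obtain A where A: "size A = degree q" "q = smult (lead_coeff q) (\<Prod>x\<in>#A. [:- x, 1:])"
    using alg_closed_imp_factorization[of q] n by fastforce
  obtain x where x: "poly q x = 0"
    using alg_closed_imp_poly_has_root[of q] n by auto
  have "y = x" if "y \<in># A" for y
  proof -
    have "poly q y = 0"
      using that by (subst A(2)) (auto simp: poly_prod_mset)
    then show ?thesis using * x by blast
  qed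
  then have "A = replicate_mset n x"
    using A(1) n by (metis set_mset_subset_singletonD subsetI singletonI subset_singletonD insertI1 singleton_iff)
  then have q: "q = [:- x, 1:] ^ n"
    using A(2) monic by simp
  have "coeff q (n - 1) = - (of_nat n * x)"
    unfolding q using n(2) by (cases n; subst coeff_linear_poly_power) auto
  then have "x = 0"
    using c n(2) by simp
  then show False
    using nz q by (simp add: monom_altdef)
qed

text \<open>
  One step of the Newton--Puiseux algorithm. After a Tschirnhaus substitution, scale the variable by
  the power of the series variable that is given by the least slope of the Newton polygon, which is
  an integer after the ramification \<open>e\<close>. The coefficients become integral and the reduction is not a
  power of a linear polynomial (\<open>poly_two_roots\<close>), so that it has two coprime factors, which Hensel
  lifting carries back.
\<close>

lemma puiseux_factor:
  fixes P :: "'k::{alg_closed_field,field_char_0} fls poly"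
  assumes monic: "lead_coeff P = 1" and n: "degree P = n" "n \<ge> 2"
  shows "\<exists>e>0. \<exists>G H. map_poly (\<lambda>x. fls_compose_power x e) P = G * H \<and> degree G > 0 \<and> degree H > 0"
proof -
  define c where "c = - (coeff P (n - 1) / of_nat n)"
  define Q where "Q = pcompose P [:c, 1:]"
  have PQ: "P = pcompose Q [:- c, 1:]"
    unfolding Q_def by (simp add: pcompose_pCons flip: pcompose_assoc)
  have dQ: "degree Q = n"
    using n by (simp add: Q_def degree_pcompose)
  have mQ: "lead_coeff Q = 1"
    unfolding Q_def using monic by (subst lead_coeff_comp) auto
  have cQ: "coeff Q (n - 1) = 0"
    using coeff_tschirnhaus[of P n] monic n unfolding Q_def c_def by simp
  have "\<exists>e>0. \<exists>G H. map_poly (\<lambda>x. fls_compose_power x e) Q = G * H \<and> degree G > 0 \<and> degree H > 0"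
  proof (cases "\<forall>i<n. coeff Q i = 0")
    case True
    have "Q = monom 1 n"
    proof (rule poly_eqI)
      fix i show "coeff Q i = coeff (monom 1 n) i"
        using True mQ dQ by (cases i n rule: linorder_cases) (auto simp: coeff_eq_0)
    qed
    also have "monom 1 n = [:0, 1:] * monom (1 :: 'k fls) (n - 1)"
      using n(2) by (simp add: monom_altdef flip: power_Suc)
    finally have Q: "Q = [:0, 1:] * monom 1 (n - 1)" .
    have "(\<lambda>x::'k fls. fls_compose_power x 1) = (\<lambda>x. x)"
      by (intro ext fls_eqI) (simp add: fls_nth_compose_power)
    then have "map_poly (\<lambda>x. fls_compose_power x 1) Q = [:0, 1:] * monom 1 (n - 1)"
      using Q by (simp add: map_poly_idI)
    moreover have "degree [:0, 1 :: 'k fls:] > 0" "degree (monom (1 :: 'k fls) (n - 1)) > 0"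
      using n(2) by (simp_all add: degree_monom_eq)
    ultimately show ?thesis
      by (intro exI[of _ "1 :: nat"] conjI exI[of _ "[:0, 1 :: 'k fls:]"] exI[of _ "monom (1 :: 'k fls) (n - 1)"]) simp_all
  next
    case False
    define I where "I = {i. i < n \<and> coeff Q i \<noteq> 0}"
    define val where "val = (\<lambda>i. fls_subdegree (coeff Q i))"
    \<comment> \<open>The points \<open>(n - i, val i)\<close> of the Newton polygon are compared by their slopes seen from the origin.\<close>
    define slope where "slope = (\<lambda>i. (of_int (val i) :: rat) / of_nat (n - i))"
    have I: "finite I" "I \<noteq> {}"
      using False by (auto simp: I_def)
    obtain k where k: "k \<in> I" "\<And>i. i \<in> I \<Longrightarrow> slope k \<le> slope i"
      using arg_min_if_finite[OF I, of slope] by (metis linorder_not_less)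
    define e where "e = n - k"
    define u where "u = val k"
    have e: "e > 0"
      using k by (simp add: e_def I_def)
    have ineq: "u * int (n - i) \<le> int e * val i" if "i \<in> I" for i
    proof -
      have "of_int u / of_nat e \<le> (of_int (val i) :: rat) / of_nat (n - i)"
        using k(2)[OF that] by (simp add: slope_def u_def e_def)
      moreover have "n - i > 0"
        using that by (simp add: I_def)
      ultimately have "of_int u * of_nat (n - i) \<le> (of_int (val i) :: rat) * of_nat e"
        using e by (simp add: field_simps)
      then have "of_int (u * int (n - i)) \<le> (of_int (int e * val i) :: rat)"
        by (simp add: mult.commute)
      then show ?thesis
        by (simp only: of_int_le_iff)
    qed
    interpret cp: field_hom "\<lambda>x::'k fls. fls_compose_power x e"
      by (rule field_hom_fls_compose_power) (rule e)
    define Q1 where "Q1 = map_poly (\<lambda>x. fls_compose_power x e) Q"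
    define Z :: "int \<Rightarrow> 'k fls" where "Z = fls_X_intpow"
    have Z: "Z (a + b) = Z a * Z b" "Z 0 = 1" "Z a \<noteq> 0" for a b
      by (simp_all add: Z_def fls_X_intpow_times_fls_X_intpow)
    have Zp: "Z a ^ m = Z (int m * a)" for a m
      by (induction m) (simp_all add: Z algebra_simps)
    \<comment> \<open>\<open>Q2\<close> has the coefficient \<open>Z (- u * (n - i))\<close> times that of \<open>Q1\<close> at \<open>i\<close>, and stays monic.\<close>
    define Q2 where "Q2 = smult (Z (- u * int n)) (pcompose Q1 [:0, Z u:])"
    have c1: "coeff Q1 i = fls_compose_power (coeff Q i) e" for i
      by (simp add: Q1_def)
    have c2: "coeff Q2 i = Z (- u * (int n - int i)) * fls_compose_power (coeff Q i) e" for i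
      by (simp add: Q2_def coeff_pcompose_linear c1 Zp algebra_simps flip: Z(1))
    have sub: "fls_subdegree (coeff Q2 i) = int e * val i - u * (int n - int i)" if "coeff Q i \<noteq> 0" for i
    proof -
      have "fls_subdegree (Z a) = a" for a
        by (simp add: Z_def)
      then show ?thesis
        using that e Z(3) unfolding c2 by (subst fls_subdegree_mult) (auto simp: subdegree_compose_power val_def)
    qed
    have Q2n: "coeff Q2 n = 1"
      using mQ dQ by (simp add: c2 Z)
    have dQ2: "degree Q2 = n"
    proof (rule antisym)
      show "degree Q2 \<le> n"
        by (rule degree_le) (simp add: c2 coeff_eq_0 dQ)
      show "n \<le> degree Q2"
        by (rule le_degree) (simp add: Q2n)
    qed
    have integral: "fls_nth (coeff Q2 i) m = 0" if "m < 0" for i m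
    proof (cases "coeff Q i = 0 \<or> i = n")
      case True
      then show ?thesis
        using that Q2n by (auto simp: c2)
    next
      case False
      then have i: "i \<in> I"
        using le_degree[of Q i] dQ by (auto simp: I_def)
      then have "fls_subdegree (coeff Q2 i) \<ge> 0"
        using ineq[OF i] by (subst sub) (auto simp: I_def of_nat_diff)
      then show ?thesis
        using that by (intro fls_eq0_below_subdegree) linarith
    qed
    define q where "q = map_poly (\<lambda>x. fls_nth x 0) Q2"
    have cq: "coeff q i = fls_nth (coeff Q2 i) 0" for i
      by (simp add: q_def coeff_map_poly)
    have dq: "degree q = n"
    proof (rule antisym)
      show "degree q \<le> n"
        by (rule degree_le) (simp add: cq coeff_eq_0 dQ2)
      show "n \<le> degree q"
        by (rule le_degree) (simp add: cq Q2n)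
    qed
    have mq: "lead_coeff q = 1"
      by (simp add: dq cq Q2n)
    have "coeff q k \<noteq> 0"
    proof -
      have kI: "coeff Q k \<noteq> 0" "k < n"
        using k(1) by (auto simp: I_def)
      then have "fls_subdegree (coeff Q2 k) = 0"
        by (subst sub) (auto simp: u_def e_def of_nat_diff)
      moreover have "coeff Q2 k \<noteq> 0"
        using kI(1) e by (simp add: c2 Z)
      ultimately show ?thesis
        using nth_fls_subdegree_nonzero[of "coeff Q2 k"] by (simp add: cq)
    qed
    then have nm: "q \<noteq> monom 1 n"
      using k(1) by (auto simp: I_def)
    have "coeff q (n - 1) = 0"
      using cQ by (simp add: cq c2)
    from poly_two_roots[OF dq _ mq this nm] n(2) obtain x y where "x \<noteq> y" "poly q x = 0" "poly q y = 0"
      by auto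
    then obtain r s where rs: "degree r > 0" "degree s > 0" "coprime r s" "q = r * s"
      using alg_closed_imp_poly_splits_coprime[of q x y] dq n(2) by auto
    obtain G H where GH: "Q2 = G * H" "degree G > 0" "degree H > 0"
      using hensel_lift[of Q2 r s] integral Q2n dQ2 rs by (auto simp: q_def)
    have "Q1 = smult (Z (u * int n)) (pcompose Q2 [:0, Z (- u):])"
    proof (rule poly_eqI)
      fix i
      show "coeff Q1 i = coeff (smult (Z (u * int n)) (pcompose Q2 [:0, Z (- u):])) i"
        by (simp add: coeff_pcompose_linear c1 c2 Zp algebra_simps Z(2) flip: Z(1) mult.assoc)
    qed
    also have "\<dots> = smult (Z (u * int n)) (pcompose G [:0, Z (- u):]) * pcompose H [:0, Z (- u):]"
      by (simp add: GH(1) pcompose_mult)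
    finally have "Q1 = smult (Z (u * int n)) (pcompose G [:0, Z (- u):]) * pcompose H [:0, Z (- u):]" .
    moreover have "degree (smult (Z (u * int n)) (pcompose G [:0, Z (- u):])) > 0"
      "degree (pcompose H [:0, Z (- u):]) > 0"
      using GH(2,3) Z(3) by (simp_all add: degree_pcompose)
    ultimately show ?thesis
      unfolding Q1_def using e by blast
  qed
  then obtain e G H where e: "e > 0" and GH: "map_poly (\<lambda>x. fls_compose_power x e) Q = G * H"
    "degree G > 0" "degree H > 0" by blast
  interpret cp: field_hom "\<lambda>x::'k fls. fls_compose_power x e"
    by (rule field_hom_fls_compose_power) (rule e)
  let ?s = "map_poly (\<lambda>x. fls_compose_power x e) [:- c, 1:]"
  have "degree ?s = 1" by simp
  then have "map_poly (\<lambda>x. fls_compose_power x e) P = pcompose G ?s * pcompose H ?s"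
    "degree (pcompose G ?s) > 0" "degree (pcompose H ?s) > 0"
    by (auto simp: PQ cp.map_poly_pcompose GH pcompose_mult degree_pcompose simp del: cp.degree_map_poly_hom)
  then show ?thesis
    using e by blast
qed

text \<open>
  Factors of positive degree are split further by induction; the two ramification indices that arise
  are multiplied to obtain a common one.
\<close>

theorem puiseux:
  fixes P :: "'k::{alg_closed_field,field_char_0} fls poly"
  assumes "P \<noteq> 0"
  shows "\<exists>e>0. \<exists>c A. map_poly (\<lambda>x. fls_compose_power x e) P = smult c (\<Prod>x\<in>#A. [:- x, 1:])"
  using assms
proof (induction "degree P" arbitrary: P rule: less_induct)
  case less
  consider "degree P = 0" | "degree P = 1" | "degree P \<ge> 2" by linarith
  then show ?case
  proof cases
    case 1
    then obtain a where "P = [:a:]"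
      by (elim degree_eq_zeroE)
    then have "map_poly (\<lambda>x. fls_compose_power x 1) P = smult (fls_compose_power a 1) (\<Prod>x\<in>#{#}. [:- x, 1:])"
      by (intro poly_eqI) (simp add: coeff_map_poly coeff_pCons split: nat.splits)
    then show ?thesis
      by (intro exI[of _ "1 :: nat"] conjI exI[of _ "fls_compose_power a 1"] exI[of _ "{#} :: 'k fls multiset"]) (assumption | simp)+
  next
    case 2
    obtain a b where P: "P = [:a, b:]" "b \<noteq> 0"
    proof
      show "P = [:coeff P 0, coeff P 1:]"
        using 2 by (intro poly_eqI) (auto simp: coeff_pCons coeff_eq_0 split: nat.splits)
      show "coeff P 1 \<noteq> 0"
        using 2 leading_coeff_0_iff[of P] by auto
    qed
    define e :: nat where "e = 1"
    then have e: "e > 0" by simp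
    let ?c = "\<lambda>x::'k fls. fls_compose_power x e"
    interpret cp: field_hom ?c
      by (rule field_hom_fls_compose_power) (rule e)
    have "map_poly ?c P = smult (?c b) (\<Prod>x\<in>#{# - ?c a / ?c b #}. [:- x, 1:])"
      using P by (simp add: map_poly_pCons)
    then show ?thesis
      using e by blast
  next
    case 3
    define l where "l = lead_coeff P"
    define P' where "P' = smult (inverse l) P"
    have l: "l \<noteq> 0"
      using less.prems by (simp add: l_def)
    then have P: "P = smult l P'" and P': "lead_coeff P' = 1" "degree P' = degree P"
      by (simp_all add: P'_def l_def)
    obtain e G H where e: "e > 0" and GH: "map_poly (\<lambda>x. fls_compose_power x e) P' = G * H"
      "degree G > 0" "degree H > 0"
      using puiseux_factor[OF P'(1) refl] P'(2) 3 by auto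
    interpret cp: field_hom "\<lambda>x::'k fls. fls_compose_power x e"
      by (rule field_hom_fls_compose_power) (rule e)
    have nz: "G \<noteq> 0" "H \<noteq> 0"
      using GH by auto
    have "degree P = degree (G * H)"
      unfolding GH(1)[symmetric] using P'(2) by simp
    then have deg: "degree P = degree G + degree H"
      using nz by (simp add: degree_mult_eq)
    obtain e1 c1 A1 where 1: "e1 > 0"
      "map_poly (\<lambda>x. fls_compose_power x e1) G = smult c1 (\<Prod>x\<in>#A1. [:- x, 1:])"
      using less.hyps[of G] deg GH nz by auto
    obtain e2 c2 A2 where 2: "e2 > 0"
      "map_poly (\<lambda>x. fls_compose_power x e2) H = smult c2 (\<Prod>x\<in>#A2. [:- x, 1:])"
      using less.hyps[of H] deg GH nz by auto
    define E where "E = e * e1 * e2"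
    have E: "E > 0"
      using e 1(1) 2(1) by (simp add: E_def)
    have comp: "fls_compose_power (fls_compose_power x a) b = fls_compose_power x (a * b)"
      if "a > 0" "b > 0" for a b and x :: "'k fls"
    proof (rule fls_eqI)
      fix m
      have "int (a * b) dvd m \<longleftrightarrow> int b dvd m \<and> int a dvd m div int b"
        using that by (auto simp: dvd_div_iff_mult mult.commute dest: dvd_mult_right dvd_mult_left)
      then show "fls_nth (fls_compose_power (fls_compose_power x a) b) m = fls_nth (fls_compose_power x (a * b)) m"
        using that by (auto simp: fls_nth_compose_power div_mult2_eq zdiv_zmult2_eq mult.commute[of "int a"])
    qed
    have mcomp: "map_poly (\<lambda>x. fls_compose_power x b) (map_poly (\<lambda>x. fls_compose_power x a) R) =
        map_poly (\<lambda>x. fls_compose_power x (a * b)) R" if "a > 0" "b > 0" for a b and R :: "'k fls poly"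
      using that by (intro poly_eqI) (simp add: coeff_map_poly comp)
    have lin: "map_poly (\<lambda>x. fls_compose_power x a) (smult c (\<Prod>x\<in>#A. [:- x, 1:])) =
        smult (fls_compose_power c a) (\<Prod>x\<in>#image_mset (\<lambda>x. fls_compose_power x a) A. [:- x, 1:])"
      if "a > 0" for a c and A :: "'k fls multiset"
    proof -
      interpret ca: field_hom "\<lambda>x::'k fls. fls_compose_power x a"
        by (rule field_hom_fls_compose_power) (rule that)
      interpret ma: map_poly_comm_ring_hom "\<lambda>x::'k fls. fls_compose_power x a" ..
      show ?thesis
        by (simp add: ca.map_poly_hom_smult ma.hom_prod_mset image_mset.compositionality o_def map_poly_pCons that)
    qed
    interpret m12: map_poly_comm_ring_hom "\<lambda>x::'k fls. fls_compose_power x (e1 * e2)"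
    proof -
      interpret c12: field_hom "\<lambda>x::'k fls. fls_compose_power x (e1 * e2)"
        by (rule field_hom_fls_compose_power) (use 1 2 in simp)
      show "map_poly_comm_ring_hom (\<lambda>x::'k fls. fls_compose_power x (e1 * e2))" ..
    qed
    interpret cE: field_hom "\<lambda>x::'k fls. fls_compose_power x E"
      by (rule field_hom_fls_compose_power) (rule E)
    have "map_poly (\<lambda>x. fls_compose_power x E) P' = map_poly (\<lambda>x. fls_compose_power x (e1 * e2)) (G * H)"
      unfolding GH(1)[symmetric] using e 1(1) 2(1) by (simp add: mcomp E_def mult.assoc)
    also have "\<dots> = map_poly (\<lambda>x. fls_compose_power x e2) (map_poly (\<lambda>x. fls_compose_power x e1) G) *
        map_poly (\<lambda>x. fls_compose_power x e1) (map_poly (\<lambda>x. fls_compose_power x e2) H)"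
      using 1(1) 2(1) by (simp add: m12.hom_mult mcomp mult.commute[of e2])
    also have "\<exists>c A. \<dots> = smult c (\<Prod>x\<in>#A. [:- x, 1:])"
      unfolding 1(2) 2(2) lin[OF 1(1)] lin[OF 2(1)]
      by (intro exI[of _ "fls_compose_power c1 e2 * fls_compose_power c2 e1"]
          exI[of _ "image_mset (\<lambda>x. fls_compose_power x e2) A1 + image_mset (\<lambda>x. fls_compose_power x e1) A2"])
         (simp add: mult_ac)
    finally obtain c A where cA: "map_poly (\<lambda>x. fls_compose_power x E) P' = smult c (\<Prod>x\<in>#A. [:- x, 1:])"
      by blast
    have "map_poly (\<lambda>x. fls_compose_power x E) P = smult (fls_compose_power l E * c) (\<Prod>x\<in>#A. [:- x, 1:])"
      by (subst P) (simp add: cE.map_poly_hom_smult cA)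
    then show ?thesis
      using E by blast
  qed
qed

section \<open>Order bounds for Laurent series\<close>

text \<open>
  The subdegree of the zero series is 0, not infinity. Lower bounds for the order are therefore
  expressed by a predicate, which holds for the zero series and every bound.
\<close>

definition ord_ge :: "'a::zero fls \<Rightarrow> int \<Rightarrow> bool" where
  "ord_ge x s \<longleftrightarrow> (\<forall>n<s. fls_nth x n = 0)"

lemma ord_ge_iff: "ord_ge x s \<longleftrightarrow> x = 0 \<or> s \<le> fls_subdegree x"
  unfolding ord_ge_def by (auto simp: fls_subdegree_geI) (meson linorder_not_less nth_fls_subdegree_nonzero)

lemma ord_ge_0 [simp]: "ord_ge 0 s"
  by (simp add: ord_ge_def)

lemma ord_ge_mono: "ord_ge x s \<Longrightarrow> t \<le> s \<Longrightarrow> ord_ge x t"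
  by (simp add: ord_ge_def)

lemma ord_ge_add: "ord_ge x s \<Longrightarrow> ord_ge y s \<Longrightarrow> ord_ge (x + y) s" for x :: "'a::monoid_add fls"
  by (simp add: ord_ge_def)

lemma ord_ge_sum: "(\<And>i. i \<in> I \<Longrightarrow> ord_ge (f i) s) \<Longrightarrow> ord_ge (\<Sum>i\<in>I. f i) s"
  for f :: "'b \<Rightarrow> 'a::comm_monoid_add fls"
  by (induction I rule: infinite_finite_induct) (auto intro: ord_ge_add)

lemma ord_ge_mult:
  fixes x :: "'a::idom fls"
  assumes "ord_ge x s" "ord_ge y t"
  shows "ord_ge (x * y) (s + t)"
  using assms by (cases "x = 0"; cases "y = 0") (auto simp: ord_ge_iff)

lemma ord_ge_1 [simp]: "ord_ge (1 :: 'a::idom fls) 0"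
  by (simp add: ord_ge_iff)

lemma ord_ge_const [simp]: "ord_ge (fls_const a) 0"
  by (simp add: ord_ge_def)

lemma ord_ge_prod:
  fixes f :: "'b \<Rightarrow> 'a::idom fls"
  assumes "\<And>i. i \<in> I \<Longrightarrow> ord_ge (f i) (s i)"
  shows "ord_ge (\<Prod>i\<in>I. f i) (\<Sum>i\<in>I. s i)"
  using assms by (induction I rule: infinite_finite_induct) (auto intro: ord_ge_mult)

lemma ord_ge_power: "ord_ge x s \<Longrightarrow> ord_ge (x ^ n) (int n * s)" for x :: "'a::idom fls"
  using ord_ge_prod[of "{..<n}" "\<lambda>_. x" "\<lambda>_. s"] by simp

section \<open>Linear algebra and growth\<close>

interpretation ksp: vector_space "\<lambda>(a::'k::field) (x::'k fls). fls_const a * x"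
  by standard (simp_all add: algebra_simps flip: fls_const_mult_const fls_plus_const)

lemma ksp_independent_family:
  fixes y :: "nat \<Rightarrow> 'k::field fls"
  assumes "\<And>\<kappa>. (\<Sum>j<n. fls_const (\<kappa> j) * y j) = 0 \<Longrightarrow> \<forall>j<n. \<kappa> j = 0"
  shows "inj_on y {..<n}" "ksp.independent (y ` {..<n})"
proof -
  show inj: "inj_on y {..<n}"
  proof (rule inj_onI, rule ccontr)
    fix a b assume ab: "a \<in> {..<n}" "b \<in> {..<n}" "y a = y b" "a \<noteq> b"
    define \<kappa> :: "nat \<Rightarrow> 'k" where "\<kappa> = (\<lambda>j. if j = a then 1 else if j = b then - 1 else 0)"
    have "(\<Sum>j<n. fls_const (\<kappa> j) * y j) = (\<Sum>j\<in>{a, b}. fls_const (\<kappa> j) * y j)"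
      using ab by (intro sum.mono_neutral_right) (auto simp: \<kappa>_def)
    also have "\<dots> = 0"
      using ab by (simp add: \<kappa>_def)
    finally have "\<kappa> a = 0"
      using assms ab(1) by blast
    then show False by (simp add: \<kappa>_def)
  qed
  show "ksp.independent (y ` {..<n})"
  proof (rule ksp.independent_if_scalars_zero)
    fix f x assume f: "(\<Sum>x\<in>y ` {..<n}. fls_const (f x) * x) = 0" and x: "x \<in> y ` {..<n}"
    from f have "(\<Sum>j<n. fls_const (f (y j)) * y j) = 0"
      by (simp add: sum.reindex[OF inj])
    from assms[OF this] x show "f x = 0" by auto
  qed simp
qed

lemma ksp_span_family:
  fixes y :: "nat \<Rightarrow> 'k::field fls"
  assumes "inj_on y {..<n}" "x \<in> ksp.span (y ` {..<n})"
  obtains \<kappa> where "x = (\<Sum>j<n. fls_const (\<kappa> j) * y j)"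
proof -
  have "x \<in> range (\<lambda>u. \<Sum>v\<in>y ` {..<n}. fls_const (u v) * v)"
    using assms(2) by (subst (asm) ksp.span_finite) auto
  then obtain u where "x = (\<Sum>v\<in>y ` {..<n}. fls_const (u v) * v)" by blast
  then have "x = (\<Sum>j<n. fls_const (u (y j)) * y j)"
    by (simp add: sum.reindex[OF assms(1)])
  then show ?thesis by (rule that)
qed

lemma ksp_independent_familyD:
  fixes y :: "nat \<Rightarrow> 'k::field fls"
  assumes "inj_on y {..<n}" "ksp.independent (y ` {..<n})" "(\<Sum>j<n. fls_const (\<kappa> j) * y j) = 0" "j < n"
  shows "\<kappa> j = 0"
proof -
  define u where "u = (\<lambda>x. \<kappa> (inv_into {..<n} y x))"
  have u: "u (y i) = \<kappa> i" if "i < n" for i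
    using inv_into_f_f[OF assms(1)] that by (simp add: u_def)
  have "(\<Sum>v\<in>y ` {..<n}. fls_const (u v) * v) = (\<Sum>j<n. fls_const (\<kappa> j) * y j)"
    by (simp add: sum.reindex[OF assms(1)] u)
  then have "u (y j) = 0"
    using assms(3,4) by (intro ksp.independentD[OF assms(2), of "y ` {..<n}"]) auto
  then show ?thesis using u assms(4) by simp
qed

text \<open>
  A linearly independent set with as many elements as a finite spanning set spans the same space.
\<close>

lemma ksp_span_of_card_eq:
  fixes F S :: "'k::field fls set"
  assumes F: "finite F" and S: "S \<subseteq> ksp.span F" "ksp.independent S" "card S = card F"
    and x: "x \<in> ksp.span F"
  shows "x \<in> ksp.span S"
proof (rule ccontr)
  assume nx: "x \<notin> ksp.span S"
  have fin: "finite S"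
    using ksp.independent_span_bound[OF F S(2,1)] by blast
  have "ksp.independent (insert x S)"
    using nx S(2) by (rule ksp.independent_insertI)
  moreover have "insert x S \<subseteq> ksp.span F"
    using x S(1) by blast
  ultimately have "card (insert x S) \<le> card F"
    using ksp.independent_span_bound[OF F] by blast
  moreover have "x \<notin> S"
    using nx ksp.span_base by blast
  ultimately show False
    using fin S(3) by simp
qed

text \<open>
  If all power sums with positive exponent vanished, then so would the sum of \<open>g (w j)\<close> for every
  polynomial \<open>g\<close> without constant term. Choosing \<open>g\<close> to vanish at all values of \<open>w\<close> other than \<open>w i\<close>
  leaves a positive multiple of \<open>g (w i)\<close>, which is not zero in characteristic zero.
\<close>

lemma exists_power_sum_nonzero:
  fixes w :: "'b \<Rightarrow> 'a::field_char_0"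
  assumes fin: "finite I" and i: "i \<in> I" "w i \<noteq> 0"
  shows "\<exists>n>0. (\<Sum>j\<in>I. w j ^ n) \<noteq> 0"
proof (rule ccontr)
  assume "\<not> ?thesis"
  then have zero: "(\<Sum>j\<in>I. w j ^ n) = 0" if "n > 0" for n
    using that by blast
  define v where "v = w i"
  define g where "g = [:0, 1:] * (\<Prod>x\<in>w ` I - {v, 0}. [:- x, 1:])"
  have g0: "coeff g 0 = 0"
    by (simp add: g_def coeff_mult)
  have gv: "poly g v \<noteq> 0"
    using fin i by (auto simp: g_def v_def poly_prod)
  have "poly g (w j) = 0" if "j \<in> I" "w j \<noteq> v" for j
    using that fin by (auto simp: g_def poly_prod)
  then have "(\<Sum>j\<in>I. poly g (w j)) = (\<Sum>j\<in>{j \<in> I. w j = v}. poly g v)"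
    using fin by (intro sum.mono_neutral_cong_right) auto
  also have "\<dots> = of_nat (card {j \<in> I. w j = v}) * poly g v"
    by simp
  also have "\<dots> \<noteq> 0"
    using gv i fin by (auto simp: v_def)
  finally have "(\<Sum>j\<in>I. poly g (w j)) \<noteq> 0" .
  moreover have "(\<Sum>j\<in>I. poly g (w j)) = (\<Sum>n\<le>degree g. coeff g n * (\<Sum>j\<in>I. w j ^ n))"
    by (simp add: poly_altdef sum_distrib_left) (rule sum.swap)
  moreover have "\<dots> = 0"
  proof (rule sum.neutral, rule ballI)
    fix n show "coeff g n * (\<Sum>j\<in>I. w j ^ n) = 0"
      using g0 zero[of n] by (cases n) auto
  qed
  ultimately show False by simp
qed

lemma quadratic_le_power:
  fixes x :: real
  assumes "x \<ge> 0"
  shows "1 + real n * x + real n * (real n - 1) / 2 * x\<^sup>2 \<le> (1 + x) ^ n"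
proof (induction n)
  case (Suc n)
  define h where "h = real n * (real n - 1) / 2"
  have h: "h \<ge> 0"
    unfolding h_def by (cases n) auto
  have h': "real (Suc n) * (real (Suc n) - 1) / 2 = h + real n"
    by (simp add: h_def field_simps)
  have "1 + real (Suc n) * x + real (Suc n) * (real (Suc n) - 1) / 2 * x\<^sup>2 =
      (1 + real n * x + h * x\<^sup>2) * (1 + x) - h * x ^ 3"
    unfolding h' by (simp add: algebra_simps power2_eq_square power3_eq_cube)
  also have "\<dots> \<le> (1 + real n * x + real n * (real n - 1) / 2 * x\<^sup>2) * (1 + x)"
    using h assms by (simp flip: h_def)
  also have "\<dots> \<le> (1 + x) ^ n * (1 + x)"
    using Suc assms by (intro mult_right_mono) auto
  finally show ?case by (simp add: mult.commute)
qed simp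

text \<open>
  If every ratio of consecutive terms up to \<open>J\<close> exceeded \<open>1 + x\<close>, then \<open>a J\<close> would be at least
  \<open>(1 + x)^J\<close>, whose quadratic term already exceeds the linear bound \<open>A (J + 1)\<close> once \<open>J x^2 > 4 A\<close>.
\<close>

lemma linear_growth_ratio:
  fixes a :: "nat \<Rightarrow> nat" and A x :: real
  assumes a0: "a 0 > 0" and a: "\<And>j. real (a j) \<le> A * real (Suc j)" and x: "0 < x" "x \<le> 1"
  shows "\<exists>j. real j \<le> (4 * A + 3) / x\<^sup>2 \<and> real (a (Suc j)) \<le> (1 + x) * real (a j)"
proof -
  have A: "A > 0"
    using a[of 0] a0 by simp
  define J where "J = nat \<lceil>4 * A / x\<^sup>2\<rceil> + 3"
  have Jr: "real J = real_of_int \<lceil>4 * A / x\<^sup>2\<rceil> + 3"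
  proof -
    have "4 * A / x\<^sup>2 \<ge> 0" using A by simp
    then show ?thesis by (simp add: J_def)
  qed
  have J: "real J \<ge> 4 * A / x\<^sup>2 + 3" "real J \<le> 4 * A / x\<^sup>2 + 4"
    unfolding Jr by linarith+
  have "\<exists>j<J. real (a (Suc j)) \<le> (1 + x) * real (a j)"
  proof (rule ccontr)
    assume *: "\<not> ?thesis"
    have pow: "(1 + x) ^ j \<le> real (a j)" if "j \<le> J" for j
      using that
    proof (induction j)
      case 0
      then show ?case using a0 by simp
    next
      case (Suc j)
      have "(1 + x) ^ Suc j \<le> (1 + x) * real (a j)"
        using Suc x by simp
      moreover have "\<not> real (a (Suc j)) \<le> (1 + x) * real (a j)"
        using * Suc.prems by (meson Suc_le_lessD)
      ultimately show ?case by linarith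
    qed
    have Jx: "real J * x\<^sup>2 > 4 * A"
    proof -
      have "4 * A / x\<^sup>2 < real J" using J(1) by linarith
      then show ?thesis using x by (simp add: pos_divide_less_eq)
    qed
    have J3: "real J \<ge> 3" unfolding J_def by simp
    have "A * real (Suc J) < real J * x\<^sup>2 / 4 * (2 * (real J - 1))"
    proof (rule mult_less_le_imp_less)
      show "A < real J * x\<^sup>2 / 4" using Jx by simp
      show "real (Suc J) \<le> 2 * (real J - 1)" using J3 by simp
    qed (use A J3 in auto)
    also have "\<dots> = real J * (real J - 1) / 2 * x\<^sup>2"
      by (simp add: algebra_simps)
    also have "\<dots> \<le> 1 + real J * x + real J * (real J - 1) / 2 * x\<^sup>2"
      using x by simp
    also have "\<dots> \<le> (1 + x) ^ J"
      using x by (intro quadratic_le_power) simp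
    also have "\<dots> \<le> real (a J)"
      by (rule pow) simp
    also have "\<dots> \<le> A * real (Suc J)"
      by (rule a)
    finally show False by simp
  qed
  then obtain j where j: "j < J" "real (a (Suc j)) \<le> (1 + x) * real (a j)" by blast
  have "real j \<le> 4 * A / x\<^sup>2 + 3"
    using j(1) J(2) by linarith
  also have "\<dots> \<le> (4 * A + 3) / x\<^sup>2"
    using x power_le_one[of x 2] by (simp add: add_divide_distrib pos_le_divide_eq)
  finally show ?thesis using j(2) by blast
qed

section \<open>The splitting field\<close>

text \<open>
  The embedding of \<open>K[T]\<close> into \<open>K((s))\<close> that sends \<open>T\<close> to \<open>s\<close> to the power \<open>- e\<close>.
\<close>

definition emb :: "nat \<Rightarrow> 'k::field poly \<Rightarrow> 'k fls" where
  "emb e g = fls_compose_power (poly_fls g) e"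

lemma inj_idom_hom_emb:
  assumes "e > 0"
  shows "inj_idom_hom (emb e :: 'k::field poly \<Rightarrow> 'k fls)"
proof -
  interpret cp: field_hom "\<lambda>x::'k fls. fls_compose_power x e"
    by (rule field_hom_fls_compose_power) (rule assms)
  show ?thesis
    by standard (auto simp: emb_def poly_fls_add poly_fls_mult cp.hom_add cp.hom_mult)
qed

lemma emb_pCons:
  assumes "e > 0"
  shows "emb e (pCons a g) = fls_const a + emb e [:0, 1:] * emb e g"
  using assms by (simp add: emb_def poly_fls_pCons)

lemma emb_const: "e > 0 \<Longrightarrow> emb e [:a:] = fls_const a"
  by (simp add: emb_def poly_fls_pCons)

lemma emb_subdegree: "e > 0 \<Longrightarrow> fls_subdegree (emb e g) = - int e * int (degree g)"
  by (simp add: emb_def subdegree_compose_power poly_fls_subdegree)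

text \<open>
  The roots of a monic separable polynomial \<open>P\<close> over \<open>K[T]\<close> in a field of Puiseux series.
  Separability is recorded as a nonzero constant \<open>\<delta>\<close> in the ideal of \<open>P\<close> and its derivative. The number
  \<open>c\<close> serves as the weight of the roots: it bounds both the degrees of the coefficients and the poles
  of the roots at infinity. The family \<open>\<rho>\<close> is indexed by all natural numbers, with repetitions,
  so that statements about \<open>\<rho> i\<close> need no bound on \<open>i\<close>.
\<close>

locale root_system =
  fixes e d c :: nat and P A B :: "'k::field_char_0 poly poly" and \<delta> :: "'k poly" and \<rho> :: "nat \<Rightarrow> 'k fls"
  assumes e: "e > 0" and d: "d > 0" and c: "c > 0"
    and deg_P: "degree P = d" and monic: "lead_coeff P = 1"
    and split: "map_poly (emb e) P = (\<Prod>i<d. [:- \<rho> i, 1:])"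
    and root: "\<And>i. poly (map_poly (emb e) P) (\<rho> i) = 0"
    and bezout: "A * P + B * pderiv P = [:\<delta>:]" and \<delta>: "\<delta> \<noteq> 0"
    and deg_coeff: "\<And>i. degree (coeff P i) \<le> c"
    and ord_\<rho>: "\<And>i. ord_ge (\<rho> i) (- int e * int c)"
begin

abbreviation \<iota> :: "'k poly \<Rightarrow> 'k fls" where "\<iota> \<equiv> emb e"
abbreviation T :: "'k fls" where "T \<equiv> emb e [:0, 1:]"

sublocale \<iota>: inj_idom_hom "emb e :: 'k poly \<Rightarrow> 'k fls"
  by (rule inj_idom_hom_emb) (rule e)

lemma ord_\<iota>: "ord_ge (\<iota> g) (- int e * int (degree g))"
  using e by (simp add: ord_ge_iff emb_subdegree)

lemma ord_\<iota>_nonpos: "ord_ge (\<iota> g) s \<Longrightarrow> g \<noteq> 0 \<Longrightarrow> s \<le> 0"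
  using e by (auto simp: ord_ge_iff emb_subdegree intro: order.trans)

subsection \<open>Derivation\<close>

text \<open>
  The derivation \<open>d/dT\<close>: since \<open>T\<close> is \<open>s\<close> to the power \<open>- e\<close>, it equals \<open>- s^(e + 1) / e\<close> times \<open>d/ds\<close>.
\<close>

definition D :: "'k fls \<Rightarrow> 'k fls" where
  "D x = fls_const (- 1 / of_nat e) * fls_X_intpow (int e + 1) * fls_deriv x"

lemma D_add: "D (x + y) = D x + D y"
  by (simp add: D_def ring_distribs)

lemma D_mult: "D (x * y) = D x * y + x * D y"
  by (simp add: D_def ring_distribs mult_ac)

lemma D_const [simp]: "D (fls_const a) = 0"
  by (simp add: D_def)

lemma D_0 [simp]: "D 0 = 0"
  by (simp add: D_def)

lemma D_T: "D T = 1"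
proof -
  have "T = fls_X_intpow (- int e)"
    using e by (simp add: emb_def poly_fls_pCons)
  then have "fls_deriv T = fls_const (- of_nat e) * fls_X_intpow (- int e - 1)"
    by (simp add: fls_deriv_shift fls_of_nat add.commute)
  then have "D T = (fls_const (- 1 / of_nat e) * fls_const (- of_nat e)) *
      (fls_X_intpow (int e + 1) * fls_X_intpow (- int e - 1))"
    by (simp only: D_def mult_ac)
  also have "fls_const (- 1 / of_nat e) * fls_const (- of_nat e) = (1 :: 'k fls)"
    using e by (simp only: fls_const_mult_const) simp
  also have "fls_X_intpow (int e + 1) * fls_X_intpow (- int e - 1) = (1 :: 'k fls)"
    by (simp only: fls_X_intpow_times_fls_X_intpow) simp
  finally show ?thesis by simp
qed

lemma D_\<iota>: "D (\<iota> g) = \<iota> (pderiv g)"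
proof (induction g)
  case (pCons a g)
  show ?case
    by (simp add: emb_pCons[OF e, of a] pderiv_pCons emb_pCons[OF e, of 0 "pderiv g"] D_add D_mult D_T pCons.IH \<iota>.hom_add)
qed simp

lemma D_poly:
  "D (poly (map_poly \<iota> G) x) = poly (map_poly \<iota> (map_poly pderiv G)) x + poly (map_poly \<iota> (pderiv G)) x * D x"
proof (induction G)
  case (pCons a G)
  have [simp]: "map_poly pderiv (pCons a G) = pCons (pderiv a) (map_poly pderiv G)"
    by (intro poly_eqI) (simp add: coeff_map_poly coeff_pCons split: nat.splits)
  show ?case
    by (simp add: D_add D_mult D_\<iota> pCons.IH pderiv_pCons \<iota>.hom_add
        \<iota>.map_poly_pCons_hom \<iota>.map_poly_hom_add algebra_simps)
qed simp

lemma D_eq_0_imp: "D x = 0 \<Longrightarrow> \<exists>a. x = fls_const a"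
  using e fls_deriv_eq_0_iff[of x] fls_X_intpow_nonzero[of "int e + 1", where 'a = 'k]
  by (auto simp: D_def fls_const_nonzero simp del: fls_X_intpow_nonzero)

text \<open>
  The derivative of a root is a rational function of that root with denominator \<open>P'(\<rho> i)\<close>. This
  denominator divides \<open>\<delta>\<close>, so the multiple \<open>\<theta>\<close> of the derivation maps the ring generated by \<open>T\<close> and
  the roots into itself, with the same constants.
\<close>

definition \<theta> :: "'k fls \<Rightarrow> 'k fls" where
  "\<theta> x = \<iota> \<delta> * D x"

lemma \<theta>_add: "\<theta> (x + y) = \<theta> x + \<theta> y"
  by (simp add: \<theta>_def D_add ring_distribs)

lemma \<theta>_mult: "\<theta> (x * y) = \<theta> x * y + x * \<theta> y"
  by (simp add: \<theta>_def D_mult ring_distribs mult_ac)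

lemma \<theta>_0 [simp]: "\<theta> 0 = 0"
  by (simp add: \<theta>_def)

lemma \<theta>_scale: "\<theta> (fls_const a * x) = fls_const a * \<theta> x"
  by (simp add: \<theta>_def D_mult)

lemma \<theta>_eq_0_imp: "\<theta> x = 0 \<Longrightarrow> \<exists>a. x = fls_const a"
  using \<delta> D_eq_0_imp by (auto simp: \<theta>_def)

lemma \<theta>_\<iota>: "\<theta> (\<iota> g) = \<iota> (\<delta> * pderiv g)"
  by (simp add: \<theta>_def D_\<iota> \<iota>.hom_mult)

text \<open>
  Differentiating \<open>P (\<rho> i) = 0\<close> gives \<open>P'(\<rho> i) * D (\<rho> i)\<close>, and multiplying by \<open>B (\<rho> i)\<close> turns the factor
  \<open>P'(\<rho> i)\<close> into \<open>\<delta>\<close>. The polynomial on the right does not depend on \<open>i\<close>, so \<open>\<theta>\<close> commutes with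
  substituting roots for roots.
\<close>

lemma \<theta>_\<rho>: "\<theta> (\<rho> i) = poly (map_poly \<iota> (- (B * map_poly pderiv P))) (\<rho> i)"
proof -
  interpret m: map_poly_inj_idom_hom \<iota> ..
  let ?ev = "\<lambda>G. poly (map_poly \<iota> G) (\<rho> i)"
  have 1: "?ev (map_poly pderiv P) + ?ev (pderiv P) * D (\<rho> i) = 0"
    using D_poly[of P "\<rho> i"] root[of i] by simp
  have "?ev (A * P + B * pderiv P) = \<iota> \<delta>"
    by (simp add: bezout \<iota>.map_poly_pCons_hom)
  then have 2: "?ev B * ?ev (pderiv P) = \<iota> \<delta>"
    using root[of i] by (simp add: m.hom_add m.hom_mult)
  have "\<theta> (\<rho> i) = ?ev B * (?ev (pderiv P) * D (\<rho> i))"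
    by (simp add: \<theta>_def mult.assoc flip: 2)
  also have "?ev (pderiv P) * D (\<rho> i) = - ?ev (map_poly pderiv P)"
    using 1 by (simp add: eq_neg_iff_add_eq_0 add.commute)
  finally show ?thesis
    by (simp add: m.hom_mult m.hom_uminus)
qed

lemma ord_D: "ord_ge x s \<Longrightarrow> ord_ge (D x) (s + int e)"
proof -
  assume "ord_ge x s"
  then have "ord_ge (fls_deriv x) (s - 1)"
    by (simp add: ord_ge_def)
  moreover have "ord_ge (fls_X_intpow (int e + 1) :: 'k fls) (int e + 1)"
    by (simp add: ord_ge_iff)
  ultimately have "ord_ge (D x) (0 + (int e + 1) + (s - 1))"
    unfolding D_def by (intro ord_ge_mult ord_ge_const)
  then show ?thesis by (simp add: algebra_simps)
qed

lemma ord_\<theta>: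
  assumes "ord_ge x s"
  shows "ord_ge (\<theta> x) (s - int e * int (degree \<delta>))"
  using ord_ge_mult[OF ord_\<iota>[of \<delta>] ord_D[OF assms]] unfolding \<theta>_def
  by (rule ord_ge_mono) simp

lemma ord_\<theta>_iter: "ord_ge x s \<Longrightarrow> ord_ge ((\<theta> ^^ i) x) (s - int i * (int e * int (degree \<delta>)))"
proof (induction i)
  case (Suc i)
  from ord_\<theta>[OF Suc.IH[OF Suc.prems]] show ?case
    by (simp add: algebra_simps)
qed simp

lemma \<theta>_iter_add: "(\<theta> ^^ i) (x + y) = (\<theta> ^^ i) x + (\<theta> ^^ i) y"
  by (induction i) (simp_all add: \<theta>_add)

lemma \<theta>_iter_scale: "(\<theta> ^^ i) (fls_const a * x) = fls_const a * (\<theta> ^^ i) x"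
  by (induction i) (simp_all add: \<theta>_scale)

lemma \<theta>_iter_0 [simp]: "(\<theta> ^^ i) 0 = 0"
  by (induction i) simp_all

lemma \<theta>_iter_sum: "(\<theta> ^^ i) (\<Sum>j\<in>J. f j) = (\<Sum>j\<in>J. (\<theta> ^^ i) (f j))"
  by (induction J rule: infinite_finite_induct) (simp_all add: \<theta>_iter_add)

subsection \<open>Polynomial functions of tuples of roots\<close>

text \<open>
  A polynomial in \<open>d\<close> variables over \<open>K[T]\<close>, viewed as a function of the index tuple \<open>\<tau>\<close> at which it is
  evaluated: the variable \<open>j\<close> takes the value \<open>\<rho> (\<tau> j)\<close>. The polynomial itself is evaluated at the
  tuple \<open>id\<close>, and the other tuples take the place of its conjugates.
\<close>

inductive_set tuple_poly :: "((nat \<Rightarrow> nat) \<Rightarrow> 'k fls) set" where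
  const: "(\<lambda>_. \<iota> g) \<in> tuple_poly"
| coordinate: "j < d \<Longrightarrow> (\<lambda>\<tau>. \<rho> (\<tau> j)) \<in> tuple_poly"
| add: "\<Phi> \<in> tuple_poly \<Longrightarrow> \<Psi> \<in> tuple_poly \<Longrightarrow> (\<lambda>\<tau>. \<Phi> \<tau> + \<Psi> \<tau>) \<in> tuple_poly"
| mult: "\<Phi> \<in> tuple_poly \<Longrightarrow> \<Psi> \<in> tuple_poly \<Longrightarrow> (\<lambda>\<tau>. \<Phi> \<tau> * \<Psi> \<tau>) \<in> tuple_poly"

lemma tuple_poly_0: "(\<lambda>_. 0) \<in> tuple_poly"
  using tuple_poly.const[of 0] by simp

lemma tuple_poly_1: "(\<lambda>_. 1) \<in> tuple_poly"
  using tuple_poly.const[of 1] by simp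

lemma tuple_poly_sum: "(\<And>i. i \<in> I \<Longrightarrow> \<Phi> i \<in> tuple_poly) \<Longrightarrow> (\<lambda>\<tau>. \<Sum>i\<in>I. \<Phi> i \<tau>) \<in> tuple_poly"
  by (induction I rule: infinite_finite_induct) (simp_all add: tuple_poly_0 tuple_poly.add)

lemma tuple_poly_prod: "(\<And>i. i \<in> I \<Longrightarrow> \<Phi> i \<in> tuple_poly) \<Longrightarrow> (\<lambda>\<tau>. \<Prod>i\<in>I. \<Phi> i \<tau>) \<in> tuple_poly"
  by (induction I rule: infinite_finite_induct) (simp_all add: tuple_poly_1 tuple_poly.mult)

lemma tuple_poly_power: "\<Phi> \<in> tuple_poly \<Longrightarrow> (\<lambda>\<tau>. \<Phi> \<tau> ^ n) \<in> tuple_poly"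
  by (induction n) (simp_all add: tuple_poly_1 tuple_poly.mult)

lemma tuple_poly_eval: "j < d \<Longrightarrow> (\<lambda>\<tau>. poly (map_poly \<iota> G) (\<rho> (\<tau> j))) \<in> tuple_poly"
proof (induction G)
  case 0
  then show ?case by (simp add: tuple_poly_0)
next
  case (pCons a G)
  have "(\<lambda>\<tau>. \<iota> a + \<rho> (\<tau> j) * poly (map_poly \<iota> G) (\<rho> (\<tau> j))) \<in> tuple_poly"
    by (intro tuple_poly.intros pCons)
  then show ?case by (simp add: \<iota>.map_poly_pCons_hom)
qed

lemma tuple_poly_\<theta>: "\<Phi> \<in> tuple_poly \<Longrightarrow> (\<lambda>\<tau>. \<theta> (\<Phi> \<tau>)) \<in> tuple_poly"
proof (induction rule: tuple_poly.induct)
  case (const g)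
  then show ?case unfolding \<theta>_\<iota> by (rule tuple_poly.const)
next
  case (coordinate j)
  then show ?case unfolding \<theta>_\<rho> by (rule tuple_poly_eval)
next
  case (add \<Phi> \<Psi>)
  then show ?case unfolding \<theta>_add by (intro tuple_poly.add)
next
  case (mult \<Phi> \<Psi>)
  then show ?case unfolding \<theta>_mult by (intro tuple_poly.add tuple_poly.mult)
qed

lemma tuple_poly_\<theta>_iter: "\<Phi> \<in> tuple_poly \<Longrightarrow> (\<lambda>\<tau>. (\<theta> ^^ i) (\<Phi> \<tau>)) \<in> tuple_poly"
  by (induction i) (simp_all add: tuple_poly_\<theta>)

subsection \<open>Power sums\<close>

lemma range_\<iota>_add: "x \<in> range \<iota> \<Longrightarrow> y \<in> range \<iota> \<Longrightarrow> x + y \<in> range \<iota>"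
  by (auto simp flip: \<iota>.hom_add)

lemma range_\<iota>_sum: "(\<And>i. i \<in> I \<Longrightarrow> f i \<in> range \<iota>) \<Longrightarrow> (\<Sum>i\<in>I. f i) \<in> range \<iota>"
proof (induction I rule: infinite_finite_induct)
  case (insert i I)
  have "f i + sum f I \<in> range \<iota>"
    by (intro range_\<iota>_add insert.IH insert.prems) auto
  then show ?case by (simp only: sum.insert[OF insert.hyps])
qed (auto intro: range_eqI[of _ _ 0])

lemma range_\<iota>_const: "fls_const a \<in> range \<iota>"
  using emb_const[OF e, of a] by (metis rangeI)

lemma range_\<iota>_mult: "x \<in> range \<iota> \<Longrightarrow> y \<in> range \<iota> \<Longrightarrow> x * y \<in> range \<iota>"
  by (auto simp flip: \<iota>.hom_mult)

lemma range_\<iota>_diff: "x \<in> range \<iota> \<Longrightarrow> y \<in> range \<iota> \<Longrightarrow> x - y \<in> range \<iota>"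
  by (auto simp flip: \<iota>.hom_minus)

text \<open>
  Newton's identities: the product \<open>Q\<close> of the power series \<open>1 - \<rho> l X\<close> has coefficients in \<open>K[T]\<close>, being
  the reversal of \<open>P\<close>, and the power sums are the coefficients of its negative logarithmic derivative.
\<close>

lemma power_sum_rational: "(\<Sum>l<d. \<rho> l ^ m) \<in> range \<iota>"
proof (induction m rule: less_induct)
  case (less m)
  show ?case
  proof (cases m)
    case 0
    have "(\<Sum>l<d. \<rho> l ^ m) = fls_const (of_nat d)"
      by (simp add: 0 fls_of_nat)
    then show ?thesis by (simp only: range_\<iota>_const)
  next
    case (Suc n)
    define p where "p = (\<lambda>m. \<Sum>l<d. \<rho> l ^ m)"
    define f where "f = (\<lambda>l. 1 - fps_const (\<rho> l) * fps_X)"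
    define g where "g = (\<lambda>l. Abs_fps (\<lambda>m. \<rho> l ^ Suc m))"
    define Q where "Q = (\<Prod>l<d. f l)"
    have "f l * g l = fps_const (\<rho> l)" for l
    proof (rule fps_ext)
      fix k show "fps_nth (f l * g l) k = fps_nth (fps_const (\<rho> l)) k"
        by (cases k) (simp_all add: f_def g_def algebra_simps)
    qed
    then have df: "fps_deriv (f l) = - (f l * g l)" for l
      by (simp add: f_def)
    have "fps_deriv (\<Prod>l\<in>I. f l) = - ((\<Prod>l\<in>I. f l) * (\<Sum>l\<in>I. g l))" for I
      by (induction I rule: infinite_finite_induct) (auto simp: df algebra_simps)
    then have "fps_deriv Q = - (Q * (\<Sum>l<d. g l))"
      by (simp add: Q_def)
    moreover have "(\<Sum>l<d. g l) = Abs_fps (\<lambda>m. p (Suc m))"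
      by (rule fps_ext) (simp add: g_def p_def fps_sum_nth)
    ultimately have "fps_nth (fps_deriv Q) n = - (\<Sum>i=0..n. fps_nth Q i * p (Suc (n - i)))"
      by (simp add: fps_mult_nth)
    moreover have "(\<Sum>i=0..n. fps_nth Q i * p (Suc (n - i))) =
        fps_nth Q 0 * p (Suc n) + (\<Sum>i=Suc 0..n. fps_nth Q i * p (Suc (n - i)))"
      by (subst sum.atLeast_Suc_atMost) auto
    moreover have "fps_nth (\<Prod>l\<in>I. f l) 0 = 1" for I
      by (induction I rule: infinite_finite_induct) (auto simp: f_def)
    then have "fps_nth Q 0 = 1"
      by (simp add: Q_def)
    ultimately have "of_nat (Suc n) * fps_nth Q (Suc n) = - (p m + (\<Sum>i=Suc 0..n. fps_nth Q i * p (Suc (n - i))))"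
      using Suc by simp
    then have eq: "p m = 0 - of_nat (Suc n) * fps_nth Q (Suc n) - (\<Sum>i=Suc 0..n. fps_nth Q i * p (Suc (n - i)))"
      by (simp only: diff_0) (simp del: of_nat_Suc)
    have "f l = fps_of_poly (reflect_poly [:- \<rho> l, 1:])" for l
      by (rule fps_ext) (auto simp: f_def coeff_reflect_poly coeff_pCons split: nat.splits)
    then have "Q = fps_of_poly (reflect_poly (map_poly \<iota> P))"
      by (simp only: Q_def split reflect_poly_prod fps_of_poly_prod)
    then have "fps_nth Q i = (if i > d then 0 else \<iota> (coeff P (d - i)))" for i
      by (simp add: coeff_reflect_poly deg_P)
    then have Q: "fps_nth Q i \<in> range \<iota>" for i
      by (metis \<iota>.hom_zero rangeI)
    have "0 - of_nat (Suc n) * fps_nth Q (Suc n) \<in> range \<iota>"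
      using range_\<iota>_const[of 0] range_\<iota>_const[of "of_nat (Suc n)"] unfolding fls_of_nat fls_const_0
      by (intro range_\<iota>_diff range_\<iota>_mult Q)
    moreover have "(\<Sum>i=Suc 0..n. fps_nth Q i * p (Suc (n - i))) \<in> range \<iota>"
    proof (intro range_\<iota>_sum range_\<iota>_mult Q)
      fix i assume "i \<in> {Suc 0..n}"
      then have "Suc (n - i) < m"
        using Suc by auto
      then show "p (Suc (n - i)) \<in> range \<iota>"
        unfolding p_def by (rule less.IH)
    qed
    ultimately have "p m \<in> range \<iota>"
      unfolding eq by (rule range_\<iota>_diff)
    then show ?thesis by (simp add: p_def)
  qed
qed

inductive_set tuple_monomial_sum :: "((nat \<Rightarrow> nat) \<Rightarrow> 'k fls) set" where
  monomial: "(\<lambda>\<tau>. \<iota> g * (\<Prod>j<d. \<rho> (\<tau> j) ^ m j)) \<in> tuple_monomial_sum"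
| add: "\<Phi> \<in> tuple_monomial_sum \<Longrightarrow> \<Psi> \<in> tuple_monomial_sum \<Longrightarrow> (\<lambda>\<tau>. \<Phi> \<tau> + \<Psi> \<tau>) \<in> tuple_monomial_sum"

lemma tuple_monomial_sum_mult:
  assumes "\<Phi> \<in> tuple_monomial_sum" "\<Psi> \<in> tuple_monomial_sum"
  shows "(\<lambda>\<tau>. \<Phi> \<tau> * \<Psi> \<tau>) \<in> tuple_monomial_sum"
  using assms
proof (induction arbitrary: \<Psi> rule: tuple_monomial_sum.induct)
  case (monomial g m)
  from monomial show ?case
  proof (induction rule: tuple_monomial_sum.induct)
    case (monomial h n)
    have "(\<lambda>\<tau>. \<iota> g * (\<Prod>j<d. \<rho> (\<tau> j) ^ m j) * (\<iota> h * (\<Prod>j<d. \<rho> (\<tau> j) ^ n j))) =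
        (\<lambda>\<tau>. \<iota> (g * h) * (\<Prod>j<d. \<rho> (\<tau> j) ^ (m j + n j)))"
      by (simp add: \<iota>.hom_mult power_add prod.distrib mult_ac)
    then show ?case
      by (simp only: tuple_monomial_sum.monomial)
  next
    case (add \<Phi> \<Psi>)
    then show ?case
      by (simp only: distrib_left tuple_monomial_sum.add)
  qed
next
  case (add \<Phi> \<Psi>')
  then show ?case
    by (simp only: distrib_right tuple_monomial_sum.add)
qed

lemma tuple_poly_subset: "\<Phi> \<in> tuple_poly \<Longrightarrow> \<Phi> \<in> tuple_monomial_sum"
proof (induction rule: tuple_poly.induct)
  case (const g)
  show ?case
    using tuple_monomial_sum.monomial[of g "\<lambda>_. 0"] by simp
next
  case (coordinate j)
  have "(\<lambda>\<tau>. \<iota> 1 * (\<Prod>i<d. \<rho> (\<tau> i) ^ (if i = j then 1 else 0))) = (\<lambda>\<tau>. \<rho> (\<tau> j))"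
  proof
    fix \<tau> :: "nat \<Rightarrow> nat"
    have "(\<Prod>i<d. \<rho> (\<tau> i) ^ (if i = j then 1 else 0)) = (\<Prod>i<d. if i = j then \<rho> (\<tau> i) else 1)"
      by (intro prod.cong) auto
    then show "\<iota> 1 * (\<Prod>i<d. \<rho> (\<tau> i) ^ (if i = j then 1 else 0)) = \<rho> (\<tau> j)"
      using coordinate by simp
  qed
  then show ?case
    using tuple_monomial_sum.monomial[of 1 "\<lambda>i. if i = j then 1 else 0"] by simp
next
  case (add \<Phi> \<Psi>)
  then show ?case by (intro tuple_monomial_sum.add)
next
  case (mult \<Phi> \<Psi>)
  then show ?case by (intro tuple_monomial_sum_mult)
qed

abbreviation "tuples \<equiv> {..<d} \<rightarrow>\<^sub>E {..<d}"

lemma range_\<iota>_prod: "(\<And>i. i \<in> I \<Longrightarrow> f i \<in> range \<iota>) \<Longrightarrow> (\<Prod>i\<in>I. f i) \<in> range \<iota>"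
proof (induction I rule: infinite_finite_induct)
  case (insert i I)
  have "f i * prod f I \<in> range \<iota>"
    by (intro range_\<iota>_mult insert.IH insert.prems) auto
  then show ?case by (simp only: prod.insert[OF insert.hyps])
qed (auto intro: range_eqI[of _ _ 1])

text \<open>
  Summing over all self-maps of the index set, instead of all permutations, makes the sum factor into
  power sums.
\<close>

lemma tuple_sum_rational_monomial:
  "(\<Sum>\<tau>\<in>tuples. \<iota> g * (\<Prod>j<d. \<rho> (\<tau> j) ^ m j)) \<in> range \<iota>"
proof -
  have "(\<Prod>j\<in>{..<d}. \<Sum>l\<in>{..<d}. \<rho> l ^ m j) = (\<Sum>\<tau>\<in>{..<d} \<rightarrow>\<^sub>E {..<d}. \<Prod>j\<in>{..<d}. \<rho> (\<tau> j) ^ m j)"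
    using prod_sum_PiE[of "{..<d}" "\<lambda>_. {..<d}" "\<lambda>j l. \<rho> l ^ m j", OF finite_lessThan finite_lessThan] .
  moreover have "(\<Prod>j\<in>{..<d}. \<Sum>l\<in>{..<d}. \<rho> l ^ m j) \<in> range \<iota>"
    by (rule range_\<iota>_prod) (rule power_sum_rational)
  ultimately have "(\<Sum>\<tau>\<in>tuples. \<Prod>j<d. \<rho> (\<tau> j) ^ m j) \<in> range \<iota>"
    by (rule subst)
  then have "\<iota> g * (\<Sum>\<tau>\<in>tuples. \<Prod>j<d. \<rho> (\<tau> j) ^ m j) \<in> range \<iota>"
    by (rule range_\<iota>_mult[OF rangeI])
  then show ?thesis
    unfolding sum_distrib_left .
qed

lemma tuple_sum_rational:
  assumes "\<Phi> \<in> tuple_poly"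
  shows "(\<Sum>\<tau>\<in>tuples. \<Phi> \<tau>) \<in> range \<iota>"
proof -
  have "\<Phi> \<in> tuple_monomial_sum"
    using assms by (rule tuple_poly_subset)
  then show ?thesis
  proof induct
    case (monomial g m)
    show ?case by (rule tuple_sum_rational_monomial)
  next
    case (add \<Phi> \<Psi>)
    then show ?case
      unfolding sum.distrib by (intro range_\<iota>_add)
  qed
qed

subsection \<open>Wronskians\<close>

definition wronskian :: "nat \<Rightarrow> (nat \<Rightarrow> 'k fls) \<Rightarrow> 'k fls" where
  "wronskian n y = det (mat n n (\<lambda>(i, j). (\<theta> ^^ i) (y j)))"

lemma wronskian_eq_0_iff:
  "wronskian n y = 0 \<longleftrightarrow> (\<exists>v. (\<exists>j<n. v j \<noteq> 0) \<and> (\<forall>i<n. (\<Sum>j<n. (\<theta> ^^ i) (y j) * v j) = 0))"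
proof -
  let ?A = "mat n n (\<lambda>(i, j). (\<theta> ^^ i) (y j))"
  have A: "?A \<in> carrier_mat n n" by simp
  have mult: "?A *\<^sub>v w = vec n (\<lambda>i. \<Sum>j<n. (\<theta> ^^ i) (y j) * vec_index w j)" if "w \<in> carrier_vec n" for w
    using that by (intro eq_vecI) (auto simp: scalar_prod_def lessThan_atLeast0)
  show ?thesis
    unfolding wronskian_def det_0_iff_vec_prod_zero_field[OF A]
  proof
    assume "\<exists>w. w \<in> carrier_vec n \<and> w \<noteq> 0\<^sub>v n \<and> ?A *\<^sub>v w = 0\<^sub>v n"
    then obtain w where w: "w \<in> carrier_vec n" "w \<noteq> 0\<^sub>v n" "?A *\<^sub>v w = 0\<^sub>v n" by blast
    have "\<exists>j<n. vec_index w j \<noteq> 0"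
    proof (rule ccontr)
      assume "\<not> ?thesis"
      then have "w = 0\<^sub>v n"
        using w(1) by (intro eq_vecI) auto
      then show False using w(2) by simp
    qed
    moreover have "(\<Sum>j<n. (\<theta> ^^ i) (y j) * vec_index w j) = 0" if "i < n" for i
      using arg_cong[OF w(3)[unfolded mult[OF w(1)]], of "\<lambda>v. vec_index v i"] that by simp
    ultimately show "\<exists>v. (\<exists>j<n. v j \<noteq> 0) \<and> (\<forall>i<n. (\<Sum>j<n. (\<theta> ^^ i) (y j) * v j) = 0)"
      by (intro exI[of _ "vec_index w"]) simp
  next
    assume "\<exists>v. (\<exists>j<n. v j \<noteq> 0) \<and> (\<forall>i<n. (\<Sum>j<n. (\<theta> ^^ i) (y j) * v j) = 0)"
    then obtain v where v: "\<exists>j<n. v j \<noteq> 0" "\<And>i. i < n \<Longrightarrow> (\<Sum>j<n. (\<theta> ^^ i) (y j) * v j) = 0" by blast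
    have "vec n v \<noteq> 0\<^sub>v n"
    proof
      assume "vec n v = 0\<^sub>v n"
      then have "v j = 0" if "j < n" for j
        using that by (metis index_vec index_zero_vec(1))
      then show False using v(1) by blast
    qed
    moreover have "?A *\<^sub>v vec n v = 0\<^sub>v n"
      unfolding mult[OF vec_carrier] by (rule eq_vecI) (simp_all add: v(2))
    ultimately show "\<exists>w. w \<in> carrier_vec n \<and> w \<noteq> 0\<^sub>v n \<and> ?A *\<^sub>v w = 0\<^sub>v n"
      by (intro exI[of _ "vec n v"]) simp
  qed
qed

text \<open>
  As \<open>\<theta>\<close> is linear over the constants, a relation between the functions is a relation between the columns.
\<close>

lemma wronskian_dependent:
  assumes "(\<Sum>j<n. fls_const (\<kappa> j) * y j) = 0" "j < n" "\<kappa> j \<noteq> 0"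
  shows "wronskian n y = 0"
proof -
  have "(\<Sum>j<n. (\<theta> ^^ i) (y j) * fls_const (\<kappa> j)) = (\<theta> ^^ i) (\<Sum>j<n. fls_const (\<kappa> j) * y j)" for i
    unfolding \<theta>_iter_sum \<theta>_iter_scale by (simp only: mult.commute)
  then show ?thesis
    unfolding wronskian_eq_0_iff using assms
    by (intro exI[of _ "\<lambda>j. fls_const (\<kappa> j)"]) (auto intro!: exI[of _ j] fls_const_nonzero)
qed

text \<open>
  The classical argument: if the first \<open>n\<close> functions have a nonzero Wronskian, normalize the last
  coefficient of a relation between the columns to be 1. Differentiating the relation gives one between
  the first \<open>n\<close> columns with the derivatives of the coefficients, which must therefore vanish.
\<close>

theorem wronskian_eq_0_imp_dependent:
  assumes "wronskian n y = 0"
  shows "\<exists>\<kappa>. (\<exists>j<n. \<kappa> j \<noteq> 0) \<and> (\<Sum>j<n. fls_const (\<kappa> j) * y j) = 0"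
  using assms
proof (induction n)
  case 0
  then show ?case by (simp add: wronskian_eq_0_iff)
next
  case (Suc n)
  show ?case
  proof (cases "wronskian n y = 0")
    case True
    then obtain \<kappa> j where k: "j < n" "\<kappa> j \<noteq> 0" "(\<Sum>j<n. fls_const (\<kappa> j) * y j) = 0"
      using Suc.IH by blast
    have "(\<Sum>j<n. fls_const ((\<kappa>(n := 0)) j) * y j) = (\<Sum>j<n. fls_const (\<kappa> j) * y j)"
      by (rule sum.cong) auto
    then show ?thesis
      using k by (intro exI[of _ "\<kappa>(n := 0)"] conjI exI[of _ j]) auto
  next
    case False
    obtain v where v: "\<exists>j<Suc n. v j \<noteq> 0" "\<And>i. i < Suc n \<Longrightarrow> (\<Sum>j<Suc n. (\<theta> ^^ i) (y j) * v j) = 0"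
      using Suc.prems unfolding wronskian_eq_0_iff by blast
    have regular: "w j = 0" if "\<And>i. i < n \<Longrightarrow> (\<Sum>j<n. (\<theta> ^^ i) (y j) * w j) = 0" "j < n" for w j
      using False that unfolding wronskian_eq_0_iff by blast
    have vn: "v n \<noteq> 0"
    proof
      assume v0: "v n = 0"
      have "(\<Sum>j<n. (\<theta> ^^ i) (y j) * v j) = 0" if "i < n" for i
        using v(2)[of i] that v0 by simp
      then have "v j = 0" if "j < n" for j
        using regular that by blast
      then show False
        using v(1) v0 by (auto simp: less_Suc_eq)
    qed
    define w where "w = (\<lambda>j. v j / v n)"
    have rel: "(\<Sum>j<n. (\<theta> ^^ i) (y j) * w j) + (\<theta> ^^ i) (y n) = 0" if "i < Suc n" for i
    proof -
      have "(\<Sum>j<n. (\<theta> ^^ i) (y j) * w j) + (\<theta> ^^ i) (y n) = (\<Sum>j<Suc n. (\<theta> ^^ i) (y j) * v j) / v n"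
        using vn by (simp add: w_def sum_divide_distrib add_divide_distrib)
      then show ?thesis using v(2)[OF that] by simp
    qed
    have \<theta>_sum: "\<theta> (\<Sum>j<m. f j) = (\<Sum>j<m. \<theta> (f j))" for f and m :: nat
      by (induction m) (simp_all add: \<theta>_add)
    have "(\<Sum>j<n. (\<theta> ^^ i) (y j) * \<theta> (w j)) = 0" if "i < n" for i
    proof -
      have "0 = \<theta> ((\<Sum>j<n. (\<theta> ^^ i) (y j) * w j) + (\<theta> ^^ i) (y n))"
        using rel[of i] that by simp
      also have "\<dots> = ((\<Sum>j<n. (\<theta> ^^ Suc i) (y j) * w j) + (\<theta> ^^ Suc i) (y n)) +
          (\<Sum>j<n. (\<theta> ^^ i) (y j) * \<theta> (w j))"
        by (simp add: \<theta>_add \<theta>_sum \<theta>_mult sum.distrib)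
      finally show ?thesis
        using rel[of "Suc i"] that by simp
    qed
    then have "\<theta> (w j) = 0" if "j < n" for j
      using regular[of "\<lambda>j. \<theta> (w j)"] that by blast
    then have "\<forall>j. \<exists>a. j < n \<longrightarrow> w j = fls_const a"
      using \<theta>_eq_0_imp by blast
    then obtain \<kappa> where \<kappa>: "\<And>j. j < n \<Longrightarrow> w j = fls_const (\<kappa> j)"
      by metis
    define \<kappa>' where "\<kappa>' = \<kappa>(n := 1)"
    have "(\<Sum>j<Suc n. fls_const (\<kappa>' j) * y j) = (\<Sum>j<n. y j * w j) + y n"
      by (simp add: \<kappa>'_def \<kappa> mult.commute)
    also have "\<dots> = 0"
      using rel[of 0] by simp
    finally show ?thesis
      by (intro exI[of _ \<kappa>'] conjI exI[of _ n]) (simp_all add: \<kappa>'_def)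
  qed
qed

lemma wronskian_column_operation:
  assumes k: "k \<le> n"
    and y: "\<And>j. j < k \<Longrightarrow> y j = z j"
    and y': "\<And>j. k \<le> j \<Longrightarrow> j < n \<Longrightarrow> y j = z j + (\<Sum>i<k. fls_const (\<kappa> i j) * z i)"
  shows "wronskian n y = wronskian n z"
proof -
  let ?A = "\<lambda>y. mat n n (\<lambda>(i, j). (\<theta> ^^ i) (y j))"
  define U where "U = mat n n (\<lambda>(i, j). if i = j then 1 else if i < k \<and> k \<le> j then fls_const (\<kappa> i j) else 0)"
  have "?A y = ?A z * U"
  proof (rule eq_matI)
    fix i j assume "i < dim_row (?A z * U)" "j < dim_col (?A z * U)"
    then have ij: "i < n" "j < n" by (simp_all add: U_def)
    let ?c = "\<lambda>l. if l = j then 1 else if l < k \<and> k \<le> j then fls_const (\<kappa> l j) else 0"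
    have "index_mat (?A z * U) (i, j) = (\<Sum>l<n. (\<theta> ^^ i) (z l) * ?c l)"
      using ij by (simp add: U_def scalar_prod_def lessThan_atLeast0)
    also have "\<dots> = (\<theta> ^^ i) (y j)"
    proof (cases "j < k")
      case True
      then have "(\<Sum>l<n. (\<theta> ^^ i) (z l) * ?c l) = (\<Sum>l<n. if l = j then (\<theta> ^^ i) (z l) else 0)"
        by (intro sum.cong) auto
      then show ?thesis
        using True ij y by simp
    next
      case False
      have "(\<Sum>l<n. (\<theta> ^^ i) (z l) * ?c l) = (\<Sum>l\<in>insert j {..<k}. (\<theta> ^^ i) (z l) * ?c l)"
        using False ij k by (intro sum.mono_neutral_right) auto
      also have "\<dots> = (\<theta> ^^ i) (z j) + (\<Sum>l<k. (\<theta> ^^ i) (z l) * ?c l)"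
        using False by (subst sum.insert) auto
      also have "(\<Sum>l<k. (\<theta> ^^ i) (z l) * ?c l) = (\<Sum>l<k. fls_const (\<kappa> l j) * (\<theta> ^^ i) (z l))"
        using False by (intro sum.cong) auto
      also have "(\<theta> ^^ i) (z j) + \<dots> = (\<theta> ^^ i) (y j)"
        using False ij y'[of j] by (simp add: \<theta>_iter_add \<theta>_iter_sum \<theta>_iter_scale)
      finally show ?thesis .
    qed
    finally show "index_mat (?A y) (i, j) = index_mat (?A z * U) (i, j)"
      using ij by simp
  qed (simp_all add: U_def)
  moreover have "det U = 1"
  proof -
    have "upper_triangular U"
      by (auto simp: U_def upper_triangular_def)
    then have "det U = prod_list (diag_mat U)"
      by (rule det_upper_triangular[of _ n]) (simp add: U_def)
    also have "\<dots> = (\<Prod>i = 0..<n. index_mat U (i, i))"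
      by (simp add: prod_list_diag_prod U_def)
    also have "\<dots> = 1"
      by (rule prod.neutral) (simp add: U_def)
    finally show ?thesis .
  qed
  ultimately show ?thesis
    unfolding wronskian_def by (simp add: det_mult[of _ n] U_def)
qed

lemma wronskian_expand:
  "wronskian n y = (\<Sum>p\<in>{p. p permutes {0..<n}}. signof p * (\<Prod>i=0..<n. (\<theta> ^^ i) (y (p i))))"
proof -
  have "p i < n" if "p permutes {0..<n}" "i < n" for p i
    using permutes_in_image[OF that(1), of i] that(2) by simp
  then show ?thesis
    unfolding wronskian_def by (subst det_def'[of _ n]) (auto intro!: sum.cong prod.cong)
qed

text \<open>
  Each application of \<open>\<theta>\<close> lowers the order by at most \<open>e\<close> times the degree of \<open>\<delta>\<close>, and a term of the
  expansion of the determinant takes one entry from each column.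
\<close>

lemma ord_wronskian:
  assumes "\<And>j. j < n \<Longrightarrow> ord_ge (y j) (s j)"
  shows "ord_ge (wronskian n y) ((\<Sum>j<n. s j) - int n * int n * (int e * int (degree \<delta>)))"
  unfolding wronskian_expand
proof (rule ord_ge_sum)
  fix p assume "p \<in> {p. p permutes {0..<n}}"
  then have p: "p permutes {0..<n}" by simp
  let ?c = "int e * int (degree \<delta>)"
  have "ord_ge ((\<theta> ^^ i) (y (p i))) (s (p i) - int n * ?c)" if "i \<in> {0..<n}" for i
  proof -
    have "p i < n"
      using permutes_in_image[OF p, of i] that by simp
    then have "ord_ge ((\<theta> ^^ i) (y (p i))) (s (p i) - int i * ?c)"
      by (intro ord_\<theta>_iter assms)
    then show ?thesis
      using that by (elim ord_ge_mono) (auto intro!: mult_right_mono)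
  qed
  then have "ord_ge (\<Prod>i=0..<n. (\<theta> ^^ i) (y (p i))) (\<Sum>i=0..<n. s (p i) - int n * ?c)"
    by (rule ord_ge_prod)
  moreover have "(\<Sum>i=0..<n. s (p i)) = (\<Sum>j<n. s j)"
    using sum.permute[OF p, of s] by (simp add: o_def lessThan_atLeast0)
  moreover have "ord_ge (signof p :: 'k fls) 0"
    by (cases "sign p = 1") (auto simp: ord_ge_iff sign_def)
  ultimately show "ord_ge (signof p * (\<Prod>i=0..<n. (\<theta> ^^ i) (y (p i)))) ((\<Sum>j<n. s j) - int n * int n * ?c)"
    using ord_ge_mult[of "signof p :: 'k fls" 0 "\<Prod>i=0..<n. (\<theta> ^^ i) (y (p i))" "\<Sum>i=0..<n. s (p i) - int n * ?c"]
    by (simp add: sum_subtractf mult.assoc)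
qed

lemma tuple_poly_wronskian:
  assumes "\<And>j. j < n \<Longrightarrow> \<Phi> j \<in> tuple_poly"
  shows "(\<lambda>\<tau>. wronskian n (\<lambda>j. \<Phi> j \<tau>)) \<in> tuple_poly"
  unfolding wronskian_expand
proof (rule tuple_poly_sum)
  fix p assume "p \<in> {p. p permutes {0..<n}}"
  then have p: "p permutes {0..<n}" by simp
  have "(\<lambda>_. signof p) \<in> tuple_poly"
  proof -
    have "(signof p :: 'k fls) = \<iota> (signof p)"
      by (simp add: \<iota>.hom_signof)
    then show ?thesis by (simp only: tuple_poly.const)
  qed
  moreover have "(\<lambda>\<tau>. \<Prod>i=0..<n. (\<theta> ^^ i) (\<Phi> (p i) \<tau>)) \<in> tuple_poly"
  proof (rule tuple_poly_prod)
    fix i assume "i \<in> {0..<n}"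
    then have "p i < n"
      using permutes_in_image[OF p, of i] by simp
    then show "(\<lambda>\<tau>. (\<theta> ^^ i) (\<Phi> (p i) \<tau>)) \<in> tuple_poly"
      by (intro tuple_poly_\<theta>_iter assms)
  qed
  ultimately show "(\<lambda>\<tau>. signof p * (\<Prod>i=0..<n. (\<theta> ^^ i) (\<Phi> (p i) \<tau>))) \<in> tuple_poly"
    by (rule tuple_poly.mult)
qed

subsection \<open>Spaces of monomials\<close>

text \<open>
  Monomials in \<open>T\<close> and the variables, of weight at most \<open>r\<close> when \<open>T\<close> has weight 1 and each variable has
  weight \<open>c\<close>. They are functions of index tuples, as above.
\<close>

inductive weighted_monomial :: "nat \<Rightarrow> ((nat \<Rightarrow> nat) \<Rightarrow> 'k fls) \<Rightarrow> bool" where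
  one: "weighted_monomial 0 (\<lambda>_. 1)"
| weaken: "weighted_monomial r \<Phi> \<Longrightarrow> weighted_monomial (Suc r) \<Phi>"
| T_factor: "weighted_monomial r \<Phi> \<Longrightarrow> weighted_monomial (Suc r) (\<lambda>\<tau>. T * \<Phi> \<tau>)"
| root_factor: "weighted_monomial r \<Phi> \<Longrightarrow> j < d \<Longrightarrow> weighted_monomial (r + c) (\<lambda>\<tau>. \<rho> (\<tau> j) * \<Phi> \<tau>)"

lemma weighted_monomial_tuple_poly: "weighted_monomial r \<Phi> \<Longrightarrow> \<Phi> \<in> tuple_poly"
  by (induction rule: weighted_monomial.induct) (simp_all add: tuple_poly_1 tuple_poly.intros)

lemma weighted_monomial_ord: "weighted_monomial r \<Phi> \<Longrightarrow> ord_ge (\<Phi> \<tau>) (- int e * int r)"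
proof (induction rule: weighted_monomial.induct)
  case (weaken r \<Phi>)
  from weaken.IH show ?case by (rule ord_ge_mono) (simp add: algebra_simps)
next
  case (T_factor r \<Phi>)
  from ord_ge_mult[OF ord_\<iota>[of "[:0, 1:]"] T_factor.IH] show ?case by (rule ord_ge_mono) (simp add: algebra_simps)
next
  case (root_factor r \<Phi> j)
  from ord_ge_mult[OF ord_\<rho>[of "\<tau> j"] root_factor.IH] show ?case by (rule ord_ge_mono) (simp add: algebra_simps)
qed simp

text \<open>
  Substituting variables for variables preserves monomials and weights, even if two variables are
  identified. Hence the values at all tuples lie in the same finite-dimensional space.
\<close>

lemma weighted_monomial_comp: "weighted_monomial r \<Phi> \<Longrightarrow> (\<And>j. j < d \<Longrightarrow> \<tau> j < d) \<Longrightarrow> weighted_monomial r (\<lambda>\<sigma>. \<Phi> (\<sigma> \<circ> \<tau>))"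
proof (induction rule: weighted_monomial.induct)
  case (root_factor r \<Phi> j)
  from weighted_monomial.root_factor[OF root_factor.IH[OF root_factor.prems] root_factor.prems[OF root_factor.hyps(2)]]
  show ?case
    by (simp add: o_def)
qed (auto intro: weighted_monomial.intros)

definition weighted_values :: "nat \<Rightarrow> 'k fls set" where
  "weighted_values r = {\<Phi> id | \<Phi>. weighted_monomial r \<Phi>}"

lemma weighted_valuesI: "weighted_monomial r \<Phi> \<Longrightarrow> \<Phi> id = x \<Longrightarrow> x \<in> weighted_values r"
  by (auto simp: weighted_values_def)

lemma weighted_monomial_value:
  assumes "weighted_monomial r \<Phi>" "\<And>j. j < d \<Longrightarrow> \<tau> j < d"
  shows "\<Phi> \<tau> \<in> weighted_values r"
proof -
  have "weighted_monomial r (\<lambda>\<sigma>. \<Phi> (\<sigma> \<circ> \<tau>))"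
    using assms by (rule weighted_monomial_comp)
  then show ?thesis
    by (rule weighted_valuesI) simp
qed

lemma one_weighted_values: "1 \<in> weighted_values r"
proof -
  have "weighted_monomial r (\<lambda>_. 1)"
    by (induction r) (auto intro: weighted_monomial.intros)
  then show ?thesis by (auto simp: weighted_values_def)
qed

lemma root_weighted_values:
  assumes "x \<in> weighted_values r" "j < d"
  shows "\<rho> j * x \<in> weighted_values (r + c)"
proof -
  obtain \<Phi> where \<Phi>: "weighted_monomial r \<Phi>" "x = \<Phi> id"
    using assms(1) unfolding weighted_values_def by blast
  have "weighted_monomial (r + c) (\<lambda>\<tau>. \<rho> (\<tau> j) * \<Phi> \<tau>)"
    using \<Phi>(1) assms(2) by (rule weighted_monomial.root_factor)
  then show ?thesis
    by (rule weighted_valuesI) (simp add: \<Phi>(2))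
qed

text \<open>
  Monomials in which no root has an exponent of \<open>d\<close> or more generate the ring over \<open>K[T]\<close>. A tuple
  now serves as a vector of exponents.
\<close>

definition reduced_monomial :: "(nat \<Rightarrow> nat) \<Rightarrow> 'k fls" where
  "reduced_monomial m = (\<Prod>j<d. \<rho> j ^ m j)"

definition reduced :: "nat \<Rightarrow> 'k fls set" where
  "reduced s = {\<Sum>m\<in>tuples. \<iota> (g m) * reduced_monomial m | g. \<forall>m. degree (g m) \<le> s}"

lemma reducedI: "(\<And>m. degree (g m) \<le> s) \<Longrightarrow> (\<Sum>m\<in>tuples. \<iota> (g m) * reduced_monomial m) \<in> reduced s"
  by (auto simp: reduced_def)

lemma reduced_0: "0 \<in> reduced s"
  using reducedI[of "\<lambda>_. 0" s] by simp

lemma reduced_mono: "x \<in> reduced s \<Longrightarrow> s \<le> t \<Longrightarrow> x \<in> reduced t"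
  unfolding reduced_def using order.trans by blast

lemma reduced_add:
  assumes "x \<in> reduced s" "y \<in> reduced s"
  shows "x + y \<in> reduced s"
proof -
  obtain g h where "x = (\<Sum>m\<in>tuples. \<iota> (g m) * reduced_monomial m)" "\<And>m. degree (g m) \<le> s"
    "y = (\<Sum>m\<in>tuples. \<iota> (h m) * reduced_monomial m)" "\<And>m. degree (h m) \<le> s"
    using assms unfolding reduced_def by blast
  then show ?thesis
    using reducedI[of "\<lambda>m. g m + h m" s] by (simp add: \<iota>.hom_add ring_distribs sum.distrib degree_add_le)
qed

lemma reduced_sum: "(\<And>i. i \<in> I \<Longrightarrow> f i \<in> reduced s) \<Longrightarrow> (\<Sum>i\<in>I. f i) \<in> reduced s"
  by (induction I rule: infinite_finite_induct) (simp_all add: reduced_0 reduced_add)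

lemma reduced_mult:
  assumes "x \<in> reduced s"
  shows "\<iota> h * x \<in> reduced (degree h + s)"
proof -
  obtain g where g: "x = (\<Sum>m\<in>tuples. \<iota> (g m) * reduced_monomial m)" "\<And>m. degree (g m) \<le> s"
    using assms unfolding reduced_def by blast
  have "degree (h * g m) \<le> degree h + s" for m
    using degree_mult_le[of h "g m"] g(2)[of m] by linarith
  from reducedI[OF this] show ?thesis
    by (simp add: g(1) \<iota>.hom_mult sum_distrib_left mult.assoc)
qed

lemma finite_tuples: "finite tuples"
  by (intro finite_PiE) auto

lemma reduced_monomial_reduced:
  assumes "m \<in> tuples"
  shows "reduced_monomial m \<in> reduced 0"
proof -
  have "(\<Sum>m'\<in>tuples. \<iota> (if m' = m then 1 else 0) * reduced_monomial m') = 
      (\<Sum>m'\<in>tuples. if m' = m then reduced_monomial m' else 0)"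
    by (intro sum.cong) auto
  also have "\<dots> = reduced_monomial m"
    using assms finite_tuples by simp
  finally show ?thesis
    using reducedI[of "\<lambda>m'. if m' = m then 1 else 0" 0] by simp
qed

lemma one_reduced: "1 \<in> reduced 0"
proof -
  have "reduced_monomial (restrict (\<lambda>_. 0) {..<d}) = 1"
    by (simp add: reduced_monomial_def)
  moreover have "restrict (\<lambda>_. 0) {..<d} \<in> tuples"
    using d by auto
  ultimately show ?thesis
    using reduced_monomial_reduced by metis
qed

lemma root_power: "\<rho> j ^ d = (\<Sum>l<d. \<iota> (- coeff P l) * \<rho> j ^ l)"
proof -
  have "0 = (\<Sum>l\<le>d. \<iota> (coeff P l) * \<rho> j ^ l)"
    using root[of j] by (simp add: poly_altdef deg_P)
  also have "\<dots> = (\<Sum>l<d. \<iota> (coeff P l) * \<rho> j ^ l) + \<rho> j ^ d"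
    using monic deg_P by (simp add: lessThan_Suc_atMost[symmetric])
  finally show ?thesis
    by (simp add: \<iota>.hom_uminus sum_negf eq_neg_iff_add_eq_0 add.commute)
qed

text \<open>
  Multiplication by a root raises an exponent. If it becomes \<open>d\<close>, the equation of the root lowers it
  again, at the expense of a coefficient of degree at most \<open>c\<close>; the weight is respected.
\<close>

lemma root_reduced_monomial:
  assumes m: "m \<in> tuples" and j: "j < d"
  shows "\<rho> j * reduced_monomial m \<in> reduced c"
proof -
  have upd: "reduced_monomial (m(j := l)) = \<rho> j ^ l * (\<Prod>i\<in>{..<d} - {j}. \<rho> i ^ m i)" for l
  proof -
    have "(\<Prod>i\<in>{..<d} - {j}. \<rho> i ^ (m(j := l)) i) = (\<Prod>i\<in>{..<d} - {j}. \<rho> i ^ m i)"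
      by (rule prod.cong) auto
    then show ?thesis
      using j by (simp add: reduced_monomial_def prod.remove[of "{..<d}" j])
  qed
  have upd_mem: "m(j := l) \<in> tuples" if "l < d" for l
    using m j that by (auto simp: PiE_iff extensional_def)
  have step: "\<rho> j * reduced_monomial m = \<rho> j ^ Suc (m j) * (\<Prod>i\<in>{..<d} - {j}. \<rho> i ^ m i)"
    using upd[of "m j"] by (simp add: mult.assoc)
  have "m j < d"
    using m j by (auto simp: PiE_iff)
  then consider "Suc (m j) < d" | "Suc (m j) = d" by linarith
  then show ?thesis
  proof cases
    case 1
    then have "\<rho> j * reduced_monomial m = reduced_monomial (m(j := Suc (m j)))"
      by (simp only: step upd)
    then show ?thesis
      using reduced_mono[OF reduced_monomial_reduced[OF upd_mem[OF 1]], of c] by simp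
  next
    case 2
    then have "\<rho> j * reduced_monomial m = (\<Sum>l<d. \<iota> (- coeff P l) * reduced_monomial (m(j := l)))"
      by (simp only: step root_power upd sum_distrib_right mult.assoc)
    also have "\<dots> \<in> reduced c"
    proof (rule reduced_sum)
      fix l assume "l \<in> {..<d}"
      then have "reduced_monomial (m(j := l)) \<in> reduced 0"
        by (intro reduced_monomial_reduced upd_mem) simp
      from reduced_mult[OF this, of "- coeff P l"]
      show "\<iota> (- coeff P l) * reduced_monomial (m(j := l)) \<in> reduced c"
        by (rule reduced_mono) (simp add: deg_coeff)
    qed
    finally show ?thesis .
  qed
qed

lemma root_reduced:
  assumes x: "x \<in> reduced s" and j: "j < d"
  shows "\<rho> j * x \<in> reduced (s + c)"
proof -
  obtain g where g: "x = (\<Sum>m\<in>tuples. \<iota> (g m) * reduced_monomial m)" "\<And>m. degree (g m) \<le> s"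
    using x unfolding reduced_def by blast
  have "\<rho> j * x = (\<Sum>m\<in>tuples. \<iota> (g m) * (\<rho> j * reduced_monomial m))"
    by (simp add: g(1) sum_distrib_left mult_ac)
  also have "\<dots> \<in> reduced (s + c)"
  proof (rule reduced_sum)
    fix m assume "m \<in> tuples"
    from reduced_mult[OF root_reduced_monomial[OF this j], of "g m"]
    show "\<iota> (g m) * (\<rho> j * reduced_monomial m) \<in> reduced (s + c)"
      by (rule reduced_mono) (simp add: g(2))
  qed
  finally show ?thesis .
qed

lemma weighted_monomial_reduced: "weighted_monomial r \<Phi> \<Longrightarrow> \<Phi> id \<in> reduced r"
proof (induction rule: weighted_monomial.induct)
  case one
  show ?case by (rule one_reduced)
next
  case (weaken r \<Phi>)
  from weaken.IH show ?case by (rule reduced_mono) simp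
next
  case (T_factor r \<Phi>)
  from reduced_mult[OF T_factor.IH, of "[:0, 1:]"] show ?case by simp
next
  case (root_factor r \<Phi> j)
  from root_reduced[OF root_factor.IH root_factor.hyps(2)] show ?case by simp
qed

lemma span_weighted_values_reduced: "ksp.span (weighted_values r) \<subseteq> reduced r"
proof (rule ksp.span_minimal)
  show "weighted_values r \<subseteq> reduced r"
    by (auto simp: weighted_values_def intro: weighted_monomial_reduced)
  show "ksp.subspace (reduced r)"
  proof (rule ksp.subspaceI)
    fix a x assume "x \<in> reduced r"
    from reduced_mult[OF this, of "[:a:]"] show "fls_const a * x \<in> reduced r"
      by (simp add: emb_const[OF e])
  qed (auto intro: reduced_0 reduced_add)
qed

lemma \<iota>_expand:
  assumes "degree g \<le> s"
  shows "\<iota> g = (\<Sum>i\<le>s. fls_const (coeff g i) * T ^ i)"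
proof -
  have "g = (\<Sum>i\<le>s. monom (coeff g i) i)"
    using poly_as_sum_of_monoms'[OF assms] by simp
  also have "\<dots> = (\<Sum>i\<le>s. [:coeff g i:] * [:0, 1:] ^ i)"
    by (simp add: monom_altdef)
  finally have "\<iota> g = \<iota> (\<Sum>i\<le>s. [:coeff g i:] * [:0, 1:] ^ i)"
    by simp
  then show ?thesis
    by (simp only: \<iota>.hom_sum \<iota>.hom_mult \<iota>.hom_power emb_const[OF e])
qed

definition generators :: "nat \<Rightarrow> 'k fls set" where
  "generators s = (\<lambda>(i, m). T ^ i * reduced_monomial m) ` ({..s} \<times> tuples)"

lemma finite_generators: "finite (generators s)"
  unfolding generators_def using finite_tuples by auto

lemma card_generators: "card (generators s) \<le> Suc s * d ^ d"
proof -
  have "card (generators s) \<le> card ({..s} \<times> tuples)"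
    unfolding generators_def using finite_tuples by (intro card_image_le) auto
  also have "\<dots> = Suc s * d ^ d"
    by (simp add: card_cartesian_product card_PiE)
  finally show ?thesis .
qed

lemma reduced_generators: "reduced s \<subseteq> ksp.span (generators s)"
proof
  fix x assume "x \<in> reduced s"
  then obtain g where g: "x = (\<Sum>m\<in>tuples. \<iota> (g m) * reduced_monomial m)" "\<And>m. degree (g m) \<le> s"
    unfolding reduced_def by blast
  have "x = (\<Sum>m\<in>tuples. \<Sum>i\<le>s. fls_const (coeff (g m) i) * (T ^ i * reduced_monomial m))"
    by (simp add: g(1) \<iota>_expand[OF g(2)] sum_distrib_right mult.assoc)
  also have "\<dots> \<in> ksp.span (generators s)"
    by (intro ksp.span_sum ksp.span_scale ksp.span_base) (auto simp: generators_def)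
  finally show "x \<in> ksp.span (generators s)" .
qed

lemma weighted_values_generators: "weighted_values r \<subseteq> ksp.span (generators r)"
  using span_weighted_values_reduced[of r] reduced_generators[of r] ksp.span_superset[of "weighted_values r"] by blast

text \<open>
  A basis is chosen among the monomials themselves, so that its elements can be evaluated at other
  tuples as well.
\<close>

lemma weighted_values_basis:
  "\<exists>\<beta>. (\<forall>j<ksp.dim (weighted_values r). weighted_monomial r (\<beta> j)) \<and> inj_on (\<lambda>j. \<beta> j id) {..<ksp.dim (weighted_values r)} \<and>
    ksp.independent ((\<lambda>j. \<beta> j id) ` {..<ksp.dim (weighted_values r)}) \<and>
    ksp.span ((\<lambda>j. \<beta> j id) ` {..<ksp.dim (weighted_values r)}) = ksp.span (weighted_values r)"
proof -
  obtain S where S: "S \<subseteq> weighted_values r" "ksp.independent S" "weighted_values r \<subseteq> ksp.span S" "card S = ksp.dim (weighted_values r)"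
    using ksp.basis_exists[of "weighted_values r"] by blast
  have "finite S"
    using ksp.independent_span_bound[OF finite_generators S(2)] S(1) weighted_values_generators[of r] by blast
  then obtain b where b: "bij_betw b {..<ksp.dim (weighted_values r)} S"
    using ex_bij_betw_nat_finite[of S] S(4) by (auto simp: lessThan_atLeast0)
  have "\<forall>x. \<exists>\<Phi>. x \<in> weighted_values r \<longrightarrow> weighted_monomial r \<Phi> \<and> \<Phi> id = x"
    by (auto simp: weighted_values_def)
  then obtain F where F: "\<And>x. x \<in> weighted_values r \<Longrightarrow> weighted_monomial r (F x) \<and> F x id = x"
    by metis
  have bS: "b j \<in> S" if "j < ksp.dim (weighted_values r)" for j
    using b that by (auto simp: bij_betw_def)
  then have weighted_values: "F (b j) id = b j" if "j < ksp.dim (weighted_values r)" for j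
    using F S(1) that by blast
  have img: "(\<lambda>j. F (b j) id) ` {..<ksp.dim (weighted_values r)} = S"
    using b weighted_values by (auto simp: bij_betw_def image_iff)
  have span: "ksp.span S = ksp.span (weighted_values r)"
    using S(1,3) ksp.span_mono ksp.span_minimal[OF S(3) ksp.subspace_span] by blast
  have inj: "inj_on (\<lambda>j. F (b j) id) {..<ksp.dim (weighted_values r)}"
    using b weighted_values by (auto simp: bij_betw_def inj_on_def)
  have "weighted_monomial r (F (b j))" if "j < ksp.dim (weighted_values r)" for j
    using F S(1) bS[OF that] by blast
  then show ?thesis
    using inj img S(2) span by (intro exI[of _ "\<lambda>j. F (b j)"]) simp
qed

lemma dim_weighted_values_le: "ksp.dim (weighted_values r) \<le> Suc r * d ^ d"
proof -
  have "ksp.dim (weighted_values r) \<le> card (generators r)"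
    by (rule ksp.dim_le_card[OF weighted_values_generators finite_generators])
  then show ?thesis using card_generators[of r] by linarith
qed

lemma dim_weighted_values_pos: "ksp.dim (weighted_values r) > 0"
proof (rule ccontr)
  assume "\<not> ?thesis"
  then have "ksp.dim (weighted_values r) = 0" by simp
  moreover obtain S where S: "S \<subseteq> weighted_values r" "ksp.independent S" "weighted_values r \<subseteq> ksp.span S" "card S = ksp.dim (weighted_values r)"
    using ksp.basis_exists[of "weighted_values r"] by blast
  moreover have "finite S"
    using ksp.independent_span_bound[OF finite_generators S(2)] S(1) weighted_values_generators[of r] by blast
  ultimately have "weighted_values r \<subseteq> {0}" by simp
  then show False
    using one_weighted_values[of r] by auto
qed

subsection \<open>Divisibility by a polynomial\<close>

text \<open>
  Linear independence over \<open>K[T]\<close> or, equivalently, over \<open>K(T)\<close>.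
\<close>

definition poly_independent :: "'k fls set \<Rightarrow> bool" where
  "poly_independent M \<longleftrightarrow> (\<forall>g. (\<Sum>b\<in>M. \<iota> (g b) * b) = 0 \<longrightarrow> (\<forall>b\<in>M. g b = 0))"

text \<open>
  A basis of the \<open>K(T)\<close>-span of a finite set, chosen within the set, with a common denominator \<open>h\<close> for
  the coordinates of all its elements.
\<close>

lemma poly_basis:
  assumes "finite M"
  shows "\<exists>M0\<subseteq>M. poly_independent M0 \<and> (\<exists>h. h \<noteq> 0 \<and> (\<forall>m\<in>M. \<exists>g. \<iota> h * m = (\<Sum>b\<in>M0. \<iota> (g b) * b)))"
  using assms
proof (induction M rule: finite_induct)
  case empty
  show ?case
    by (intro exI[of _ "{}"]) (auto simp: poly_independent_def intro: exI[of _ 1])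
next
  case (insert m M)
  then obtain M0 h where M0: "M0 \<subseteq> M" "poly_independent M0" "h \<noteq> 0"
    "\<And>x. x \<in> M \<Longrightarrow> \<exists>g. \<iota> h * x = (\<Sum>b\<in>M0. \<iota> (g b) * b)" by blast
  have fin: "finite M0" and m: "m \<notin> M0"
    using M0(1) insert.hyps finite_subset by auto
  show ?case
  proof (cases "poly_independent (insert m M0)")
    case True
    have "\<exists>g. \<iota> h * x = (\<Sum>b\<in>insert m M0. \<iota> (g b) * b)" if x: "x \<in> insert m M" for x
    proof (cases "x = m")
      case True
      have "(\<Sum>b\<in>M0. \<iota> (if b = m then h else 0) * b) = 0"
        using m by (intro sum.neutral) auto
      then show ?thesis
        using True fin m by (intro exI[of _ "\<lambda>b. if b = m then h else 0"]) simp
    next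
      case False
      then obtain g where g: "\<iota> h * x = (\<Sum>b\<in>M0. \<iota> (g b) * b)"
        using M0(4) x by blast
      have "(\<Sum>b\<in>M0. \<iota> ((g(m := 0)) b) * b) = (\<Sum>b\<in>M0. \<iota> (g b) * b)"
        using m by (intro sum.cong) auto
      then show ?thesis
        using g fin m by (intro exI[of _ "g(m := 0)"]) simp
    qed
    then show ?thesis
      using True M0(1,3) by (intro exI[of _ "insert m M0"]) blast
  next
    case False
    then obtain g b0 where g: "(\<Sum>b\<in>insert m M0. \<iota> (g b) * b) = 0" "b0 \<in> insert m M0" "g b0 \<noteq> 0"
      unfolding poly_independent_def by blast
    have sum: "\<iota> (g m) * m + (\<Sum>b\<in>M0. \<iota> (g b) * b) = 0"
      using g(1) fin m by simp
    have gm: "g m \<noteq> 0"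
    proof
      assume "g m = 0"
      then have "(\<Sum>b\<in>M0. \<iota> (g b) * b) = 0"
        using sum by simp
      then have "\<forall>b\<in>M0. g b = 0"
        using M0(2) unfolding poly_independent_def by blast
      then show False
        using g(2,3) \<open>g m = 0\<close> by auto
    qed
    have "\<exists>g'. \<iota> (h * g m) * x = (\<Sum>b\<in>M0. \<iota> (g' b) * b)" if x: "x \<in> insert m M" for x
    proof (cases "x = m")
      case True
      have "\<iota> (g m) * m = - (\<Sum>b\<in>M0. \<iota> (g b) * b)"
        using sum by (simp add: eq_neg_iff_add_eq_0)
      then have "\<iota> (h * g m) * x = (\<Sum>b\<in>M0. \<iota> (- (h * g b)) * b)"
        using True by (simp add: \<iota>.hom_mult \<iota>.hom_uminus sum_negf sum_distrib_left mult.assoc)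
      then show ?thesis by (intro exI[of _ "\<lambda>b. - (h * g b)"])
    next
      case False
      then obtain g' where g': "\<iota> h * x = (\<Sum>b\<in>M0. \<iota> (g' b) * b)"
        using M0(4) x by blast
      have "\<iota> (h * g m) * x = \<iota> (g m) * (\<iota> h * x)"
        by (simp add: \<iota>.hom_mult mult_ac)
      also have "\<dots> = (\<Sum>b\<in>M0. \<iota> (g m * g' b) * b)"
        by (simp add: g' \<iota>.hom_mult sum_distrib_left mult.assoc)
      finally show ?thesis by (intro exI[of _ "\<lambda>b. g m * g' b"])
    qed
    moreover have "h * g m \<noteq> 0"
      using M0(3) gm by simp
    ultimately show ?thesis
      using M0(1,2) by (intro exI[of _ M0]) blast
  qed
qed

text \<open>
  Coordinates with respect to a \<open>K(T)\<close>-basis of monomials: those of \<open>v\<close> are polynomials of degree at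
  most \<open>r + C\<close> after multiplication by the common denominator, and \<open>q\<close> divides each of them, while
  they do not all vanish.
\<close>

theorem degree_divisor_bound:
  "\<exists>C. \<forall>q r s v u. v \<in> reduced r \<longrightarrow> u \<in> reduced s \<longrightarrow> v \<noteq> 0 \<longrightarrow> v = \<iota> q * u \<longrightarrow> degree q \<le> r + C"
proof -
  define M where "M = reduced_monomial ` tuples"
  have "finite M"
    unfolding M_def using finite_tuples by (rule finite_imageI)
  from poly_basis[OF this] obtain M0 h where M0: "M0 \<subseteq> M" "poly_independent M0" "h \<noteq> 0"
    "\<And>x. x \<in> M \<Longrightarrow> \<exists>g. \<iota> h * x = (\<Sum>b\<in>M0. \<iota> (g b) * b)" by blast
  have finM0: "finite M0"
    using M0(1) \<open>finite M\<close> finite_subset by blast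
  have "\<forall>m. \<exists>g. m \<in> tuples \<longrightarrow> \<iota> h * reduced_monomial m = (\<Sum>b\<in>M0. \<iota> (g b) * b)"
    using M0(4) unfolding M_def by blast
  then obtain \<gamma> where \<gamma>: "\<And>m. m \<in> tuples \<Longrightarrow> \<iota> h * reduced_monomial m = (\<Sum>b\<in>M0. \<iota> (\<gamma> m b) * b)"
    by metis
  define C where "C = (\<Sum>m\<in>tuples. \<Sum>b\<in>M0. degree (\<gamma> m b))"
  have C: "degree (\<gamma> m b) \<le> C" if "m \<in> tuples" "b \<in> M0" for m b
  proof -
    have "degree (\<gamma> m b) \<le> (\<Sum>b\<in>M0. degree (\<gamma> m b))"
      using that(2) finM0 by (intro member_le_sum) auto
    also have "\<dots> \<le> C"
      unfolding C_def using that(1) finite_tuples by (intro member_le_sum) auto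
    finally show ?thesis .
  qed
  have rep: "\<exists>G. \<iota> h * x = (\<Sum>b\<in>M0. \<iota> (G b) * b) \<and> (\<forall>b\<in>M0. degree (G b) \<le> r + C)"
    if x: "x \<in> reduced r" for x r
  proof -
    obtain g where g: "x = (\<Sum>m\<in>tuples. \<iota> (g m) * reduced_monomial m)" "\<And>m. degree (g m) \<le> r"
      using x unfolding reduced_def by blast
    define G where "G = (\<lambda>b. \<Sum>m\<in>tuples. g m * \<gamma> m b)"
    have "\<iota> h * x = (\<Sum>m\<in>tuples. \<iota> (g m) * (\<iota> h * reduced_monomial m))"
      by (simp add: g(1) sum_distrib_left mult_ac)
    also have "\<dots> = (\<Sum>m\<in>tuples. \<Sum>b\<in>M0. \<iota> (g m * \<gamma> m b) * b)"
      by (intro sum.cong refl) (simp add: \<gamma> sum_distrib_left \<iota>.hom_mult mult.assoc)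
    also have "\<dots> = (\<Sum>b\<in>M0. \<iota> (G b) * b)"
      by (subst sum.swap) (simp add: G_def \<iota>.hom_sum sum_distrib_right)
    finally have "\<iota> h * x = (\<Sum>b\<in>M0. \<iota> (G b) * b)" .
    moreover have "degree (G b) \<le> r + C" if "b \<in> M0" for b
      unfolding G_def
    proof (rule degree_sum_le[OF finite_tuples])
      fix m assume m: "m \<in> tuples"
      show "degree (g m * \<gamma> m b) \<le> r + C"
        using degree_mult_le[of "g m" "\<gamma> m b"] g(2)[of m] C[OF m that] by linarith
    qed
    ultimately show ?thesis by blast
  qed
  have "degree q \<le> r + C" if v: "v \<in> reduced r" and u: "u \<in> reduced s" and nz: "v \<noteq> 0" and eq: "v = \<iota> q * u"
    for q r s v u
  proof -
    obtain G where G: "\<iota> h * v = (\<Sum>b\<in>M0. \<iota> (G b) * b)" "\<And>b. b \<in> M0 \<Longrightarrow> degree (G b) \<le> r + C"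
      using rep[OF v] by blast
    obtain U where U: "\<iota> h * u = (\<Sum>b\<in>M0. \<iota> (U b) * b)"
      using rep[OF u] by blast
    have "(\<Sum>b\<in>M0. \<iota> (G b - q * U b) * b) = \<iota> h * v - \<iota> q * (\<iota> h * u)"
      by (simp add: G(1) U \<iota>.hom_minus \<iota>.hom_mult left_diff_distrib sum_subtractf sum_distrib_left mult.assoc)
    also have "\<dots> = 0"
      by (simp add: eq)
    finally have "\<forall>b\<in>M0. G b - q * U b = 0"
      using M0(2) unfolding poly_independent_def by (elim allE[of _ "\<lambda>b. G b - q * U b"]) simp
    then have GU: "G b = q * U b" if "b \<in> M0" for b
      using that by simp
    have "\<iota> h * v \<noteq> 0"
      using nz M0(3) by simp
    then obtain b where b: "b \<in> M0" "G b \<noteq> 0"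
      unfolding G(1) by (metis (no_types, lifting) \<iota>.hom_zero mult_zero_left sum.neutral)
    then have "degree q \<le> degree (G b)"
      using GU by (metis degree_mult_right_le mult_eq_0_iff)
    then show ?thesis
      using G(2)[OF b(1)] by linarith
  qed
  then show ?thesis by blast
qed

subsection \<open>The Wronskian of an approximation\<close>

lemma weighted_monomial_restrict_id: "weighted_monomial r \<Phi> \<Longrightarrow> \<Phi> (restrict id {..<d}) = \<Phi> id"
  by (induction rule: weighted_monomial.induct) simp_all

text \<open>
  The functions whose Wronskian is studied, as functions of an index tuple: first \<open>q\<close> times
  the \<open>k\<close> functions \<open>\<beta> j\<close>, then \<open>p\<close> times the functions \<open>b i\<close>.
\<close>

definition approx_family :: "nat \<Rightarrow> 'k poly \<Rightarrow> 'k poly \<Rightarrow> (nat \<Rightarrow> (nat \<Rightarrow> nat) \<Rightarrow> 'k fls) \<Rightarrow>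
    (nat \<Rightarrow> (nat \<Rightarrow> nat) \<Rightarrow> 'k fls) \<Rightarrow> nat \<Rightarrow> (nat \<Rightarrow> nat) \<Rightarrow> 'k fls" where
  "approx_family k p q \<beta> b j \<tau> = (if j < k then \<iota> q * \<beta> j \<tau> else \<iota> p * b (j - k) \<tau>)"

lemma sum_if_less: "(\<Sum>j<k + n. if j < k then f j else g (j - k)) = (\<Sum>j<k. f j) + (\<Sum>i<n. g i)"
  for f g :: "nat \<Rightarrow> 'b::comm_monoid_add"
proof (induction n)
  case 0
  show ?case by simp
qed (simp add: add.assoc)

text \<open>
  If the Wronskian at \<open>\<tau>\<close> does not vanish, the values of the \<open>\<beta> j\<close> at \<open>\<tau>\<close> are linearly independent. They lie in
  a space of dimension \<open>k\<close>, hence span it. This space contains the products of \<open>\<rho> i0\<close> with the values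
  of the \<open>b i\<close>, so that the columns \<open>p * b i\<close> can be replaced by \<open>(p - q * \<rho> i0) * b i\<close>.
  The same root \<open>\<rho> i0\<close> is used for every \<open>\<tau>\<close>.
\<close>

lemma ord_wronskian_approx:
  assumes \<beta>: "\<And>j. j < k \<Longrightarrow> weighted_monomial (r + c) (\<beta> j)" and b: "\<And>i. i < n \<Longrightarrow> weighted_monomial r (b i)"
    and k: "k = ksp.dim (weighted_values (r + c))"
    and i0: "i0 < d" and q: "q \<noteq> 0" and s: "ord_ge (\<iota> p - \<iota> q * \<rho> i0) s"
    and \<tau>: "\<tau> \<in> tuples"
  shows "ord_ge (wronskian (k + n) (\<lambda>j. approx_family k p q \<beta> b j \<tau>))
    (int k * (- int e * int (degree q) - int e * int (r + c)) + int n * (s - int e * int r) -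
     int (k + n) * int (k + n) * (int e * int (degree \<delta>)))"
proof (cases "wronskian (k + n) (\<lambda>j. approx_family k p q \<beta> b j \<tau>) = 0")
  case False
  let ?y = "\<lambda>j. approx_family k p q \<beta> b j \<tau>"
  have \<tau>': "\<tau> j < d" if "j < d" for j
    using \<tau> that by (auto simp: PiE_iff)
  have indep: "\<forall>j<k. \<kappa> j = 0" if rel: "(\<Sum>j<k. fls_const (\<kappa> j) * \<beta> j \<tau>) = 0" for \<kappa>
  proof (intro allI impI, rule ccontr)
    fix j assume j: "j < k" "\<kappa> j \<noteq> 0"
    define \<kappa>' where "\<kappa>' = (\<lambda>j. if j < k then \<kappa> j else 0)"
    have "(\<Sum>j<k + n. fls_const (\<kappa>' j) * ?y j) =
        (\<Sum>j<k + n. if j < k then \<iota> q * (fls_const (\<kappa> j) * \<beta> j \<tau>) else 0)"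
      by (intro sum.cong) (auto simp: \<kappa>'_def approx_family_def)
    also have "\<dots> = \<iota> q * (\<Sum>j<k. fls_const (\<kappa> j) * \<beta> j \<tau>)"
      using sum_if_less[where g = "\<lambda>_. 0 :: 'k fls"] by (simp add: sum_distrib_left)
    finally have "(\<Sum>j<k + n. fls_const (\<kappa>' j) * ?y j) = 0"
      using rel by simp
    then have "wronskian (k + n) ?y = 0"
      by (rule wronskian_dependent[where j = j]) (use j in \<open>simp_all add: \<kappa>'_def\<close>)
    with False show False ..
  qed
  note inj = ksp_independent_family(1)[where n = k and y = "\<lambda>j. \<beta> j \<tau>", OF indep]
  note ind = ksp_independent_family(2)[where n = k and y = "\<lambda>j. \<beta> j \<tau>", OF indep]
  let ?S = "(\<lambda>j. \<beta> j \<tau>) ` {..<k}"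
  have cardS: "card ?S = k"
    using card_image[OF inj] by simp
  obtain \<beta>0 where \<beta>0_wm: "\<And>j. j < k \<Longrightarrow> weighted_monomial (r + c) (\<beta>0 j)"
    and \<beta>0_inj: "inj_on (\<lambda>j. \<beta>0 j id) {..<k}"
    and "ksp.independent ((\<lambda>j. \<beta>0 j id) ` {..<k})"
    and \<beta>0_span: "ksp.span ((\<lambda>j. \<beta>0 j id) ` {..<k}) = ksp.span (weighted_values (r + c))"
    using weighted_values_basis[of "r + c", folded k] by blast
  let ?basis = "(\<lambda>j. \<beta>0 j id) ` {..<k}"
  have "\<beta> j \<tau> \<in> weighted_values (r + c)" if "j < k" for j
    using \<beta>[OF that] \<tau>' by (rule weighted_monomial_value[where \<tau> = \<tau>])
  then have Sval: "?S \<subseteq> weighted_values (r + c)"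
    by (simp add: image_subset_iff)
  have "\<exists>\<kappa>. \<rho> i0 * b i \<tau> = (\<Sum>j<k. fls_const (\<kappa> j) * \<beta> j \<tau>)" if i: "i < n" for i
  proof -
    let ?x = "\<rho> i0 * b i \<tau>"
    have x: "?x \<in> weighted_values (r + c)"
    proof (rule root_weighted_values[OF _ i0])
      show "b i \<tau> \<in> weighted_values r"
        using b[OF i] \<tau>' by (rule weighted_monomial_value[where \<tau> = \<tau>])
    qed
    have mem: "?x \<in> ksp.span ?S"
    proof (rule ksp_span_of_card_eq[of ?basis])
      show "?S \<subseteq> ksp.span ?basis"
        unfolding \<beta>0_span using Sval ksp.span_superset by (rule subset_trans)
      show "?x \<in> ksp.span ?basis"
        unfolding \<beta>0_span using x by (rule ksp.span_base)
      show "card ?S = card ?basis"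
        unfolding cardS using card_image[OF \<beta>0_inj] by simp
      show "finite ?basis" by simp
    qed (rule ind)
    show ?thesis
      using ksp_span_family[where y = "\<lambda>j. \<beta> j \<tau>" and n = k, OF inj mem] by blast
  qed
  then have "\<forall>i. \<exists>\<kappa>. i < n \<longrightarrow> \<rho> i0 * b i \<tau> = (\<Sum>j<k. fls_const (\<kappa> j) * \<beta> j \<tau>)"
    by simp
  then obtain \<kappa> where \<kappa>: "\<And>i. i < n \<Longrightarrow> \<rho> i0 * b i \<tau> = (\<Sum>j<k. fls_const (\<kappa> i j) * \<beta> j \<tau>)"
    using choice[of "\<lambda>i \<kappa>. i < n \<longrightarrow> \<rho> i0 * b i \<tau> = (\<Sum>j<k. fls_const (\<kappa> j) * \<beta> j \<tau>)"] by blast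
  define z where "z = (\<lambda>j. if j < k then \<iota> q * \<beta> j \<tau> else (\<iota> p - \<iota> q * \<rho> i0) * b (j - k) \<tau>)"
  have "wronskian (k + n) ?y = wronskian (k + n) z"
  proof (rule wronskian_column_operation[where k = k and \<kappa> = "\<lambda>i j. \<kappa> (j - k) i"])
    fix j assume j: "k \<le> j" "j < k + n"
    have "z j + (\<Sum>i<k. fls_const (\<kappa> (j - k) i) * z i) =
        (\<iota> p - \<iota> q * \<rho> i0) * b (j - k) \<tau> + \<iota> q * (\<Sum>i<k. fls_const (\<kappa> (j - k) i) * \<beta> i \<tau>)"
      using j by (simp add: z_def sum_distrib_left mult_ac)
    also have "\<dots> = (\<iota> p - \<iota> q * \<rho> i0) * b (j - k) \<tau> + \<iota> q * (\<rho> i0 * b (j - k) \<tau>)"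
      using j by (subst \<kappa>) auto
    also have "\<dots> = ?y j"
      using j by (simp add: approx_family_def algebra_simps)
    finally show "?y j = z j + (\<Sum>i<k. fls_const (\<kappa> (j - k) i) * z i)" ..
  qed (simp_all add: z_def approx_family_def)
  moreover have "ord_ge (wronskian (k + n) z)
    ((\<Sum>j<k + n. if j < k then - int e * int (degree q) - int e * int (r + c) else s - int e * int r) -
     int (k + n) * int (k + n) * (int e * int (degree \<delta>)))"
  proof (rule ord_wronskian)
    fix j assume j: "j < k + n"
    show "ord_ge (z j) (if j < k then - int e * int (degree q) - int e * int (r + c) else s - int e * int r)"
    proof (cases "j < k")
      case True
      from ord_ge_mult[OF ord_\<iota>[of q] weighted_monomial_ord[OF \<beta>[OF True], of \<tau>]] True show ?thesis
        by (simp add: z_def)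
    next
      case False
      then have "j - k < n" using j by linarith
      from ord_ge_mult[OF s weighted_monomial_ord[OF b[OF this], of \<tau>]] False show ?thesis
        by (simp add: z_def)
    qed
  qed
  moreover have "(\<Sum>j<k + n. if j < k then x else y) = int k * x + int n * y" for x y :: int
    using sum_if_less[where k = k and n = n and f = "\<lambda>_. x" and g = "\<lambda>_. y"] by simp
  ultimately show ?thesis by simp
qed simp

text \<open>
  Some sum of \<open>m\<close>-th powers of the Wronskians at all tuples is a nonzero element of \<open>K[T]\<close>, so
  its order is not positive, whereas each summand has order at least \<open>m\<close> times the left-hand side.
\<close>

lemma nonvanishing_bound:
  assumes \<beta>: "\<And>j. j < k \<Longrightarrow> weighted_monomial (r + c) (\<beta> j)" and b: "\<And>i. i < n \<Longrightarrow> weighted_monomial r (b i)"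
    and k: "k = ksp.dim (weighted_values (r + c))"
    and i0: "i0 < d" and q: "q \<noteq> 0" and s: "ord_ge (\<iota> p - \<iota> q * \<rho> i0) s"
    and nz: "wronskian (k + n) (\<lambda>j. approx_family k p q \<beta> b j id) \<noteq> 0"
  shows "int k * (- int e * int (degree q) - int e * int (r + c)) + int n * (s - int e * int r) -
     int (k + n) * int (k + n) * (int e * int (degree \<delta>)) \<le> 0" (is "?S \<le> 0")
proof -
  let ?W = "\<lambda>\<tau>. wronskian (k + n) (\<lambda>j. approx_family k p q \<beta> b j \<tau>)"
  \<comment> \<open>Tuples are extensional functions, so the identity is represented by its restriction.\<close>
  let ?\<tau> = "restrict id {..<d}"
  have "approx_family k p q \<beta> b j ?\<tau> = approx_family k p q \<beta> b j id" if "j < k + n" for j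
    using that weighted_monomial_restrict_id[OF \<beta>] weighted_monomial_restrict_id[OF b, of "j - k"] by (auto simp: approx_family_def)
  then have "?W ?\<tau> = ?W id"
    unfolding wronskian_def by (intro arg_cong[of _ _ det] eq_matI) simp_all
  then have nz': "?W ?\<tau> \<noteq> 0"
    using nz by simp
  moreover have "?\<tau> \<in> tuples" by auto
  ultimately obtain m where m: "m > 0" "(\<Sum>\<tau>\<in>tuples. ?W \<tau> ^ m) \<noteq> 0"
    using exists_power_sum_nonzero[OF finite_tuples, of ?\<tau> ?W] by blast
  have "approx_family k p q \<beta> b j \<in> tuple_poly" if "j < k + n" for j
  proof (cases "j < k")
    case True
    have "(\<lambda>\<tau>. \<iota> q * \<beta> j \<tau>) \<in> tuple_poly"
      by (intro tuple_poly.mult tuple_poly.const weighted_monomial_tuple_poly[OF \<beta>] True)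
    then show ?thesis using True unfolding approx_family_def by simp
  next
    case False
    then have "j - k < n" using that by linarith
    then have "(\<lambda>\<tau>. \<iota> p * b (j - k) \<tau>) \<in> tuple_poly"
      by (intro tuple_poly.mult tuple_poly.const weighted_monomial_tuple_poly[OF b])
    then show ?thesis using False unfolding approx_family_def by simp
  qed
  then have "?W \<in> tuple_poly"
    by (rule tuple_poly_wronskian)
  then have "(\<Sum>\<tau>\<in>tuples. ?W \<tau> ^ m) \<in> range \<iota>"
    by (intro tuple_sum_rational tuple_poly_power)
  then obtain g where g: "(\<Sum>\<tau>\<in>tuples. ?W \<tau> ^ m) = \<iota> g" by blast
  have "ord_ge (\<Sum>\<tau>\<in>tuples. ?W \<tau> ^ m) (int m * ?S)"
    using ord_wronskian_approx[OF \<beta> b k i0 q s] by (intro ord_ge_sum ord_ge_power)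
  then have "int m * ?S \<le> 0"
    using m(2) unfolding g by (intro ord_\<iota>_nonpos) auto
  then show ?thesis
    using m(1) by (simp add: mult_le_0_iff)
qed

text \<open>
  A linear relation gives \<open>q v' + p v = 0\<close> with \<open>v\<close> in the span of the \<open>b i\<close> and \<open>v'\<close> in that of the
  \<open>\<beta> j\<close>; as the \<open>\<beta> j\<close> are independent, \<open>v\<close> is not zero. From \<open>x1 p + y1 q = w\<close> it follows that \<open>w v\<close> is
  a multiple of \<open>q\<close>. For coprime \<open>p\<close> and \<open>q\<close> one can take \<open>w = 1\<close>; other \<open>w\<close> occur when the numerator of
  a reduced fraction is multiplied by a fixed polynomial.
\<close>

lemma vanishing_bound:
  "\<exists>C. \<forall>r k n \<beta> b p q w x1 y1.
    (\<forall>j<k. weighted_monomial (r + c) (\<beta> j)) \<longrightarrow> (\<forall>i<n. weighted_monomial r (b i)) \<longrightarrow>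
    inj_on (\<lambda>j. \<beta> j id) {..<k} \<longrightarrow> ksp.independent ((\<lambda>j. \<beta> j id) ` {..<k}) \<longrightarrow>
    inj_on (\<lambda>i. b i id) {..<n} \<longrightarrow> ksp.independent ((\<lambda>i. b i id) ` {..<n}) \<longrightarrow>
    q \<noteq> 0 \<longrightarrow> w \<noteq> 0 \<longrightarrow> x1 * p + y1 * q = w \<longrightarrow>
    wronskian (k + n) (\<lambda>j. approx_family k p q \<beta> b j id) = 0 \<longrightarrow> degree q \<le> degree w + r + C"
proof -
  obtain C where C: "\<And>q r s v u. v \<in> reduced r \<Longrightarrow> u \<in> reduced s \<Longrightarrow> v \<noteq> 0 \<Longrightarrow> v = \<iota> q * u \<Longrightarrow> degree q \<le> r + C"
    using degree_divisor_bound by blast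
  have "degree q \<le> degree w + r + C"
    if \<beta>: "\<And>j. j < k \<Longrightarrow> weighted_monomial (r + c) (\<beta> j)" and b: "\<And>i. i < n \<Longrightarrow> weighted_monomial r (b i)"
      and \<beta>i: "inj_on (\<lambda>j. \<beta> j id) {..<k}" "ksp.independent ((\<lambda>j. \<beta> j id) ` {..<k})"
      and bi: "inj_on (\<lambda>i. b i id) {..<n}" "ksp.independent ((\<lambda>i. b i id) ` {..<n})"
      and q: "q \<noteq> 0" and w: "w \<noteq> 0" and bez: "x1 * p + y1 * q = w"
      and W: "wronskian (k + n) (\<lambda>j. approx_family k p q \<beta> b j id) = 0"
    for r k n \<beta> b p q w x1 y1
  proof -
    obtain \<kappa> j0 where \<kappa>: "j0 < k + n" "\<kappa> j0 \<noteq> 0"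
      "(\<Sum>j<k + n. fls_const (\<kappa> j) * approx_family k p q \<beta> b j id) = 0"
      using wronskian_eq_0_imp_dependent[OF W] by blast
    define v' where "v' = (\<Sum>j<k. fls_const (\<kappa> j) * \<beta> j id)"
    define v where "v = (\<Sum>i<n. fls_const (\<kappa> (k + i)) * b i id)"
    have "(\<Sum>j<k + n. fls_const (\<kappa> j) * approx_family k p q \<beta> b j id) =
        (\<Sum>j<k + n. if j < k then \<iota> q * (fls_const (\<kappa> j) * \<beta> j id)
           else \<iota> p * (fls_const (\<kappa> (k + (j - k))) * b (j - k) id))"
      by (intro sum.cong) (auto simp: approx_family_def)
    also have "\<dots> = (\<Sum>j<k. \<iota> q * (fls_const (\<kappa> j) * \<beta> j id)) + (\<Sum>i<n. \<iota> p * (fls_const (\<kappa> (k + i)) * b i id))"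
      by (rule sum_if_less[where g = "\<lambda>i. \<iota> p * (fls_const (\<kappa> (k + i)) * b i id)"])
    also have "\<dots> = \<iota> q * v' + \<iota> p * v"
      by (simp add: v_def v'_def sum_distrib_left)
    finally have rel: "\<iota> q * v' + \<iota> p * v = 0"
      using \<kappa>(3) by simp
    have v0: "v \<noteq> 0"
    proof
      assume v0: "v = 0"
      then have "v' = 0"
        using rel q by simp
      then have "\<kappa> j = 0" if "j < k" for j
        using ksp_independent_familyD[OF \<beta>i _ that] unfolding v'_def by blast
      moreover have "\<kappa> (k + i) = 0" if "i < n" for i
        using ksp_independent_familyD[OF bi, of "\<lambda>i. \<kappa> (k + i)"] v0 that unfolding v_def by blast
      moreover have "j0 < k \<or> j0 = k + (j0 - k) \<and> j0 - k < n"
        using \<kappa>(1) by linarith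
      ultimately show False
        using \<kappa>(2) by metis
    qed
    have v': "v' \<in> reduced (r + c)"
      unfolding v'_def
    proof (rule reduced_sum)
      fix j assume "j \<in> {..<k}"
      then have "\<beta> j id \<in> reduced (r + c)"
        by (intro weighted_monomial_reduced \<beta>) simp
      from reduced_mult[OF this, of "[:\<kappa> j:]"] show "fls_const (\<kappa> j) * \<beta> j id \<in> reduced (r + c)"
        by (simp add: emb_const[OF e])
    qed
    have v: "v \<in> reduced r"
      unfolding v_def
    proof (rule reduced_sum)
      fix i assume "i \<in> {..<n}"
      then have "b i id \<in> reduced r"
        by (intro weighted_monomial_reduced b) simp
      from reduced_mult[OF this, of "[:\<kappa> (k + i):]"] show "fls_const (\<kappa> (k + i)) * b i id \<in> reduced r"
        by (simp add: emb_const[OF e])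
    qed
    define u where "u = \<iota> y1 * v + \<iota> (- x1) * v'"
    let ?s = "degree y1 + degree x1 + r + c"
    have u: "u \<in> reduced ?s"
      unfolding u_def
      by (intro reduced_add reduced_mono[OF reduced_mult[OF v]] reduced_mono[OF reduced_mult[OF v']]) auto
    have "\<iota> w * v = \<iota> x1 * (\<iota> p * v) + \<iota> q * (\<iota> y1 * v)"
      by (simp add: \<iota>.hom_add \<iota>.hom_mult algebra_simps flip: bez)
    also have "\<iota> p * v = - (\<iota> q * v')"
      using rel by (simp add: eq_neg_iff_add_eq_0 add.commute)
    also have "\<iota> x1 * - (\<iota> q * v') + \<iota> q * (\<iota> y1 * v) = \<iota> q * u"
      by (simp add: u_def \<iota>.hom_uminus algebra_simps)
    finally have "\<iota> w * v = \<iota> q * u" .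
    moreover have "\<iota> w * v \<noteq> 0"
      using v0 w by simp
    ultimately show ?thesis
      using C[OF reduced_mult[OF v, of w] u] by blast
  qed
  then show ?thesis by (intro exI[of _ C]) blast
qed

text \<open>
  The weight \<open>r\<close> is chosen such that the two spaces have dimensions \<open>k \<le> (1 + \<epsilon>/2) n\<close>. If the Wronskian is not
  zero, the order estimate leaves \<open>n (\<epsilon>/2) deg q\<close> on one side and \<open>O(n (r + n))\<close> on the other. Both \<open>r\<close>
  and \<open>n\<close> are \<open>O(1/\<epsilon>^2)\<close>, which accounts for the third power of \<open>1/\<epsilon>\<close>.
\<close>

theorem approximation_degree_bound:
  fixes c0 :: real and c1 :: nat
  assumes c0: "c0 \<ge> 0"
  shows "\<exists>M>0. \<forall>\<epsilon> p q w x1 y1 i0 s. 0 < \<epsilon> \<longrightarrow> \<epsilon> \<le> 1 \<longrightarrow> i0 < d \<longrightarrow> q \<noteq> 0 \<longrightarrow> w \<noteq> 0 \<longrightarrow> degree w \<le> c1 \<longrightarrow>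
    x1 * p + y1 * q = w \<longrightarrow> ord_ge (\<iota> p - \<iota> q * \<rho> i0) s \<longrightarrow>
    real_of_int s \<ge> real e * ((1 + \<epsilon>) * real (degree q) - c0) \<longrightarrow> real (degree q) \<le> M / \<epsilon> ^ 3"
proof -
  obtain C where C: "\<And>r k n \<beta> b p q w x1 y1.
    (\<forall>j<k. weighted_monomial (r + c) (\<beta> j)) \<Longrightarrow> (\<forall>i<n. weighted_monomial r (b i)) \<Longrightarrow>
    inj_on (\<lambda>j. \<beta> j id) {..<k} \<Longrightarrow> ksp.independent ((\<lambda>j. \<beta> j id) ` {..<k}) \<Longrightarrow>
    inj_on (\<lambda>i. b i id) {..<n} \<Longrightarrow> ksp.independent ((\<lambda>i. b i id) ` {..<n}) \<Longrightarrow>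
    q \<noteq> 0 \<Longrightarrow> w \<noteq> 0 \<Longrightarrow> x1 * p + y1 * q = w \<Longrightarrow>
    wronskian (k + n) (\<lambda>j. approx_family k p q \<beta> b j id) = 0 \<Longrightarrow> degree q \<le> degree w + r + C"
    using vanishing_bound by blast
  define A where "A = real (c * d ^ d)"
  define R where "R = real c * ((4 * A + 3) * 4)"
  define M1 where "M1 = c0 + 3 * R + 2 * real c + 9 * (R + 1) * real (d ^ d) * real (degree \<delta>)"
  define M where "M = 2 * M1 + real c1 + R + real C"
  have A: "A > 0"
    using c d by (simp add: A_def)
  have R: "R > 0"
    unfolding R_def using A c by (intro mult_pos_pos) auto
  have M1: "M1 \<ge> 0"
    unfolding M1_def using c0 R by (intro add_nonneg_nonneg mult_nonneg_nonneg) auto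
  have M: "M > 0"
    unfolding M_def using M1 R by (intro add_pos_nonneg add_nonneg_pos) auto
  have "real (degree q) \<le> M / \<epsilon> ^ 3"
    if \<epsilon>: "0 < \<epsilon>" "\<epsilon> \<le> 1" and i0: "i0 < d" and q: "q \<noteq> 0" and w: "w \<noteq> 0" "degree w \<le> c1"
      and bez: "x1 * p + y1 * q = w" and s: "ord_ge (\<iota> p - \<iota> q * \<rho> i0) s"
      and s_ge: "real_of_int s \<ge> real e * ((1 + \<epsilon>) * real (degree q) - c0)"
    for \<epsilon> p q w x1 y1 i0 s
  proof -
    \<comment> \<open>Weights are multiples of \<open>c\<close>, so that multiplication by a root leads from one to the next.\<close>
    have "\<exists>j. real j \<le> (4 * A + 3) / (\<epsilon> / 2)\<^sup>2 \<and>
        real (ksp.dim (weighted_values (Suc j * c))) \<le> (1 + \<epsilon> / 2) * real (ksp.dim (weighted_values (j * c)))"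
    proof (rule linear_growth_ratio)
      fix j
      have "ksp.dim (weighted_values (j * c)) \<le> Suc (j * c) * d ^ d"
        by (rule dim_weighted_values_le)
      also have "\<dots> \<le> c * Suc j * d ^ d"
        using c by (intro mult_right_mono) auto
      also have "c * Suc j * d ^ d = c * d ^ d * Suc j"
        by (simp only: mult_ac)
      finally show "real (ksp.dim (weighted_values (j * c))) \<le> A * real (Suc j)"
        by (simp only: A_def of_nat_mult[symmetric] of_nat_le_iff)
    qed (use \<epsilon> dim_weighted_values_pos in auto)
    then obtain j where j: "real j \<le> (4 * A + 3) / (\<epsilon> / 2)\<^sup>2"
      "real (ksp.dim (weighted_values (Suc j * c))) \<le> (1 + \<epsilon> / 2) * real (ksp.dim (weighted_values (j * c)))" by blast
    define r where "r = j * c"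
    define n where "n = ksp.dim (weighted_values r)"
    define k where "k = ksp.dim (weighted_values (r + c))"
    have rR: "real r \<le> R / \<epsilon>\<^sup>2"
    proof -
      have "real r \<le> (4 * A + 3) / (\<epsilon> / 2)\<^sup>2 * real c"
        unfolding r_def of_nat_mult by (intro mult_right_mono j) simp
      also have "\<dots> = R / \<epsilon>\<^sup>2"
        by (simp add: R_def power_divide)
      finally show ?thesis .
    qed
    have kn: "real k \<le> (1 + \<epsilon> / 2) * real n"
      using j(2) by (simp add: k_def n_def r_def add.commute)
    have n0: "n > 0"
      unfolding n_def by (rule dim_weighted_values_pos)
    have n_le: "real n \<le> (real r + 1) * real (d ^ d)"
    proof -
      have "real n \<le> real (Suc r * d ^ d)"
        by (simp only: n_def of_nat_le_iff dim_weighted_values_le)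
      then show ?thesis by (simp add: algebra_simps)
    qed
    obtain \<beta> where \<beta>: "\<And>j. j < k \<Longrightarrow> weighted_monomial (r + c) (\<beta> j)" "inj_on (\<lambda>j. \<beta> j id) {..<k}"
      "ksp.independent ((\<lambda>j. \<beta> j id) ` {..<k})"
      "ksp.span ((\<lambda>j. \<beta> j id) ` {..<k}) = ksp.span (weighted_values (r + c))"
      using weighted_values_basis[of "r + c", folded k_def] by blast
    obtain b where b: "\<And>i. i < n \<Longrightarrow> weighted_monomial r (b i)" "inj_on (\<lambda>j. b j id) {..<n}"
      "ksp.independent ((\<lambda>j. b j id) ` {..<n})"
      "ksp.span ((\<lambda>j. b j id) ` {..<n}) = ksp.span (weighted_values r)"
      using weighted_values_basis[of r, folded n_def] by blast
    have inv_ge: "1 \<le> 1 / \<epsilon>\<^sup>2" "0 \<le> 1 / \<epsilon>\<^sup>2"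
      using \<epsilon> power_le_one[of \<epsilon> 2] by auto
    have cube: "x / \<epsilon>\<^sup>2 \<le> x / \<epsilon> ^ 3" if "x \<ge> 0" for x
      using \<epsilon> that by (intro divide_left_mono power_decreasing) auto
    show ?thesis
    proof (cases "wronskian (k + n) (\<lambda>j. approx_family k p q \<beta> b j id) = 0")
      case True
      have "degree q \<le> degree w + r + C"
        by (rule C[OF _ _ \<beta>(2,3) b(2,3) q w(1) bez True]) (use \<beta>(1) b(1) in auto)
      then have "real (degree q) \<le> real c1 + real r + real C"
        using w(2) by linarith
      also have "\<dots> \<le> real c1 * (1 / \<epsilon>\<^sup>2) + R * (1 / \<epsilon>\<^sup>2) + real C * (1 / \<epsilon>\<^sup>2)"
        using rR inv_ge mult_left_mono[OF inv_ge(1), of "real c1"] mult_left_mono[OF inv_ge(1), of "real C"]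
        by simp
      also have "\<dots> = (real c1 + R + real C) / \<epsilon>\<^sup>2"
        by (simp add: add_divide_distrib)
      also have "\<dots> \<le> (real c1 + R + real C) / \<epsilon> ^ 3"
        using R by (intro cube) simp
      also have "\<dots> \<le> M / \<epsilon> ^ 3"
        using \<epsilon> M1 by (intro divide_right_mono) (auto simp: M_def)
      finally show ?thesis .
    next
      case False
      define D where "D = real (degree q)"
      define \<delta>' where "\<delta>' = real (degree \<delta>)"
      have D0: "D \<ge> 0" and \<delta>0: "\<delta>' \<ge> 0" by (simp_all add: D_def \<delta>'_def)
      have "int k * (- int e * int (degree q) - int e * int (r + c)) + int n * (s - int e * int r) -
         int (k + n) * int (k + n) * (int e * int (degree \<delta>)) \<le> 0"
        by (rule nonvanishing_bound[OF \<beta>(1) b(1) k_def i0 q s False])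
      then have "real_of_int (int k * (- int e * int (degree q) - int e * int (r + c)) + int n * (s - int e * int r) -
         int (k + n) * int (k + n) * (int e * int (degree \<delta>))) \<le> 0"
        by (simp only: of_int_le_0_iff)
      then have "real n * (real_of_int s - real e * real r) \<le>
         real e * (real k * (D + real r + real c) + (real k + real n)\<^sup>2 * \<delta>')"
        by (simp add: D_def \<delta>'_def algebra_simps power2_eq_square)
      moreover have "real n * (real e * ((1 + \<epsilon>) * D - c0) - real e * real r) \<le> real n * (real_of_int s - real e * real r)"
        using s_ge by (intro mult_left_mono) (auto simp: D_def)
      ultimately have "real e * (real n * ((1 + \<epsilon>) * D - c0 - real r)) \<le>
         real e * (real k * (D + real r + real c) + (real k + real n)\<^sup>2 * \<delta>')"
        by (simp add: algebra_simps)
      then have main: "real n * ((1 + \<epsilon>) * D - c0 - real r) \<le> real k * (D + real r + real c) + (real k + real n)\<^sup>2 * \<delta>'"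
        using e by simp
      have kD: "real k * D \<le> (1 + \<epsilon> / 2) * real n * D"
        using kn D0 by (rule mult_right_mono)
      have k2: "real k \<le> 2 * real n"
        using kn \<epsilon> mult_right_mono[of "1 + \<epsilon> / 2" 2 "real n"] by simp
      then have kr: "real k * (real r + real c) \<le> 2 * real n * (real r + real c)"
        by (intro mult_right_mono) auto
      have "(real k + real n)\<^sup>2 \<le> (3 * real n)\<^sup>2"
        using k2 by (intro power_mono) auto
      then have sq: "(real k + real n)\<^sup>2 * \<delta>' \<le> 9 * real n * real n * \<delta>'"
        using \<delta>0 mult_right_mono[of "(real k + real n)\<^sup>2" "(3 * real n)\<^sup>2" \<delta>'] by (simp add: power2_eq_square)
      have "real n * (\<epsilon> / 2 * D) \<le> real n * (c0 + real r + 2 * (real r + real c) + 9 * real n * \<delta>')"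
        using main kD kr sq by (simp add: algebra_simps)
      then have "\<epsilon> / 2 * D \<le> c0 + 3 * real r + 2 * real c + 9 * real n * \<delta>'"
        using n0 by simp
      also have "\<dots> \<le> c0 * (1 / \<epsilon>\<^sup>2) + 3 * (R * (1 / \<epsilon>\<^sup>2)) + 2 * (real c * (1 / \<epsilon>\<^sup>2)) +
          9 * ((R + 1) * (1 / \<epsilon>\<^sup>2) * real (d ^ d)) * \<delta>'"
      proof (intro add_mono mult_left_mono mult_right_mono)
        show "c0 \<le> c0 * (1 / \<epsilon>\<^sup>2)"
          using mult_left_mono[OF inv_ge(1) c0] by simp
        show "real r \<le> R * (1 / \<epsilon>\<^sup>2)" using rR by simp
        show "real c \<le> real c * (1 / \<epsilon>\<^sup>2)"
          using mult_left_mono[OF inv_ge(1), of "real c"] by simp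
        have "real r + 1 \<le> (R + 1) * (1 / \<epsilon>\<^sup>2)"
          using add_mono[OF rR inv_ge(1)] by (simp add: add_divide_distrib)
        then show "real n \<le> (R + 1) * (1 / \<epsilon>\<^sup>2) * real (d ^ d)"
          using order.trans[OF n_le] by (meson mult_right_mono of_nat_0_le_iff)
      qed (use \<delta>0 in auto)
      also have "\<dots> = M1 / \<epsilon>\<^sup>2"
        by (simp only: M1_def \<delta>'_def divide_inverse mult_1_left) (simp add: algebra_simps)
      finally have "D \<le> 2 * (M1 / \<epsilon>\<^sup>2) / \<epsilon>"
        using \<epsilon> by (simp add: pos_le_divide_eq mult.commute)
      also have "\<dots> = 2 * M1 / \<epsilon> ^ 3"
        by (simp add: power2_eq_square power3_eq_cube)
      also have "\<dots> \<le> M / \<epsilon> ^ 3"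
        using \<epsilon> R by (intro divide_right_mono) (auto simp: M_def)
      finally show ?thesis by (simp add: D_def)
    qed
  qed
  then show ?thesis
    using M by blast
qed

end

section \<open>Integral separable equations\<close>

lemma inj_idom_hom_poly_fls: "inj_idom_hom (poly_fls :: 'a::field poly \<Rightarrow> 'a fls)"
  by standard (simp_all add: poly_fls_add poly_fls_mult)

lemma inj_idom_hom_to_fract: "inj_idom_hom (to_fract :: 'a::idom \<Rightarrow> 'a fract)"
  by standard simp_all

lemma ratfun_fls_to_fract [simp]: "ratfun_fls (to_fract g) = poly_fls g"
  by (simp add: to_fract_def ratfun_fls_Fract)

lemma field_hom_ratfun_fls: "field_hom (ratfun_fls :: 'a::field poly fract \<Rightarrow> 'a fls)"
proof
  show "ratfun_fls 0 = (0 :: 'a fls)" "ratfun_fls 1 = (1 :: 'a fls)"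
    using ratfun_fls_to_fract[of 0] ratfun_fls_to_fract[of 1] by simp_all
  fix x y :: "'a poly fract"
  obtain a b where x: "x = Fract a b" "b \<noteq> 0" by (cases x) auto
  obtain u v where y: "y = Fract u v" "v \<noteq> 0" by (cases y) auto
  show "ratfun_fls (x + y) = ratfun_fls x + ratfun_fls y"
    using x y by (simp add: ratfun_fls_Fract poly_fls_add poly_fls_mult add_frac_eq)
  show "ratfun_fls (x * y) = ratfun_fls x * ratfun_fls y"
    using x y by (simp add: ratfun_fls_Fract poly_fls_mult)
qed

lemma clear_denominators:
  fixes R :: "'a::idom fract poly"
  shows "\<exists>l R'. l \<noteq> 0 \<and> smult (to_fract l) R = map_poly to_fract R'"
proof -
  interpret tf: inj_idom_hom "to_fract :: 'a \<Rightarrow> 'a fract"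
    by (rule inj_idom_hom_to_fract)
  show ?thesis
  proof (induction R)
    case 0
    show ?case by (intro exI[of _ 1] exI[of _ 0]) simp
  next
    case (pCons a R)
    then obtain l R' where l: "l \<noteq> 0" "smult (to_fract l) R = map_poly to_fract R'" by blast
    obtain x y where a: "a = Fract x y" "y \<noteq> 0" by (cases a) auto
    have "to_fract (l * y) * a = to_fract (l * x)"
      using a by (simp add: to_fract_def eq_fract)
    moreover have "smult (to_fract (l * y)) R = map_poly to_fract (smult y R')"
      by (simp add: tf.map_poly_hom_smult mult.commute[of l] flip: l(2))
    ultimately have "smult (to_fract (l * y)) (pCons a R) = map_poly to_fract (pCons (l * x) (smult y R'))"
      by (simp only: smult_pCons tf.map_poly_pCons_hom)
    then show ?case
      using l(1) a(2) by (intro exI[of _ "l * y"] exI[of _ "pCons (l * x) (smult y R')"]) simp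
  qed
qed

text \<open>
  An irreducible polynomial is coprime to its derivative, unless the derivative vanishes. The assumption on
  the degree excludes that case.
\<close>

lemma irreducible_bezout_pderiv:
  fixes P :: "'a::field poly"
  assumes irr: "irreducible P" and nz: "of_nat (degree P) \<noteq> (0 :: 'a)"
  obtains g h where "g * P + h * pderiv P = 1"
proof -
  have deg: "degree P > 0"
    using nz by (cases "degree P") auto
  have "coeff (pderiv P) (degree P - 1) = of_nat (degree P) * lead_coeff P"
    using deg by (simp add: coeff_pderiv)
  then have P': "pderiv P \<noteq> 0"
    using nz deg by auto
  have "coprime P (pderiv P)"
  proof (rule coprimeI)
    fix x assume x: "x dvd P" "x dvd pderiv P"
    have "x dvd 1 \<or> P dvd x"
      using irr x(1) by (metis irreducibleD')
    moreover have "\<not> P dvd x"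
    proof
      assume "P dvd x"
      then have "P dvd pderiv P"
        using x(2) by (rule dvd_trans)
      then have "degree P \<le> degree (pderiv P)"
        using P' by (rule dvd_imp_degree_le)
      then show False
        using degree_pderiv_le[of P] deg by linarith
    qed
    ultimately show "is_unit x" by blast
  qed
  then show thesis
    by (rule coprime_poly_bezout) (rule that)
qed

text \<open>
  With \<open>l\<close> a common denominator of the minimal polynomial \<open>P\<close>, the product \<open>l \<alpha>\<close> is a root of the monic
  polynomial \<open>l^d P(X / l)\<close>, which has coefficients in \<open>K[T]\<close>. The substitution also transports the relation
  \<open>g P + h P' = 1\<close>, and clearing denominators once more gives the relation between polynomials.
\<close>

lemma integral_separable_equation:
  fixes \<alpha> :: "'a::field_char_0 fls"
  assumes alg: "algebraic_of_degree \<alpha> d" and d: "d > 0"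
  shows "\<exists>l Q A B h. l \<noteq> 0 \<and> lead_coeff Q = 1 \<and> degree Q = d \<and>
    poly (map_poly poly_fls Q) (poly_fls l * \<alpha>) = 0 \<and> A * Q + B * pderiv Q = [:h:] \<and> h \<noteq> 0"
proof -
  interpret tf: inj_idom_hom "to_fract :: 'a poly \<Rightarrow> 'a poly fract"
    by (rule inj_idom_hom_to_fract)
  interpret mtf: map_poly_inj_idom_hom "to_fract :: 'a poly \<Rightarrow> 'a poly fract" ..
  interpret rf: field_hom "ratfun_fls :: 'a poly fract \<Rightarrow> 'a fls"
    by (rule field_hom_ratfun_fls)
  obtain P where P: "lead_coeff P = 1" "irreducible P" "poly (map_poly ratfun_fls P) \<alpha> = 0" "degree P = d"
    using alg unfolding algebraic_of_degree_def min_poly_over_ratfun_def by blast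
  have "of_nat (degree P) \<noteq> (0 :: 'a poly fract)"
    using P(4) d by (simp add: of_nat_fract eq_fract Zero_fract_def)
  then obtain g h where gh: "g * P + h * pderiv P = 1"
    using irreducible_bezout_pderiv[OF P(2)] by blast
  obtain l R where l: "l \<noteq> 0" "smult (to_fract l) P = map_poly to_fract R"
    using clear_denominators[of P] by blast
  define L where "L = to_fract l"
  have L: "L \<noteq> 0" using l(1) by (simp add: L_def)
  define r where "r = [:0, inverse L:]"
  define QF where "QF = smult (L ^ d) (pcompose P r)"
  define Q where "Q = monom 1 d + (\<Sum>i<d. monom (l ^ (d - 1 - i) * coeff R i) i)"
  have cQ: "coeff Q i = (if i < d then l ^ (d - 1 - i) * coeff R i else if i = d then 1 else 0)" for i
    by (auto simp: Q_def coeff_sum)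
  have cQF: "coeff QF i = L ^ d * inverse L ^ i * coeff P i" for i
    by (simp add: QF_def r_def coeff_pcompose_linear)
  have QF: "map_poly to_fract Q = QF"
  proof (rule poly_eqI)
    fix i
    consider "i < d" | "i = d" | "i > d" by linarith
    then show "coeff (map_poly to_fract Q) i = coeff QF i"
    proof cases
      case 1
      have "L * coeff P i = to_fract (coeff R i)"
        using arg_cong[OF l(2), of "\<lambda>p. coeff p i"] by (simp add: L_def)
      then have "coeff (map_poly to_fract Q) i = L ^ (d - 1 - i) * (L * coeff P i)"
        using 1 by (simp add: cQ tf.hom_power L_def)
      also have "\<dots> = L ^ (d - i) * coeff P i"
      proof -
        have "L ^ (d - i) = L ^ (d - 1 - i) * L"
          using 1 by (metis Suc_diff_Suc diff_diff_left plus_1_eq_Suc power_Suc2)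
        then show ?thesis by (simp add: mult.assoc)
      qed
      also have "L ^ (d - i) = L ^ d * inverse L ^ i"
        using 1 L by (simp add: power_diff power_inverse divide_inverse)
      finally show ?thesis by (simp add: cQF)
    next
      case 2
      then show ?thesis
        using P(1,4) L by (simp add: cQ cQF power_inverse)
    next
      case 3
      then show ?thesis
        using P(4) by (simp add: cQ cQF coeff_eq_0)
    qed
  qed
  have dQ: "degree Q = d"
  proof (rule antisym)
    show "degree Q \<le> d" by (rule degree_le) (simp add: cQ)
    show "d \<le> degree Q" by (rule le_degree) (simp add: cQ)
  qed
  have lQ: "lead_coeff Q = 1"
    by (simp add: dQ cQ)
  have root: "poly (map_poly poly_fls Q) (poly_fls l * \<alpha>) = 0"
  proof -
    have "map_poly poly_fls Q = map_poly ratfun_fls (map_poly to_fract Q)"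
      by (rule poly_eqI) (simp add: coeff_map_poly)
    also have "\<dots> = smult (ratfun_fls (L ^ d)) (pcompose (map_poly ratfun_fls P) (map_poly ratfun_fls r))"
      by (simp add: QF QF_def rf.map_poly_hom_smult rf.map_poly_pcompose)
    also have "map_poly ratfun_fls r = [:0, inverse (poly_fls l):]"
      by (simp add: r_def L_def rf.map_poly_pCons_hom rf.hom_inverse)
    finally have "poly (map_poly poly_fls Q) (poly_fls l * \<alpha>) =
        ratfun_fls (L ^ d) * poly (map_poly ratfun_fls P) (poly_fls l * \<alpha> * inverse (poly_fls l))"
      by (simp add: poly_pcompose)
    also have "poly_fls l * \<alpha> * inverse (poly_fls l) = \<alpha>"
      using l(1) by simp
    finally show ?thesis
      using P(3) by simp
  qed
  define gF where "gF = smult (inverse (L ^ d)) (pcompose g r)"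
  define hF where "hF = smult (L * inverse (L ^ d)) (pcompose h r)"
  have dQF: "pderiv QF = smult (L ^ d * inverse L) (pcompose (pderiv P) r)"
    by (simp add: QF_def r_def pderiv_smult pderiv_pcompose pderiv_pCons mult.commute)
  have cancel: "smult x p * smult y q = p * q" if "x * y = 1" for x y and p q :: "'a poly fract poly"
    using that by (simp add: mult.commute[of y])
  have "gF * QF = pcompose g r * pcompose P r"
    unfolding gF_def QF_def by (rule cancel) (use L in simp)
  moreover have "hF * pderiv QF = pcompose h r * pcompose (pderiv P) r"
    unfolding hF_def dQF by (rule cancel) (use L in \<open>simp add: field_simps\<close>)
  ultimately have "gF * QF + hF * pderiv QF = pcompose (g * P + h * pderiv P) r"
    by (simp only: pcompose_add pcompose_mult)
  then have bez: "gF * QF + hF * pderiv QF = 1"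
    by (simp add: gh pcompose_1)
  obtain h1 A' where A': "h1 \<noteq> 0" "smult (to_fract h1) gF = map_poly to_fract A'"
    using clear_denominators[of gF] by blast
  obtain h2 B' where B': "h2 \<noteq> 0" "smult (to_fract h2) hF = map_poly to_fract B'"
    using clear_denominators[of hF] by blast
  have "map_poly to_fract (smult h2 A' * Q + smult h1 B' * pderiv Q) =
      smult (to_fract (h1 * h2)) (gF * QF + hF * pderiv QF)"
    by (simp add: mtf.hom_add mtf.hom_mult tf.map_poly_hom_smult tf.map_poly_pderiv QF smult_add_right
        mult.commute flip: A'(2) B'(2))
  also have "\<dots> = map_poly to_fract [:h1 * h2:]"
    by (simp add: bez tf.map_poly_pCons_hom)
  finally have "smult h2 A' * Q + smult h1 B' * pderiv Q = [:h1 * h2:]"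
    by (simp only: mtf.eq_iff)
  then show ?thesis
    using l(1) lQ dQ root A'(1) B'(1)
    by (intro exI[of _ l] exI[of _ Q] exI[of _ "smult h2 A'"] exI[of _ "smult h1 B'"] exI[of _ "h1 * h2"]) simp
qed

section \<open>Extension of the constant field\<close>

text \<open>
  Puiseux's theorem requires an algebraically closed constant field.
\<close>

lift_definition fls_to_ac :: "'a::field fls \<Rightarrow> 'a alg_closure fls" is "\<lambda>f n. to_ac (f n)"
  by (auto elim: eventually_mono)

lemma fls_nth_to_ac [simp]: "fls_nth (fls_to_ac f) n = to_ac (fls_nth f n)"
  by (simp add: fls_to_ac.rep_eq)

lemma fls_to_ac_eq_0_iff [simp]: "fls_to_ac f = 0 \<longleftrightarrow> f = 0"
  by (simp add: fls_eq_iff)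

lemma subdegree_to_ac [simp]: "fls_subdegree (fls_to_ac f) = fls_subdegree f"
proof (cases "f = 0")
  case True
  then have "fls_to_ac f = 0" by simp
  then show ?thesis by (simp only: True fls_zero_subdegree)
next
  case False
  then show ?thesis by (intro fls_subdegree_eqI) auto
qed

lemma fls_to_ac_mult: "fls_to_ac (f * g) = fls_to_ac f * fls_to_ac g"
  by (rule fls_eqI) (simp add: fls_times_nth(2) to_ac_sum)

lemma field_hom_fls_to_ac: "field_hom (fls_to_ac :: 'a::field fls \<Rightarrow> _)"
  by standard (auto intro!: fls_eqI simp: fls_to_ac_mult)

lemma fls_to_ac_poly_fls: "fls_to_ac (poly_fls g) = poly_fls (map_poly to_ac g)"
  by (rule fls_eqI) (simp add: poly_fls_nth coeff_map_poly)

text \<open>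
  The weight \<open>c\<close> is a sum of all the quantities that it has to dominate, and 1 to make it positive.
\<close>

lemma exists_root_system:
  fixes Q :: "'k::{alg_closed_field,field_char_0} poly poly"
  assumes monic: "lead_coeff Q = 1" and d: "degree Q = d" "d > 0"
    and bezout: "A * Q + B * pderiv Q = [:h:]" "h \<noteq> 0"
  shows "\<exists>e c \<rho>. root_system e d c Q A B h \<rho>"
proof -
  interpret pf: inj_idom_hom "poly_fls :: 'k poly \<Rightarrow> 'k fls"
    by (rule inj_idom_hom_poly_fls)
  have "map_poly poly_fls Q \<noteq> 0"
    using d by auto
  then obtain e a R where e: "e > 0"
    and R: "map_poly (\<lambda>x. fls_compose_power x e) (map_poly poly_fls Q) = smult a (\<Prod>x\<in>#R. [:- x, 1:])"
    using puiseux by blast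
  interpret em: inj_idom_hom "emb e :: 'k poly \<Rightarrow> 'k fls"
    by (rule inj_idom_hom_emb) (rule e)
  have "map_poly (\<lambda>x. fls_compose_power x e) (map_poly poly_fls Q) = map_poly (emb e) Q"
    using e by (intro poly_eqI) (simp add: coeff_map_poly emb_def)
  then have R': "map_poly (emb e) Q = smult a (\<Prod>x\<in>#R. [:- x, 1:])"
    using R by simp
  obtain xs where xs: "mset xs = R"
    using ex_mset by blast
  have prod: "(\<Prod>x\<in>#R. [:- x, 1:]) = (\<Prod>i<length xs. [:- (xs ! i), 1:])"
    by (simp add: prod_mset_prod_list prod.list_conv_set_nth lessThan_atLeast0 flip: xs mset_map)
  have lead: "lead_coeff (\<Prod>i<length xs. [:- (xs ! i), 1:]) = 1"
    by (simp add: lead_coeff_prod)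
  have "lead_coeff (map_poly (emb e) Q) = 1"
    using monic by simp
  then have a: "a = 1"
    unfolding R' prod lead_coeff_smult lead by simp
  have "degree (map_poly (emb e) Q) = d"
    using d by simp
  then have len: "length xs = d"
    unfolding R' prod a by (simp add: degree_prod_sum_eq)
  define \<rho> where "\<rho> = (\<lambda>i. xs ! (if i < d then i else 0))"
  have split: "map_poly (emb e) Q = (\<Prod>i<d. [:- \<rho> i, 1:])"
    unfolding R' prod a len by (simp add: \<rho>_def)
  define c where "c = 1 + (\<Sum>i\<le>d. degree (coeff Q i)) + (\<Sum>i<d. nat (- fls_subdegree (xs ! i)))"
  have "root_system e d c Q A B h \<rho>"
  proof
    show "poly (map_poly (emb e) Q) (\<rho> i) = 0" for i
    proof -
      have "\<exists>j<d. \<rho> i = \<rho> j"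
        using d(2) by (intro exI[of _ "if i < d then i else 0"]) (auto simp: \<rho>_def)
      then show ?thesis
        by (auto simp: split poly_prod)
    qed
    show "degree (coeff Q i) \<le> c" for i
    proof (cases "i \<le> d")
      case True
      then have "degree (coeff Q i) \<le> (\<Sum>i\<le>d. degree (coeff Q i))"
        by (intro member_le_sum) auto
      then show ?thesis by (simp add: c_def)
    qed (simp add: coeff_eq_0 d)
    show "ord_ge (\<rho> i) (- int e * int c)" for i
    proof -
      let ?j = "if i < d then i else 0"
      have "nat (- fls_subdegree (xs ! ?j)) \<le> (\<Sum>i<d. nat (- fls_subdegree (xs ! i)))"
        using d(2) by (intro member_le_sum) auto
      then have "nat (- fls_subdegree (xs ! ?j)) \<le> c"
        unfolding c_def by linarith
      then have "- fls_subdegree (\<rho> i) \<le> int c"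
        by (simp only: \<rho>_def nat_le_iff)
      moreover have "int c \<le> int e * int c"
        using e by (simp add: mult_le_cancel_right1)
      ultimately show ?thesis
        by (simp add: ord_ge_iff)
    qed
  qed (use e d monic bezout split in \<open>auto simp: c_def\<close>)
  then show ?thesis by blast
qed

section \<open>Degrees of the solutions\<close>

text \<open>
  The solution \<open>p/q\<close> for \<open>\<alpha>\<close> gives the approximation \<open>l p/q\<close> of the integral element \<open>l \<alpha>\<close>. It is no longer in lowest
  terms, but \<open>l\<close> is a combination of \<open>l p\<close> and \<open>q\<close>.
\<close>

lemma solution_degree_bound:
  fixes \<alpha> :: "'a::field_char_0 fls"
  assumes alg: "algebraic_of_degree \<alpha> d" and d: "d > 0"
  shows "\<exists>M>0. \<forall>\<epsilon> p q. 0 < \<epsilon> \<longrightarrow> \<epsilon> \<le> 1 \<longrightarrow> q \<noteq> 0 \<longrightarrow> coprime p q \<longrightarrow>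
    (\<alpha> \<noteq> poly_fls p / poly_fls q \<longrightarrow>
      (2 + \<epsilon>) * real (degree q) \<le> real_of_int (fls_subdegree (\<alpha> - poly_fls p / poly_fls q))) \<longrightarrow>
    real (degree q) \<le> M / \<epsilon> ^ 3"
proof -
  obtain l Q A B h where Q: "l \<noteq> 0" "lead_coeff Q = 1" "degree Q = d"
    "poly (map_poly poly_fls Q) (poly_fls l * \<alpha>) = 0" "A * Q + B * pderiv Q = [:h:]" "h \<noteq> 0"
    using integral_separable_equation[OF alg d] by blast
  let ?m = "map_poly (to_ac :: 'a \<Rightarrow> 'a alg_closure)"
  interpret ac: field_hom "to_ac :: 'a \<Rightarrow> 'a alg_closure"
    by standard simp_all
  interpret m: map_poly_inj_idom_hom "to_ac :: 'a \<Rightarrow> 'a alg_closure" ..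
  interpret mm: map_poly_inj_idom_hom ?m ..
  let ?mm = "map_poly ?m"
  have "?mm (A * Q + B * pderiv Q) = ?mm [:h:]"
    by (simp only: Q(5))
  then have "?mm A * ?mm Q + ?mm B * pderiv (?mm Q) = [:?m h:]"
    by (simp add: mm.hom_add mm.hom_mult m.map_poly_pderiv m.map_poly_pCons_hom)
  moreover have "lead_coeff (?mm Q) = 1" "degree (?mm Q) = d"
    using Q(2,3) by simp_all
  ultimately obtain e c \<rho> where "root_system e d c (?mm Q) (?mm A) (?mm B) (?m h) \<rho>"
    using exists_root_system[of "?mm Q" d "?mm A" "?mm B" "?m h"] d Q(6) by auto
  then interpret rs: root_system e d c "?mm Q" "?mm A" "?mm B" "?m h" \<rho> .
  have "0 \<le> real (degree l)" by simp
  from rs.approximation_degree_bound[OF this, of "degree l"]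
  obtain M where M: "M > 0" and bound: "\<forall>\<epsilon> p q w x1 y1 i0 s. 0 < \<epsilon> \<longrightarrow> \<epsilon> \<le> 1 \<longrightarrow> i0 < d \<longrightarrow> q \<noteq> 0 \<longrightarrow>
    w \<noteq> 0 \<longrightarrow> degree w \<le> degree l \<longrightarrow> x1 * p + y1 * q = w \<longrightarrow> ord_ge (emb e p - emb e q * \<rho> i0) s \<longrightarrow>
    real_of_int s \<ge> real e * ((1 + \<epsilon>) * real (degree q) - real (degree l)) \<longrightarrow> real (degree q) \<le> M / \<epsilon> ^ 3"
    by (elim exE conjE)
  interpret fa: field_hom "fls_to_ac :: 'a fls \<Rightarrow> _"
    by (rule field_hom_fls_to_ac)
  interpret cp: field_hom "\<lambda>x::'a alg_closure fls. fls_compose_power x e"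
    by (rule field_hom_fls_compose_power) (rule rs.e)
  define \<sigma> where "\<sigma> = (\<lambda>x::'a fls. fls_compose_power (fls_to_ac x) e)"
  interpret \<sigma>: field_hom \<sigma>
    by standard (simp_all add: \<sigma>_def fa.hom_add fa.hom_mult cp.hom_add cp.hom_mult)
  have \<sigma>_poly: "\<sigma> (poly_fls g) = emb e (?m g)" for g
    by (simp add: \<sigma>_def fls_to_ac_poly_fls emb_def)
  have \<sigma>_sub: "fls_subdegree (\<sigma> x) = int e * fls_subdegree x" for x
    by (simp add: \<sigma>_def subdegree_compose_power rs.e)
  have "map_poly \<sigma> (map_poly poly_fls Q) = map_poly (emb e) (?mm Q)"
    by (rule poly_eqI) (simp add: coeff_map_poly \<sigma>_poly)
  then have "poly (map_poly (emb e) (?mm Q)) (\<sigma> (poly_fls l * \<alpha>)) = 0"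
    using \<sigma>.poly_map_poly[of "map_poly poly_fls Q" "poly_fls l * \<alpha>"] Q(4) by simp
  then obtain i0 where i0: "i0 < d" "\<sigma> (poly_fls l * \<alpha>) = \<rho> i0"
    unfolding rs.split by (auto simp: poly_prod)
  have "real (degree q) \<le> M / \<epsilon> ^ 3"
    if \<epsilon>: "0 < \<epsilon>" "\<epsilon> \<le> 1" and q: "q \<noteq> 0" and cop: "coprime p q"
      and close: "\<alpha> \<noteq> poly_fls p / poly_fls q \<longrightarrow>
        (2 + \<epsilon>) * real (degree q) \<le> real_of_int (fls_subdegree (\<alpha> - poly_fls p / poly_fls q))"
    for \<epsilon> p q
  proof -
    obtain x y where xy: "x * p + y * q = 1"
      using cop by (rule coprime_poly_bezout)
    define z where "z = - (poly_fls l * poly_fls q * (\<alpha> - poly_fls p / poly_fls q))"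
    have z: "emb e (?m (l * p)) - emb e (?m q) * \<rho> i0 = \<sigma> z"
    proof -
      have "emb e (?m (l * p)) - emb e (?m q) * \<rho> i0 =
          \<sigma> (poly_fls (l * p) - poly_fls q * (poly_fls l * \<alpha>))"
        by (simp only: \<sigma>.hom_minus \<sigma>.hom_mult[of "poly_fls q"] \<sigma>_poly i0(2))
      also have "poly_fls (l * p) - poly_fls q * (poly_fls l * \<alpha>) = z"
        using q by (simp add: z_def poly_fls_mult field_simps)
      finally show ?thesis .
    qed
    obtain s where s: "ord_ge (\<sigma> z) s"
      "real_of_int s \<ge> real e * ((1 + \<epsilon>) * real (degree q) - real (degree l))"
    proof (cases "z = 0")
      \<comment> \<open>If \<open>\<alpha> = p/q\<close>, every order bound holds, and one is chosen that is large enough.\<close>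
      case True
      show thesis
        by (rule that[of "\<lceil>real e * ((1 + \<epsilon>) * real (degree q) - real (degree l))\<rceil>"]) (simp_all add: True)
    next
      case False
      then have nz: "\<alpha> - poly_fls p / poly_fls q \<noteq> 0"
        by (auto simp: z_def)
      have sub: "fls_subdegree z = - int (degree l) - int (degree q) + fls_subdegree (\<alpha> - poly_fls p / poly_fls q)"
        using nz q Q(1) by (simp add: z_def poly_fls_subdegree)
      have "(1 + \<epsilon>) * real (degree q) - real (degree l) \<le> real_of_int (fls_subdegree z)"
        using close nz by (simp add: sub algebra_simps)
      then have "real e * ((1 + \<epsilon>) * real (degree q) - real (degree l)) \<le> real e * real_of_int (fls_subdegree z)"
        by (intro mult_left_mono) simp_all
      then show thesis
        by (intro that[of "int e * fls_subdegree z"]) (simp_all add: ord_ge_iff \<sigma>_sub)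
    qed
    have "?m x * ?m (l * p) + ?m (l * y) * ?m q = ?m (l * (x * p + y * q))"
      by (simp add: m.hom_mult m.hom_add algebra_simps)
    then have bez: "?m x * ?m (l * p) + ?m (l * y) * ?m q = ?m l"
      by (simp add: xy)
    have "real (degree (?m q)) \<le> M / \<epsilon> ^ 3"
      by (rule bound[rule_format, OF \<epsilon> i0(1) _ _ _ bez, of s]) (use q Q(1) s in \<open>simp_all add: z\<close>)
    then show ?thesis by simp
  qed
  then show ?thesis
    using M by blast
qed

section \<open>Counting\<close>

lemma approx_solutionsD:
  assumes "(p, q) \<in> approx_solutions \<mu> \<alpha> \<epsilon>" "\<mu> > 1" "\<alpha> \<noteq> poly_fls p / poly_fls q"
  shows "(2 + \<epsilon>) * real (degree q) < real_of_int (fls_subdegree (\<alpha> - poly_fls p / poly_fls q))"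
proof -
  let ?v = "fls_subdegree (\<alpha> - poly_fls p / poly_fls q)"
  have q: "q \<noteq> 0" and "laurent_abs \<mu> (\<alpha> - poly_fls p / poly_fls q) < 1 / laurent_abs \<mu> (poly_fls q) powr (2 + \<epsilon>)"
    using assms(1) by (auto simp: approx_solutions_def)
  then have "\<mu> powi (- ?v) < 1 / (\<mu> powi int (degree q)) powr (2 + \<epsilon>)"
    using assms(3) by (simp add: laurent_abs_def poly_fls_subdegree)
  also have "\<mu> powi (- ?v) = \<mu> powr (- real_of_int ?v)"
    using assms(2) powr_real_of_int'[of \<mu> "- ?v"] by simp
  also have "1 / (\<mu> powi int (degree q)) powr (2 + \<epsilon>) = \<mu> powr (- (real (degree q) * (2 + \<epsilon>)))"
    using assms(2) powr_realpow[of \<mu> "degree q"] by (simp add: powr_powr powr_minus_divide flip: powr_realpow)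
  finally have "- real_of_int ?v < - (real (degree q) * (2 + \<epsilon>))"
    using assms(2) by simp
  then show ?thesis by (simp add: mult.commute)
qed

lemma poly_eq_0_if_ord_pos:
  assumes "ord_ge (poly_fls g) 1"
  shows "g = 0"
  using assms by (cases "g = 0") (auto simp: ord_ge_iff poly_fls_subdegree)

text \<open>
  Multiplied by \<open>q q'\<close>, the difference of the two fractions is a polynomial in \<open>T\<close> of positive order at
  infinity, hence zero. Coprimality then makes the two pairs proportional.
\<close>

lemma equal_degree_solutions:
  fixes \<alpha> :: "'a::field fls"
  assumes x: "(p, q) \<in> approx_solutions \<mu> \<alpha> \<epsilon>" and y: "(p', q') \<in> approx_solutions \<mu> \<alpha> \<epsilon>"
    and \<mu>: "\<mu> > 1" and \<epsilon>: "\<epsilon> > 0" and deg: "degree q = degree q'"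
  shows "((p, q), (p', q')) \<in> scalar_rel"
proof -
  have q: "q \<noteq> 0" "q' \<noteq> 0" and cop: "coprime p q" "coprime p' q'"
    using x y by (auto simp: approx_solutions_def)
  let ?D = "2 * int (degree q)"
  have close: "ord_ge (\<alpha> - poly_fls u / poly_fls v) (?D + 1)"
    if "(u, v) \<in> approx_solutions \<mu> \<alpha> \<epsilon>" "degree v = degree q" for u v
  proof (cases "\<alpha> = poly_fls u / poly_fls v")
    case False
    have "real_of_int ?D \<le> (2 + \<epsilon>) * real (degree q)"
      using \<epsilon> by (simp add: distrib_right)
    also have "\<dots> < real_of_int (fls_subdegree (\<alpha> - poly_fls u / poly_fls v))"
      using approx_solutionsD[OF that(1) \<mu> False] that(2) by simp
    finally have "?D < fls_subdegree (\<alpha> - poly_fls u / poly_fls v)"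
      by (simp only: of_int_less_iff)
    then show ?thesis by (simp add: ord_ge_iff)
  qed simp
  have "ord_ge (- 1 * (\<alpha> - poly_fls p / poly_fls q)) (0 + (?D + 1))"
    by (intro ord_ge_mult close x) (simp_all add: ord_ge_iff)
  then have "ord_ge ((\<alpha> - poly_fls p' / poly_fls q') + - 1 * (\<alpha> - poly_fls p / poly_fls q)) (?D + 1)"
    using close[OF y] deg by (intro ord_ge_add) simp_all
  moreover have "ord_ge (poly_fls q * poly_fls q') (- ?D)"
    using q deg by (simp add: ord_ge_iff poly_fls_subdegree)
  ultimately have "ord_ge (poly_fls q * poly_fls q' *
      ((\<alpha> - poly_fls p' / poly_fls q') + - 1 * (\<alpha> - poly_fls p / poly_fls q))) (- ?D + (?D + 1))"
    by (intro ord_ge_mult)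
  moreover have "poly_fls q * poly_fls q' *
      ((\<alpha> - poly_fls p' / poly_fls q') + - 1 * (\<alpha> - poly_fls p / poly_fls q)) =
      poly_fls p * poly_fls q' - poly_fls p' * poly_fls q"
    using q by (simp add: field_simps)
  moreover have "poly_fls p * poly_fls q' - poly_fls p' * poly_fls q = poly_fls (p * q' - p' * q)"
  proof -
    interpret inj_idom_hom "poly_fls :: 'a poly \<Rightarrow> 'a fls"
      by (rule inj_idom_hom_poly_fls)
    show ?thesis by (simp add: hom_minus hom_mult)
  qed
  ultimately have "ord_ge (poly_fls (p * q' - p' * q)) 1"
    by simp
  then have cross: "p * q' = p' * q"
    using poly_eq_0_if_ord_pos by fastforce
  obtain g h where "g * p + h * q = 1"
    using cop(1) by (rule coprime_poly_bezout)
  then have "q' = (g * p + h * q) * q'"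
    by simp
  also have "\<dots> = g * (p * q') + h * q' * q"
    by (simp add: algebra_simps)
  also have "\<dots> = (g * p' + h * q') * q"
    unfolding cross by (simp add: algebra_simps)
  finally have "q' = (g * p' + h * q') * q" .
  then have "q dvd q'"
    by (rule dvdI[where k = "g * p' + h * q'", OF trans[OF _ mult.commute]])
  then obtain t where t: "q' = q * t" by (elim dvdE)
  then have "t \<noteq> 0" "degree t = 0"
    using q deg by (auto simp: degree_mult_eq)
  then obtain a where a: "t = [:a:]" "a \<noteq> 0"
    by (metis degree_eq_zeroE pCons_0_0)
  have "q * (p * t) = q * p'"
    using cross by (simp add: t mult_ac)
  then have "p' = p * t"
    using q(1) by simp
  then show ?thesis
    using a t unfolding scalar_rel_def by (auto intro!: exI[of _ a])
qed

text \<open>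
  The degree of the denominator determines the class.
\<close>

lemma card_classes_le:
  fixes \<alpha> :: "'a::field fls"
  assumes \<mu>: "\<mu> > 1" and \<epsilon>: "\<epsilon> > 0"
    and N: "\<And>p q. (p, q) \<in> approx_solutions \<mu> \<alpha> \<epsilon> \<Longrightarrow> degree q \<le> N"
  shows "finite (approx_solutions \<mu> \<alpha> \<epsilon> // scalar_rel)" "card (approx_solutions \<mu> \<alpha> \<epsilon> // scalar_rel) \<le> Suc N"
proof -
  let ?S = "approx_solutions \<mu> \<alpha> \<epsilon>"
  define rep where "rep = (\<lambda>n. SOME x. x \<in> ?S \<and> degree (snd x) = n)"
  have rep: "rep (degree (snd x)) \<in> ?S \<and> degree (snd (rep (degree (snd x)))) = degree (snd x)" if "x \<in> ?S" for x
    using someI[of "\<lambda>y. y \<in> ?S \<and> degree (snd y) = degree (snd x)" x] that by (simp add: rep_def)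
  have sub: "?S // scalar_rel \<subseteq> (\<lambda>n. scalar_rel `` {rep n}) ` {..N}"
  proof
    fix C assume "C \<in> ?S // scalar_rel"
    then obtain x where x: "x \<in> ?S" "C = scalar_rel `` {x}"
      by (elim quotientE)
    let ?y = "rep (degree (snd x))"
    have "(x, ?y) \<in> scalar_rel"
      using equal_degree_solutions[of "fst x" "snd x" \<mu> \<alpha> \<epsilon> "fst ?y" "snd ?y"] x(1) rep[OF x(1)] \<mu> \<epsilon> by simp
    then have "C = scalar_rel `` {?y}"
      unfolding x(2) by (rule equiv_class_eq[OF equiv_scalar_rel])
    moreover have "degree (snd x) \<le> N"
      using N[of "fst x" "snd x"] x(1) by simp
    ultimately show "C \<in> (\<lambda>n. scalar_rel `` {rep n}) ` {..N}"
      by (intro image_eqI[of _ _ "degree (snd x)"]) simp_all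
  qed
  show "finite (?S // scalar_rel)"
    using sub by (rule finite_subset) simp
  have "card (?S // scalar_rel) \<le> card ((\<lambda>n. scalar_rel `` {rep n}) ` {..N})"
    using sub by (intro card_mono) simp_all
  also have "\<dots> \<le> card {..N}"
    by (rule card_image_le) simp
  finally show "card (?S // scalar_rel) \<le> Suc N" by simp
qed

theorem theorem6:
  fixes \<alpha> :: "'a::field_char_0 fls" and d :: nat
  assumes "algebraic_of_degree \<alpha> d" and "d \<ge> 2"
  shows "\<exists>C>0. \<forall>\<mu>>1. \<forall>\<epsilon>::real. 0 < \<epsilon> \<and> \<epsilon> \<le> 1 / 3 \<longrightarrow>
    finite (approx_solutions \<mu> \<alpha> \<epsilon> // scalar_rel) \<and>
    real (card (approx_solutions \<mu> \<alpha> \<epsilon> // scalar_rel)) < exp (C * (real d)\<^sup>2 * \<epsilon> powi (-2))"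
proof -
  have "d > 0" using assms(2) by simp
  from solution_degree_bound[OF assms(1) this]
  obtain M where M: "M > 0" and bound: "\<forall>\<epsilon> p q. 0 < \<epsilon> \<longrightarrow> \<epsilon> \<le> 1 \<longrightarrow> q \<noteq> 0 \<longrightarrow> coprime p q \<longrightarrow>
    (\<alpha> \<noteq> poly_fls p / poly_fls q \<longrightarrow>
      (2 + \<epsilon>) * real (degree q) \<le> real_of_int (fls_subdegree (\<alpha> - poly_fls p / poly_fls q))) \<longrightarrow>
    real (degree q) \<le> M / \<epsilon> ^ 3" by (elim exE conjE)
  have "finite (approx_solutions \<mu> \<alpha> \<epsilon> // scalar_rel) \<and>
    real (card (approx_solutions \<mu> \<alpha> \<epsilon> // scalar_rel)) < exp ((M + 1) * (real d)\<^sup>2 * \<epsilon> powi (-2))"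
    if \<mu>: "\<mu> > 1" and \<epsilon>: "0 < \<epsilon>" "\<epsilon> \<le> 1 / 3" for \<mu> \<epsilon> :: real
  proof -
    let ?S = "approx_solutions \<mu> \<alpha> \<epsilon>"
    define N where "N = nat \<lfloor>M / \<epsilon> ^ 3\<rfloor>"
    have N: "degree q \<le> N" if "(p, q) \<in> ?S" for p q
    proof -
      have "real (degree q) \<le> M / \<epsilon> ^ 3"
      proof (rule bound[rule_format, of \<epsilon> q p])
        show "q \<noteq> 0" "coprime p q"
          using that by (auto simp: approx_solutions_def)
        show "(2 + \<epsilon>) * real (degree q) \<le> real_of_int (fls_subdegree (\<alpha> - poly_fls p / poly_fls q))"
          if "\<alpha> \<noteq> poly_fls p / poly_fls q"
          using approx_solutionsD[OF \<open>(p, q) \<in> ?S\<close> \<mu> that] by simp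
      qed (use \<epsilon> in auto)
      then show ?thesis
        unfolding N_def by (simp add: le_nat_floor)
    qed
    have classes: "finite (?S // scalar_rel)" "card (?S // scalar_rel) \<le> Suc N"
      by (rule card_classes_le[where N = N, OF \<mu> \<epsilon>(1)], erule N)+
    define x where "x = \<epsilon> powi (-2)"
    have x: "x = 1 / \<epsilon>\<^sup>2"
      by (simp add: x_def power_int_minus field_simps)
    have x1: "x \<ge> 1"
      using \<epsilon> power_le_one[of \<epsilon> 2] by (simp add: x)
    have "M / \<epsilon> ^ 3 \<le> M * x\<^sup>2"
    proof -
      have "M / \<epsilon> ^ 3 \<le> M / \<epsilon> ^ 4"
        using \<epsilon> M by (intro divide_left_mono power_decreasing) auto
      also have "\<dots> = M * x\<^sup>2"
        by (simp add: x power_divide flip: power_mult)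
      finally show ?thesis .
    qed
    moreover have "real N \<le> M / \<epsilon> ^ 3"
      using M \<epsilon> by (simp add: N_def)
    ultimately have N_le: "real N \<le> M * x\<^sup>2" by linarith
    define y where "y = (M + 1) * (real d)\<^sup>2 * x"
    \<comment> \<open>The factor 4 comes from \<open>d \<ge> 2\<close>; it leaves room to absorb \<open>M x^2\<close> in \<open>y^2 / 2\<close>.\<close>
    have y: "y \<ge> 4 * ((M + 1) * x)"
    proof -
      have "(2::real)\<^sup>2 \<le> (real d)\<^sup>2"
        using assms(2) by (intro power_mono) auto
      then have "((M + 1) * x) * 4 \<le> ((M + 1) * x) * (real d)\<^sup>2"
        using M x1 by (intro mult_left_mono) auto
      then show ?thesis by (simp add: y_def mult_ac)
    qed
    have "M * x\<^sup>2 \<le> ((M + 1) * x)\<^sup>2"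
    proof -
      have "M \<le> (M + 1)\<^sup>2"
        using M by (simp add: power2_eq_square algebra_simps)
      then show ?thesis
        by (simp add: power_mult_distrib mult_right_mono)
    qed
    also have "\<dots> \<le> y\<^sup>2 / 16"
    proof -
      have "(4 * ((M + 1) * x))\<^sup>2 \<le> y\<^sup>2"
        using y M x1 by (intro power_mono) auto
      then show ?thesis by (simp add: power_mult_distrib)
    qed
    finally have Ny: "real N \<le> y\<^sup>2 / 16"
      using N_le by linarith
    have y0: "y > 0"
      using y M x1 by (smt (verit) mult_pos_pos)
    have "real (card (?S // scalar_rel)) \<le> real N + 1"
      using classes(2) by linarith
    also have "\<dots> < 1 + y + y\<^sup>2 / 2"
      using Ny y0 zero_less_power[OF y0, of 2] by linarith
    also have "\<dots> \<le> exp y"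
      using y0 by (intro exp_lower_Taylor_quadratic) simp
    finally show ?thesis
      using classes(1) by (simp add: y_def x_def)
  qed
  then show ?thesis
    using M by (intro exI[of _ "M + 1"]) auto
qed

end
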